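(* Let $\mathbb{D}$ be a non-dictatorial, unidimensional domain. Then the following two statements hold. (i) There exists an anonymous, tops-only and strategy-proof rule on $\mathbb{D}$ (with some number $n\ge 2$ of voters), (a) if and only if $\mathbb{D}$ is a semi-single-peaked domain, and (b) if and only if $\mathbb{D}$ admits a strategy-proof projection rule. (ii) There exists no anonymous, tops-only and strategy-proof rule on $\mathbb{D}$ (for any number $n\geq 2$ of voters) if and only if $\mathbb{D}$ is a semi-hybrid domain satisfying the unique seconds property. Furthermore, in this case, every tops-only and strategy-proof rule $f:\mathbb{D}^n\to A$, $n\ge2$, behaves like a dictatorship on a weak superset of the free zone (that is, whenever $\mathbb{D}$ is an $(a,b)$-semi-hybrid domain on a tree $\mathcal{T}^A$, on some set $B\supseteq\langle a,b|\mathcal{T}^A\rangle$).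
   Context: **Model.** $A$ is a finite set of alternatives, $|A|=m\ge 3$. A preference is a linear order $P_i$ on $A$; $r_k(P_i)$ is its $k$-th ranked alternative, $r_1(P_i)$ its peak, $\max^{P_i}(B)$ the $P_i$-best element of $B\subseteq A$. A domain $\mathbb{D}$ is a set of preferences; $\mathbb{D}^a=\{P_i\in\mathbb{D}:r_1(P_i)=a\}$. Voters: $N=\{1,\dots,n\}$, $n\ge2$. An SCF is a map $f:\mathbb{D}^n\to A$; it is a rule if unanimous ($f(P)=a$ whenever all peaks at $P$ equal $a$); strategy-proof if for all $i$, $P_i,P_i'\in\mathbb{D}$, $P_{-i}\in\mathbb{D}^{n-1}$, either $f(P_i,P_{-i})=f(P_i',P_{-i})$ or $f(P_i,P_{-i})\mathrel{P_i}f(P_i',P_{-i})$; tops-only if $f(P)=f(P')$ whenever $r_1(P_i)=r_1(P_i')$ for all $i$; anonymous if $f(P_1,\dots,P_n)=f(P_{\sigma(1)},\dots,P_{\sigma(n)})$ for all profiles and all permutations $\sigma$ of $N$; a dictatorship if for some $i$, $f(P)=r_1(P_i)$ for all $P$. $f$ behaves like a dictatorship on a nonempty $B\subseteq A$ if for some $i$, $f(P)=r_1(P_i)$ for all $P\in\mathbb{D}^n$ with all peaks in $B$. $\mathbb{D}$ is non-dictatorial if for some $n\ge2$ it admits a strategy-proof rule that is not a dictatorship. **Unidimensional domains.** $a\ne b$ are adjacent ($a\sim b$) if there are $P_i,P_i'\in\mathbb{D}$ with $r_1(P_i)=r_2(P_i')=a$, $r_1(P_i')=r_2(P_i)=b$,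 $r_k(P_i)=r_k(P_i')$ for $k\ge3$. The adjacency graph $G_\sim^A$ has vertex set $A$ and edges the adjacent pairs; for $B\subseteq A$, $G_\sim^B$ is the induced subgraph on $B$. $\mathrm{Leaf}(G)$ is the set of vertices with exactly one neighbor in a graph $G$; $\mathcal{N}_\sim^A(x)$ is the set of neighbors of $x$ in $G_\sim^A$. Path-connectedness: $G_\sim^A$ is connected. Diversity: $\mathbb{D}$ contains two completely reversed preferences ($a\mathrel{P_i}b\Leftrightarrow b\mathrel{P_i'}a$ for all $a\neq b$). With $\mathcal{S}(\mathbb{D}^a)=\{r_2(P_i):P_i\in\mathbb{D}^a\}$, leaf symmetry: for each $x\in\mathrm{Leaf}(G_\sim^A)$ with $|\mathcal{S}(\mathbb{D}^x)|>1$ there is $z\in\mathcal{S}(\mathbb{D}^x)$ with $z\notin\mathcal{N}_\sim^A(x)$ and $x\in\mathcal{S}(\mathbb{D}^z)$. A domain is unidimensional if it satisfies path-connectedness, diversity and leaf symmetry. Unique seconds property: $|\mathcal{S}(\mathbb{D}^x)|=1$ for some $x\in A$. **Trees.** $\mathcal{T}^A$ denotes a tree with vertex set $A$; $\langle x,y|\mathcal{T}^A\rangle$ is the unique path between $x$ and $y$ (also its vertex set). For a subtree with vertex set $B$, $\mathrm{Proj}(a,\mathcal{T}^B)$ is $a$ if $a\in B$, and otherwise the unique $a'\in B$ lying on $\langle a,b|\mathcal{T}^A\rangle$ for all $b\in B$. For a profile $P$, $\mathcal{T}^{\Gamma(P)}$ is the minimal subtree containing all voters' peaks. For $x\ne y$,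 $A^{x\rightharpoonup y}=\{z\in A: x\in\langle z,y|\mathcal{T}^A\rangle\}$. Distinct $a,b$ are dual-thresholds in $\mathcal{T}^A$ if $\mathrm{Proj}(c,\langle a,b|\mathcal{T}^A\rangle)\in\{a,b\}$ for all $c\in A\setminus\langle a,b|\mathcal{T}^A\rangle$. **Semi-single-peakedness.** $P_i$ is semi-single-peaked on $\mathcal{T}^A$ w.r.t. a threshold $\bar{x}\in A$ if (1) for distinct $a,b\in\langle r_1(P_i),\bar{x}|\mathcal{T}^A\rangle$, $a\in\langle r_1(P_i),b|\mathcal{T}^A\rangle$ implies $a\mathrel{P_i}b$; and (2) for $a\notin\langle r_1(P_i),\bar{x}|\mathcal{T}^A\rangle$ with projection $a'$ on that path, $a'\mathrel{P_i}a$. $\mathbb{D}_{\mathrm{SSP}}(\mathcal{T}^A,\bar{x})$ is the set of all such preferences. $\mathbb{D}$ is a semi-single-peaked domain if $\mathbb{D}\subseteq\mathbb{D}_{\mathrm{SSP}}(\mathcal{T}^A,\bar{x})$ for some tree $\mathcal{T}^A$ and $\bar x\in A$, and $G_\sim^A$ is connected. **Semi-hybridness.** Given dual-thresholds $a,b$ in $\mathcal{T}^A$, $P_i$ is $(a,b)$-semi-hybrid on $\mathcal{T}^A$ if: (1) if $r_1(P_i)\in A^{a\rightharpoonup b}\setminus\{a\}$, then $P_i$ is semi-single-peaked on $\mathcal{T}^A$ w.r.t. $a$ and $\max^{P_i}(A^{b\rightharpoonup a})=b$; (2) if $r_1(P_i)\in A^{b\rightharpoonup a}\setminus\{b\}$,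 then $P_i$ is semi-single-peaked on $\mathcal{T}^A$ w.r.t. $b$ and $\max^{P_i}(A^{a\rightharpoonup b})=a$; (3) if $r_1(P_i)\in\langle a,b|\mathcal{T}^A\rangle$, then $\max^{P_i}(A^{a\rightharpoonup b})=a$ and $\max^{P_i}(A^{b\rightharpoonup a})=b$. $\mathbb{D}_{\mathrm{SH}}(\mathcal{T}^A,a,b)$ is the set of all such preferences. $\mathbb{D}$ is an $(a,b)$-semi-hybrid domain on $\mathcal{T}^A$ ($a,b$ dual-thresholds in $\mathcal{T}^A$) if: (i) $\mathbb{D}\subseteq\mathbb{D}_{\mathrm{SH}}(\mathcal{T}^A,a,b)$ and $G_\sim^A$ is connected; (ii) there are no tree $\widehat{\mathcal{T}}^A$ and dual-thresholds $\hat a,\hat b$ in it with $\mathbb{D}\subseteq\mathbb{D}_{\mathrm{SH}}(\widehat{\mathcal{T}}^A,\hat a,\hat b)$ and $\langle\hat a,\hat b|\widehat{\mathcal{T}}^A\rangle\subsetneq\langle a,b|\mathcal{T}^A\rangle$ as vertex sets; (iii) if $G_\sim^A$ is a tree, then for each $x\in\mathrm{Leaf}(G_\sim^{\langle a,b|\mathcal{T}^A\rangle})$ some $P_i\in\mathbb{D}$ is not semi-single-peaked on $G_\sim^A$ w.r.t. $x$. The set $\langle a,b|\mathcal{T}^A\rangle$ is then called the free zone. $\mathbb{D}$ is a semi-hybrid domain if it is so for some $\mathcal{T}^A,a,b$. **Projection rule.** $f:\mathbb{D}^n\to A$ is a projection rule if there are a tree $\mathcal{T}^A$ and $\bar x\in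 A$ with $f(P)=\mathrm{Proj}(\bar x,\mathcal{T}^{\Gamma(P)})$ for all $P\in\mathbb{D}^n$. *)

theory Defs
  imports "HOL.Hull" "HOL-Library.FuncSet" "HOL-Library.Cardinality" "HOL-Combinatorics.Permutations"
begin

text \<open>
  The set of alternatives is a finite type \<open>'a\<close>. A preference is a linear order on
  \<open>'a\<close>, and \<open>(a, b) \<in> P\<close> means that \<open>a\<close> is at least as good as \<open>b\<close>, i.e. the most
  preferred alternative comes first. The orders are reflexive, so between distinct alternatives
  membership in \<open>P\<close> is strict preference; every use below compares distinct
  alternatives or is a disjunction that already includes equality.
\<close>

type_synonym 'a pref = "'a rel"

definition preference_domain :: "'a pref set \<Rightarrow> bool" where
  "preference_domain D \<longleftrightarrow> (\<forall>P\<in>D. linear_order P)"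

text \<open>The \<open>k\<close>-th ranked alternative, counting from 1; unspecified unless \<open>1 \<le> k \<le> CARD('a)\<close>.\<close>

definition ranked :: "nat \<Rightarrow> 'a pref \<Rightarrow> 'a" where
  "ranked k P = (THE x. card {y. (y, x) \<in> P} = k)"

abbreviation peak :: "'a pref \<Rightarrow> 'a" where
  "peak P \<equiv> ranked 1 P"

definition best :: "'a pref \<Rightarrow> 'a set \<Rightarrow> 'a" where
  "best P B = (THE x. x \<in> B \<and> (\<forall>y\<in>B. (x, y) \<in> P))"

definition seconds :: "'a pref set \<Rightarrow> 'a \<Rightarrow> 'a set" where
  "seconds D x = ranked 2 ` {P \<in> D. peak P = x}"

definition unique_seconds :: "'a pref set \<Rightarrow> bool" where
  "unique_seconds D \<longleftrightarrow> (\<exists>x. card (seconds D x) = 1)"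

text \<open>
  The voters are \<open>{1..n}\<close>. A social choice function on \<open>D\<close> with \<open>n\<close> voters is a function on
  \<open>profiles D n\<close>; it is represented by a total function of which only the values on
  \<open>profiles D n\<close> are ever used.
\<close>

definition profiles :: "'a pref set \<Rightarrow> nat \<Rightarrow> (nat \<Rightarrow> 'a pref) set" where
  "profiles D n = {1..n} \<rightarrow>\<^sub>E D"

type_synonym 'a scf = "(nat \<Rightarrow> 'a pref) \<Rightarrow> 'a"

definition is_rule :: "'a pref set \<Rightarrow> nat \<Rightarrow> 'a scf \<Rightarrow> bool" where
  "is_rule D n f \<longleftrightarrow>
     (\<forall>P\<in>profiles D n. \<forall>a. (\<forall>i\<in>{1..n}. peak (P i) = a) \<longrightarrow> f P = a)"

definition strategy_proof :: "'a pref set \<Rightarrow> nat \<Rightarrow> 'a scf \<Rightarrow> bool" where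
  "strategy_proof D n f \<longleftrightarrow>
     (\<forall>P\<in>profiles D n. \<forall>i\<in>{1..n}. \<forall>Q\<in>D.
        f P = f (P(i := Q)) \<or> (f P, f (P(i := Q))) \<in> P i)"

definition tops_only :: "'a pref set \<Rightarrow> nat \<Rightarrow> 'a scf \<Rightarrow> bool" where
  "tops_only D n f \<longleftrightarrow>
     (\<forall>P\<in>profiles D n. \<forall>Q\<in>profiles D n.
        (\<forall>i\<in>{1..n}. peak (P i) = peak (Q i)) \<longrightarrow> f P = f Q)"

definition anonymous :: "'a pref set \<Rightarrow> nat \<Rightarrow> 'a scf \<Rightarrow> bool" where
  "anonymous D n f \<longleftrightarrow>
     (\<forall>P\<in>profiles D n. \<forall>\<sigma>. \<sigma> permutes {1..n} \<longrightarrow> f P = f (P \<circ> \<sigma>))"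

definition dictatorship :: "'a pref set \<Rightarrow> nat \<Rightarrow> 'a scf \<Rightarrow> bool" where
  "dictatorship D n f \<longleftrightarrow> (\<exists>i\<in>{1..n}. \<forall>P\<in>profiles D n. f P = peak (P i))"

definition dictatorship_on :: "'a pref set \<Rightarrow> nat \<Rightarrow> 'a scf \<Rightarrow> 'a set \<Rightarrow> bool" where
  "dictatorship_on D n f B \<longleftrightarrow>
     B \<noteq> {} \<and>
     (\<exists>i\<in>{1..n}. \<forall>P\<in>profiles D n. (\<forall>j\<in>{1..n}. peak (P j) \<in> B) \<longrightarrow> f P = peak (P i))"

definition non_dictatorial :: "'a pref set \<Rightarrow> bool" where
  "non_dictatorial D \<longleftrightarrow>
     (\<exists>n\<ge>2. \<exists>f. is_rule D n f \<and> strategy_proof D n f \<and> \<not> dictatorship D n f)"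

text \<open>
  An undirected graph with vertex set \<open>'a\<close> is a symmetric irreflexive relation \<open>E\<close>. The
  functions that take a set \<open>B\<close> refer to the subgraph induced by \<open>E\<close> on \<open>B\<close>.
\<close>

definition connected_in :: "'a rel \<Rightarrow> 'a set \<Rightarrow> bool" where
  "connected_in E B \<longleftrightarrow> (\<forall>x\<in>B. \<forall>y\<in>B. (x, y) \<in> (Restr E B)\<^sup>*)"

definition neighbors_in :: "'a rel \<Rightarrow> 'a set \<Rightarrow> 'a \<Rightarrow> 'a set" where
  "neighbors_in E B x = {y \<in> B. (x, y) \<in> E}"

definition leaves_in :: "'a rel \<Rightarrow> 'a set \<Rightarrow> 'a set" where
  "leaves_in E B = {x \<in> B. card (neighbors_in E B x) = 1}"

definition is_path :: "'a rel \<Rightarrow> 'a list \<Rightarrow> bool" where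
  "is_path E p \<longleftrightarrow> p \<noteq> [] \<and> distinct p \<and> successively (\<lambda>u v. (u, v) \<in> E) p"

definition has_cycle :: "'a rel \<Rightarrow> bool" where
  "has_cycle E \<longleftrightarrow> (\<exists>p. is_path E p \<and> length p \<ge> 3 \<and> (last p, hd p) \<in> E)"

definition is_tree :: "'a rel \<Rightarrow> bool" where
  "is_tree E \<longleftrightarrow> sym E \<and> irrefl E \<and> connected_in E UNIV \<and> \<not> has_cycle E"

text \<open>Only meaningful for trees, where the path between \<open>x\<close> and \<open>y\<close> is unique.\<close>

definition path_verts :: "'a rel \<Rightarrow> 'a \<Rightarrow> 'a \<Rightarrow> 'a set" where
  "path_verts T x y = set (THE p. is_path T p \<and> hd p = x \<and> last p = y)"

text \<open>
  In a tree, the subtrees correspond to the nonempty vertex sets that induce a connected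
  subgraph, and a subtree is represented by its vertex set. The subtree spanned by \<open>S\<close> is the
  smallest one that contains \<open>S\<close>.
\<close>

definition subtree :: "'a rel \<Rightarrow> 'a set \<Rightarrow> bool" where
  "subtree T B \<longleftrightarrow> B \<noteq> {} \<and> connected_in T B"

definition spanned_subtree :: "'a rel \<Rightarrow> 'a set \<Rightarrow> 'a set" where
  "spanned_subtree T S = subtree T hull S"

definition proj :: "'a rel \<Rightarrow> 'a \<Rightarrow> 'a set \<Rightarrow> 'a" where
  "proj T a B =
     (if a \<in> B then a else THE a'. a' \<in> B \<and> (\<forall>b\<in>B. a' \<in> path_verts T a b))"

text \<open>\<open>beyond T x y\<close> is the set of alternatives separated from \<open>y\<close> by \<open>x\<close>, including \<open>x\<close> itself.\<close>

definition beyond :: "'a rel \<Rightarrow> 'a \<Rightarrow> 'a \<Rightarrow> 'a set" where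
  "beyond T x y = {z. x \<in> path_verts T z y}"

definition dual_thresholds :: "'a rel \<Rightarrow> 'a \<Rightarrow> 'a \<Rightarrow> bool" where
  "dual_thresholds T a b \<longleftrightarrow>
     a \<noteq> b \<and> (\<forall>c. c \<notin> path_verts T a b \<longrightarrow> proj T c (path_verts T a b) \<in> {a, b})"

definition adjacency :: "'a pref set \<Rightarrow> 'a rel" where
  "adjacency D =
     {(a, b). a \<noteq> b \<and>
        (\<exists>P\<in>D. \<exists>Q\<in>D.
           ranked 1 P = a \<and> ranked 2 Q = a \<and> ranked 1 Q = b \<and> ranked 2 P = b \<and>
           (\<forall>k\<in>{3..CARD('a)}. ranked k P = ranked k Q))}"

definition path_connected_domain :: "'a pref set \<Rightarrow> bool" where
  "path_connected_domain D \<longleftrightarrow> connected_in (adjacency D) UNIV"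

definition diverse :: "'a pref set \<Rightarrow> bool" where
  "diverse D \<longleftrightarrow> (\<exists>P\<in>D. \<exists>Q\<in>D. \<forall>a b. a \<noteq> b \<longrightarrow> ((a, b) \<in> P \<longleftrightarrow> (b, a) \<in> Q))"

definition leaf_symmetric :: "'a pref set \<Rightarrow> bool" where
  "leaf_symmetric D \<longleftrightarrow>
     (\<forall>x\<in>leaves_in (adjacency D) UNIV. card (seconds D x) > 1 \<longrightarrow>
        (\<exists>z\<in>seconds D x. z \<notin> neighbors_in (adjacency D) UNIV x \<and> x \<in> seconds D z))"

definition unidimensional :: "'a pref set \<Rightarrow> bool" where
  "unidimensional D \<longleftrightarrow> path_connected_domain D \<and> diverse D \<and> leaf_symmetric D"

definition semi_single_peaked :: "'a rel \<Rightarrow> 'a \<Rightarrow> 'a pref \<Rightarrow> bool" where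
  "semi_single_peaked T xb P \<longleftrightarrow>
     (\<forall>a\<in>path_verts T (peak P) xb. \<forall>b\<in>path_verts T (peak P) xb.
        a \<noteq> b \<longrightarrow> a \<in> path_verts T (peak P) b \<longrightarrow> (a, b) \<in> P) \<and>
     (\<forall>a. a \<notin> path_verts T (peak P) xb \<longrightarrow>
        (proj T a (path_verts T (peak P) xb), a) \<in> P)"

definition SSP_prefs :: "'a rel \<Rightarrow> 'a \<Rightarrow> 'a pref set" where
  "SSP_prefs T xb = {P. linear_order P \<and> semi_single_peaked T xb P}"

definition semi_single_peaked_domain :: "'a pref set \<Rightarrow> bool" where
  "semi_single_peaked_domain D \<longleftrightarrow>
     (\<exists>T xb. is_tree T \<and> D \<subseteq> SSP_prefs T xb) \<and> path_connected_domain D"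

definition semi_hybrid :: "'a rel \<Rightarrow> 'a \<Rightarrow> 'a \<Rightarrow> 'a pref \<Rightarrow> bool" where
  "semi_hybrid T a b P \<longleftrightarrow>
     (peak P \<in> beyond T a b - {a} \<longrightarrow>
        semi_single_peaked T a P \<and> best P (beyond T b a) = b) \<and>
     (peak P \<in> beyond T b a - {b} \<longrightarrow>
        semi_single_peaked T b P \<and> best P (beyond T a b) = a) \<and>
     (peak P \<in> path_verts T a b \<longrightarrow>
        best P (beyond T a b) = a \<and> best P (beyond T b a) = b)"

definition SH_prefs :: "'a rel \<Rightarrow> 'a \<Rightarrow> 'a \<Rightarrow> 'a pref set" where
  "SH_prefs T a b = {P. linear_order P \<and> semi_hybrid T a b P}"

text \<open>
  \<open>semi_hybrid_on D T a b\<close>: \<open>D\<close> is an \<open>(a, b)\<close>-semi-hybrid domain on the tree \<open>T\<close>, with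
  free zone \<open>path_verts T a b\<close>.
\<close>

definition semi_hybrid_on :: "'a pref set \<Rightarrow> 'a rel \<Rightarrow> 'a \<Rightarrow> 'a \<Rightarrow> bool" where
  "semi_hybrid_on D T a b \<longleftrightarrow>
     is_tree T \<and> dual_thresholds T a b \<and>
     D \<subseteq> SH_prefs T a b \<and> path_connected_domain D \<and>
     \<not> (\<exists>T' a' b'. is_tree T' \<and> dual_thresholds T' a' b' \<and>
          D \<subseteq> SH_prefs T' a' b' \<and> path_verts T' a' b' \<subset> path_verts T a b) \<and>
     (is_tree (adjacency D) \<longrightarrow>
        (\<forall>x\<in>leaves_in (adjacency D) (path_verts T a b).
           \<exists>P\<in>D. \<not> semi_single_peaked (adjacency D) x P))"

definition semi_hybrid_domain :: "'a pref set \<Rightarrow> bool" where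
  "semi_hybrid_domain D \<longleftrightarrow> (\<exists>T a b. semi_hybrid_on D T a b)"

definition projection_rule :: "'a pref set \<Rightarrow> nat \<Rightarrow> 'a scf \<Rightarrow> bool" where
  "projection_rule D n f \<longleftrightarrow>
     (\<exists>T xb. is_tree T \<and>
        (\<forall>P\<in>profiles D n. f P = proj T xb (spanned_subtree T ((\<lambda>i. peak (P i)) ` {1..n}))))"

end

theory Submission
  imports Defs
begin

text \<open>
  For two voters, every adjacent pair \<open>x \<sim> y\<close> of peaks has a winner in \<open>{x, y}\<close>, and winning
  propagates: if the first voter wins at \<open>(b, a)\<close>, she wins at \<open>(a, c)\<close> for every other neighbour
  \<open>c\<close> of \<open>a\<close>. Hence either one voter wins at all pairs, or some pair carries an arrow towards the
  alternative that wins whoever has it as her peak. Arrows form no cycles and propagate backwards.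

  If there are no unique seconds, leaf symmetry lets one continue backwards forever, so there is no
  arrow and every rule is dictatorial; thus non-dictatorial domains have unique seconds.

  If the domain is semi-hybrid, an arrow inside the free zone shows that everything behind it can be
  cut off and hung at its head as a tree towards which preferences are semi-single-peaked. The free
  zone was not minimal then, or it shrinks to a single leaf with respect to which the domain is
  semi-single-peaked; both are excluded. So tops-only rules are dictatorial on the free zone, which
  rules out anonymity. Diversity ensures that trees hang at two alternatives of the free zone at most.

  If the domain is not semi-single-peaked, it is semi-hybrid: arranging all alternatives in a line
  gives a trivial free zone, and a minimal one satisfies the definition. If it is semi-single-peaked,
  projecting the threshold on the path between two peaks is strategy-proof.
\<close>

section \<open>Preferences and adjacency\<close>

text \<open>Whether a preference is semi-hybrid does not depend on how the tree runs inside the free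
  zone, only on what hangs at its two ends. The argument therefore carries a set \<open>F\<close>
  with a forest hanging from it (\<open>hanging\<close>), a notion that survives cutting, and
  rebuilds a tree only at the end, by ordering \<open>F\<close> arbitrarily. A path has two ends,
  which is why no more than two alternatives may carry trees.

  A cut can leave a single alternative. This is not a path between distinct thresholds, so
  minimality of the free zone says nothing about it; condition (iii) of semi-hybrid domains closes
  this gap.

  The cut is made at an arrow whose head \<open>w\<close> has no outgoing arrow. Then one voter wins
  with peak \<open>w\<close> against all neighbours of \<open>w\<close>, which fixes the outcome
  \<open>w\<close> when her peak lies behind the arrow and the other peak does not.

  For arbitrary rules, arrows join mutual seconds. For tops-only rules they join adjacent elements
  of \<open>F\<close>, and moving a peak along an edge can move the outcome only along that
  edge.\<close>

declare One_nat_def [simp del] \<comment> \<open>it would rewrite \<open>peak P\<close>, which is \<open>ranked 1 P\<close>\<close>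

lemma linear_orderD:
  assumes "linear_order P"
  shows "(x, x) \<in> P" "(x, y) \<in> P \<Longrightarrow> (y, z) \<in> P \<Longrightarrow> (x, z) \<in> P"
    "(x, y) \<in> P \<Longrightarrow> (y, x) \<in> P \<Longrightarrow> x = y" "(x, y) \<in> P \<or> (y, x) \<in> P"
proof -
  from assms have *: "refl P" "trans P" "antisym P" "total P"
    by (auto simp: linear_order_on_def partial_order_on_def preorder_on_def)
  show "(x, x) \<in> P" using *(1) by (rule reflD)
  show "(x, y) \<in> P \<Longrightarrow> (y, z) \<in> P \<Longrightarrow> (x, z) \<in> P" using *(2) by (meson transD)
  show "(x, y) \<in> P \<Longrightarrow> (y, x) \<in> P \<Longrightarrow> x = y" using *(3) by (meson antisymD)
  show "(x, y) \<in> P \<or> (y, x) \<in> P" using *(1,4) by (cases "x = y") (auto simp: total_on_def dest: reflD)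
qed

text \<open>Inverse to \<open>ranked\<close>. It turns comparisons into arithmetic and resolves the
  description operators of \<open>ranked\<close> and \<open>best\<close> once and for all.\<close>

definition rank :: "'a pref \<Rightarrow> 'a \<Rightarrow> nat" where
  "rank P x = card {y. (y, x) \<in> P}"

context
  fixes P :: "'a::finite pref"
  assumes lin: "linear_order P"
begin

lemma rank_less: "(x, y) \<in> P \<Longrightarrow> x \<noteq> y \<Longrightarrow> rank P x < rank P y"
  unfolding rank_def using linear_orderD[OF lin]
  by (intro psubset_card_mono psubsetI) (simp, blast, blast)

lemma pref_iff_rank: "(x, y) \<in> P \<longleftrightarrow> rank P x \<le> rank P y"
  using rank_less linear_orderD[OF lin] by (metis less_imp_le not_less)

lemma rank_inj: "rank P x = rank P y \<Longrightarrow> x = y"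
  using pref_iff_rank linear_orderD(3)[OF lin] by (metis order_refl)

lemma rank_bounds: "1 \<le> rank P x" "rank P x \<le> CARD('a)"
proof -
  have "x \<in> {y. (y, x) \<in> P}" using linear_orderD(1)[OF lin] by simp
  then show "1 \<le> rank P x" unfolding rank_def
    by (metis card_0_eq empty_iff finite less_one linorder_not_less)
  show "rank P x \<le> CARD('a)" unfolding rank_def by (intro card_mono) auto
qed

lemma rank_range: "range (rank P) = {1..CARD('a)}"
proof (rule card_subset_eq)
  show "range (rank P) \<subseteq> {1..CARD('a)}" using rank_bounds by auto
  have "inj (rank P)" using rank_inj by (auto intro: injI)
  then show "card (range (rank P)) = card {1..CARD('a)}" by (simp add: card_image)
qed simp

lemma ranked_rank: "ranked (rank P x) P = x"
  unfolding ranked_def rank_def[symmetric] using rank_inj by (intro the_equality) auto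

lemma rank_ranked:
  assumes "1 \<le> k" "k \<le> CARD('a)"
  shows "rank P (ranked k P) = k"
proof -
  have "k \<in> range (rank P)" using rank_range assms by simp
  then show ?thesis using ranked_rank by auto
qed

lemma peak_best: "(peak P, y) \<in> P"
proof -
  have "1 \<le> CARD('a)" using rank_bounds order_trans by blast
  then have "rank P (peak P) = 1" by (intro rank_ranked) auto
  then show ?thesis using pref_iff_rank rank_bounds by simp
qed

lemma second_best:
  assumes "2 \<le> CARD('a)"
  shows "ranked 2 P \<noteq> peak P" "z \<noteq> peak P \<Longrightarrow> (ranked 2 P, z) \<in> P"
proof -
  have 2: "rank P (ranked 2 P) = 2" "rank P (peak P) = 1"
    using rank_ranked[of 2] rank_ranked[of 1] assms by linarith+
  then show "ranked 2 P \<noteq> peak P" by auto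
  assume "z \<noteq> peak P"
  then have "rank P z \<noteq> 1" using 2 rank_inj by metis
  then show "(ranked 2 P, z) \<in> P" using 2 pref_iff_rank rank_bounds[of z] by simp
qed

text \<open>A best element exists by finiteness. Otherwise the unspecified value of
  \<open>best\<close> could be \<open>a\<close> by accident, and the direction from left to right
  would fail.\<close>

lemma best_iff:
  assumes "a \<in> B"
  shows "best P B = a \<longleftrightarrow> (\<forall>y\<in>B. (a, y) \<in> P)"
proof
  assume "\<forall>y\<in>B. (a, y) \<in> P"
  then show "best P B = a" unfolding best_def
    using assms linear_orderD(3)[OF lin] by (intro the_equality conjI) (blast, blast, metis)
next
  obtain m where m: "m \<in> B" "\<And>y. y \<in> B \<Longrightarrow> rank P m \<le> rank P y"
    using assms arg_min_if_finite[of B "rank P"] by (metis emptyE finite linorder_not_less)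
  assume "best P B = a"
  moreover have "best P B = m" unfolding best_def
    using m pref_iff_rank rank_inj by (intro the_equality) (simp, meson antisym)
  ultimately show "\<forall>y\<in>B. (a, y) \<in> P" using m pref_iff_rank by auto
qed

end

locale preferences =
  fixes D :: "'a::finite pref set"
  assumes card_ge_3: "CARD('a) \<ge> 3"
    and domain: "preference_domain D"
begin

lemma linear: "P \<in> D \<Longrightarrow> linear_order P"
  using domain unfolding preference_domain_def by blast

lemmas pref_refl = linear_orderD(1)[OF linear]
lemmas pref_trans = linear_orderD(2)[OF linear]
lemmas pref_antisym = linear_orderD(3)[OF linear]
lemmas pref_total = linear_orderD(4)[OF linear]
lemmas peak_top = peak_best[OF linear]

lemma pref_peakD: "P \<in> D \<Longrightarrow> (y, peak P) \<in> P \<Longrightarrow> y = peak P"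
  using pref_antisym peak_top by blast

lemma second_top: "P \<in> D \<Longrightarrow> ranked 2 P \<noteq> peak P"
    "P \<in> D \<Longrightarrow> z \<noteq> peak P \<Longrightarrow> (ranked 2 P, z) \<in> P"
  using second_best[OF linear] card_ge_3 by auto

lemma pref_secondD: "P \<in> D \<Longrightarrow> (y, ranked 2 P) \<in> P \<Longrightarrow> y = ranked 2 P \<or> y = peak P"
  using pref_antisym second_top by blast

lemma secondsE:
  assumes "y \<in> seconds D x"
  obtains P where "P \<in> D" "peak P = x" "ranked 2 P = y"
  using assms unfolding seconds_def by auto

lemma secondsI: "P \<in> D \<Longrightarrow> peak P = x \<Longrightarrow> ranked 2 P = y \<Longrightarrow> y \<in> seconds D x"
  unfolding seconds_def by auto

lemma adjacency_sym: "(x, y) \<in> adjacency D \<Longrightarrow> (y, x) \<in> adjacency D"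
  unfolding adjacency_def mem_Collect_eq case_prod_conv by metis

lemma adjacency_irrefl: "(x, y) \<in> adjacency D \<Longrightarrow> x \<noteq> y"
  unfolding adjacency_def by auto

lemma adjacency_seconds:
  assumes "(x, y) \<in> adjacency D"
  shows "y \<in> seconds D x" "x \<in> seconds D y"
proof -
  from assms obtain P Q where "P \<in> D" "Q \<in> D" "peak P = x" "ranked 2 Q = x" "peak Q = y" "ranked 2 P = y"
    unfolding adjacency_def by blast
  then show "y \<in> seconds D x" "x \<in> seconds D y" by (auto intro: secondsI)
qed

text \<open>Passing between the two preferences that witness an adjacency can only change an outcome by
  following the swap of the two top alternatives.\<close>

lemma adjacencyE:
  assumes "(x, y) \<in> adjacency D"
  obtains P Q where "P \<in> D" "Q \<in> D" "peak P = x" "ranked 2 P = y" "peak Q = y" "ranked 2 Q = x"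
    "\<And>s t. s = t \<or> (s, t) \<in> P \<Longrightarrow> s = t \<or> (t, s) \<in> Q \<Longrightarrow> s = t \<or> s = x \<and> t = y"
proof -
  from assms obtain P Q where PQ: "P \<in> D" "Q \<in> D" "peak P = x" "ranked 2 P = y" "peak Q = y" "ranked 2 Q = x"
    and same: "\<And>k. k \<in> {3..CARD('a)} \<Longrightarrow> ranked k P = ranked k Q"
    unfolding adjacency_def by blast
  note lP = linear[OF PQ(1)] and lQ = linear[OF PQ(2)]
  have r: "rank P x = 1" "rank P y = 2" "rank Q y = 1" "rank Q x = 2"
    using PQ card_ge_3 rank_ranked[OF lP, of 1] rank_ranked[OF lP, of 2]
      rank_ranked[OF lQ, of 1] rank_ranked[OF lQ, of 2] by simp_all
  \<comment> \<open>Only the two top alternatives change places; all others keep a position from 3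
    on.\<close>
  have oth: "rank P u = rank Q u \<and> rank P u \<ge> 3" if "u \<noteq> x" "u \<noteq> y" for u
  proof -
    have "rank P u \<noteq> 1" "rank P u \<noteq> 2" using r that rank_inj[OF lP] by metis+
    then have 3: "rank P u \<ge> 3" using rank_bounds(1)[OF lP, of u] by linarith
    then have "ranked (rank P u) Q = u"
      using same[of "rank P u"] ranked_rank[OF lP] rank_bounds(2)[OF lP, of u] by auto
    moreover have "rank Q (ranked (rank P u) Q) = rank P u"
      using 3 rank_bounds(2)[OF lP, of u] by (intro rank_ranked[OF lQ]) auto
    ultimately show ?thesis using 3 by simp
  qed
  have "s = t \<or> s = x \<and> t = y" if a: "s = t \<or> (s, t) \<in> P" "s = t \<or> (t, s) \<in> Q" for s t
  proof (cases "s = t")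
    case False
    with a have "rank P s < rank P t" "rank Q t < rank Q s"
      using rank_less[OF lP] rank_less[OF lQ] by auto
    then show ?thesis using oth[of s] oth[of t] r by (cases "s = x"; cases "s = y"; cases "t = x"; cases "t = y") auto
  qed simp
  with PQ show ?thesis using that by blast
qed

end

section \<open>Paths and rooted trees\<close>

lemma rtrancl_imp_path:
  assumes "(x, y) \<in> E\<^sup>*"
  shows "\<exists>p. is_path E p \<and> hd p = x \<and> last p = y"
  using assms
proof (induction rule: rtrancl_induct)
  case base
  then show ?case by (intro exI[of _ "[x]"]) (simp add: is_path_def)
next
  case (step y z)
  then obtain p where p: "is_path E p" "hd p = x" "last p = y" by blast
  show ?case
  proof (cases "z \<in> set p")
    case True
    then obtain us vs where "p = us @ z # vs" by (meson split_list)
    with p have "is_path E (us @ [z])"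
      by (auto simp: is_path_def successively_append_iff)
    moreover have "hd (us @ [z]) = x" using p(2) \<open>p = _\<close> by (cases us) auto
    ultimately show ?thesis by (intro exI[of _ "us @ [z]"]) simp
  next
    case False
    with p step.hyps show ?thesis
      by (intro exI[of _ "p @ [z]"]) (auto simp: is_path_def successively_append_iff)
  qed
qed

lemma path_imp_rtrancl:
  assumes "successively (\<lambda>u v. (u, v) \<in> E) p" "p \<noteq> []"
  shows "(hd p, last p) \<in> E\<^sup>*"
  using assms
proof (induction p)
  case (Cons x p)
  then show ?case by (cases p) (auto intro: converse_rtrancl_into_rtrancl)
qed simp

text \<open>If the paths part after a common vertex \<open>x\<close>, following one of them up to
  the first vertex \<open>v\<close> on the other and returning along the latter closes a
  cycle.\<close>

lemma path_unique:
  assumes "sym T" "\<not> has_cycle T"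
    and "is_path T p" "is_path T q" "hd p = hd q" "last p = last q"
  shows "p = q"
  using assms(3-)
proof (induction p arbitrary: q)
  case Nil
  then show ?case by (simp add: is_path_def)
next
  case (Cons x p)
  then obtain q' where q: "q = x # q'" by (cases q) (auto simp: is_path_def)
  show ?case
  proof (cases "p = [] \<or> q' = []")
    case True
    with Cons.prems q show ?thesis by (cases p; cases q') (auto simp: is_path_def split: if_splits)
  next
    case False
    then have ne: "p \<noteq> []" "q' \<noteq> []" by auto
    have P: "is_path T p" "is_path T q'" "(x, hd p) \<in> T" "(x, hd q') \<in> T" "x \<notin> set p" "x \<notin> set q'" "last p = last q'"
      using Cons.prems ne unfolding q by (auto simp: is_path_def successively_Cons)
    show ?thesis
    proof (cases "hd p = hd q'")
      case True
      then show ?thesis using Cons.IH[OF P(1,2)] P q by simp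
    next
      case False
      have "last p \<in> set p \<inter> set q'"
        using ne P(7) last_in_set[of p] last_in_set[of q'] by simp
      then have "\<exists>v\<in>set p. v \<in> set q'" by blast
      then obtain s v s' where s: "p = s @ v # s'" "v \<in> set q'" "\<forall>w\<in>set s. w \<notin> set q'"
        using split_list_first_prop[of p "\<lambda>v. v \<in> set q'"] by metis
      obtain t t' where t: "q' = t @ v # t'" using s(2) by (meson split_list)
      let ?c = "x # s @ v # rev t"
      have revt: "successively (\<lambda>u v. (u, v) \<in> T) (v # rev t)"
      proof -
        have "successively (\<lambda>u v. (u, v) \<in> T) (t @ [v])"
          using P(2) unfolding t is_path_def by (auto simp: successively_append_iff)
        then have "successively (\<lambda>u v. (v, u) \<in> T) (rev (t @ [v]))"
          unfolding successively_rev .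
        then show ?thesis using assms(1) by (auto elim!: successively_mono dest: symD)
      qed
      have "distinct ?c" using P s t unfolding is_path_def by auto
      moreover have "successively (\<lambda>u v. (u, v) \<in> T) ?c"
      proof -
        have "successively (\<lambda>u v. (u, v) \<in> T) ((x # s @ [v]) @ s')"
          using Cons.prems(1) s(1) by (simp add: is_path_def)
        then have "successively (\<lambda>u v. (u, v) \<in> T) (x # s @ [v])"
          unfolding successively_append_iff by blast
        then have "successively (\<lambda>u v. (u, v) \<in> T) ((x # s @ [v]) @ rev t)"
          using revt unfolding successively_append_iff successively_Cons by auto
        then show ?thesis by simp
      qed
      \<comment> \<open>If \<open>s\<close> and \<open>t\<close> were both empty, both paths would
        continue with \<open>v\<close>.\<close>
      moreover have "length ?c \<ge> 3"
        using False s t by (cases s; cases t) auto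
      moreover have "(last ?c, hd ?c) \<in> T"
        using P(4) assms(1) t by (cases t) (auto dest: symD)
      ultimately have "has_cycle T" unfolding has_cycle_def is_path_def by blast
      with assms(2) show ?thesis by blast
    qed
  qed
qed

lemma path_verts_eq:
  assumes "is_tree T" "is_path T p" "hd p = x" "last p = y"
  shows "path_verts T x y = set p"
proof -
  have "(THE q. is_path T q \<and> hd q = x \<and> last q = y) = p"
  proof (rule the_equality)
    fix q assume "is_path T q \<and> hd q = x \<and> last q = y"
    then show "q = p" using assms path_unique[of T q p] unfolding is_tree_def by simp
  qed (use assms in simp)
  then show ?thesis by (simp add: path_verts_def)
qed

lemma tree_path:
  assumes "is_tree T"
  obtains p where "is_path T p" "hd p = x" "last p = y" "path_verts T x y = set p"
proof -
  have "(x, y) \<in> T\<^sup>*" using assms unfolding is_tree_def connected_in_def by simp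
  then show ?thesis using rtrancl_imp_path path_verts_eq[OF assms] that by metis
qed

lemma path_verts_ends: "is_tree T \<Longrightarrow> x \<in> path_verts T x y" "is_tree T \<Longrightarrow> y \<in> path_verts T x y"
  by (metis tree_path hd_in_set last_in_set is_path_def)+

lemma path_verts_sym:
  assumes "is_tree T"
  shows "path_verts T x y = path_verts T y x"
proof -
  obtain p where p: "is_path T p" "hd p = x" "last p = y" "path_verts T x y = set p"
    using tree_path[OF assms] .
  have "sym T" using assms by (simp add: is_tree_def)
  then have "is_path T (rev p)"
    using p(1) unfolding is_path_def by (auto simp: successively_rev elim!: successively_mono dest: symD)
  moreover have "hd (rev p) = y" "last (rev p) = x"
    using p by (auto simp: hd_rev last_rev is_path_def)
  ultimately have "path_verts T y x = set p"
    using path_verts_eq[OF assms] by (metis set_rev)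
  with p show ?thesis by simp
qed

text \<open>Connected sets are convex: a path inside \<open>B\<close> exists, and by uniqueness it
  is the path of the tree.\<close>

lemma path_verts_subset:
  assumes "is_tree T" "connected_in T B" "x \<in> B" "y \<in> B"
  shows "path_verts T x y \<subseteq> B"
proof -
  have "(x, y) \<in> (Restr T B)\<^sup>*" using assms unfolding connected_in_def by simp
  then obtain p where p: "is_path (Restr T B) p" "hd p = x" "last p = y"
    using rtrancl_imp_path by metis
  have "successively (\<lambda>u v. (u, v) \<in> Restr T B) p \<Longrightarrow> p \<noteq> [] \<Longrightarrow> hd p \<in> B \<Longrightarrow> set p \<subseteq> B" for p
  proof (induction p)
    case (Cons a p)
    then show ?case by (cases "p = []") (auto simp: successively_Cons)
  qed simp
  then have "set p \<subseteq> B" using p assms(3) unfolding is_path_def by blast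
  moreover have "is_path T p" using p unfolding is_path_def by (auto elim!: successively_mono)
  ultimately show ?thesis using path_verts_eq[OF assms(1)] p by blast
qed

lemma path_verts_refl:
  assumes "is_tree T"
  shows "path_verts T x x = {x}"
proof -
  have "path_verts T x x \<subseteq> {x}" by (rule path_verts_subset[OF assms]) (auto simp: connected_in_def)
  then show ?thesis using path_verts_ends[OF assms] by blast
qed

lemma path_verts_cut:
  assumes T: "is_tree T" and "x \<in> B" "y \<notin> B"
    and cut: "\<And>u v. (u, v) \<in> T \<Longrightarrow> u \<in> B \<Longrightarrow> v \<notin> B \<Longrightarrow> u = z \<and> v = z'"
  shows "z \<in> path_verts T x y" "z' \<in> path_verts T x y"
proof -
  have "successively (\<lambda>u v. (u, v) \<in> T) p \<Longrightarrow> p \<noteq> [] \<Longrightarrow> hd p \<in> B \<Longrightarrow> last p \<notin> B \<Longrightarrow> z \<in> set p \<and> z' \<in> set p" for p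
  proof (induction p)
    case (Cons a p)
    then show ?case
      using cut[of a "hd p"] by (cases "p = []"; cases "hd p \<in> B") (auto simp: successively_Cons)
  qed simp
  moreover obtain p where "is_path T p" "hd p = x" "last p = y" "path_verts T x y = set p"
    using tree_path[OF T] .
  ultimately show "z \<in> path_verts T x y" "z' \<in> path_verts T x y"
    using assms unfolding is_path_def by auto
qed

lemma connected_inI:
  assumes "sym E" "\<And>x. x \<in> B \<Longrightarrow> (x, r) \<in> (Restr E B)\<^sup>*"
  shows "connected_in E B"
  unfolding connected_in_def
proof (intro ballI)
  fix x y assume xy: "x \<in> B" "y \<in> B"
  have "sym ((Restr E B)\<^sup>*)" using assms(1) by (intro sym_rtrancl) (auto simp: sym_def)
  then have "(r, y) \<in> (Restr E B)\<^sup>*" using assms(2)[OF xy(2)] by (rule symD)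
  with assms(2)[OF xy(1)] show "(x, y) \<in> (Restr E B)\<^sup>*" by (rule rtrancl_trans)
qed

text \<open>A rooted tree is given by its child--parent relation \<open>R\<close>; the subtree hanging at \<open>z\<close> is
  \<open>{x. (x, z) \<in> R\<^sup>*}\<close>.\<close>

locale rooted =
  fixes R :: "'a::finite rel" and root :: 'a
  assumes single: "single_valued R" and wf: "wf (R\<inverse>)" and domain_R: "Domain R = - {root}"
begin

abbreviation T :: "'a rel" where "T \<equiv> R \<union> R\<inverse>"

lemma to_root: "(x, root) \<in> R\<^sup>*"
proof (induction x rule: wf_induct_rule[OF wf])
  case (1 x)
  show ?case
  proof (cases "x = root")
    case False
    then obtain y where "(x, y) \<in> R" using domain_R by blast
    with 1 show ?thesis by (meson converse_iff converse_rtrancl_into_rtrancl)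
  qed simp
qed

lemma acyclic_R: "acyclic R"
  using wf wf_acyclic acyclic_converse by blast

lemma desc_antisym: "(x, y) \<in> R\<^sup>* \<Longrightarrow> (y, x) \<in> R\<^sup>* \<Longrightarrow> x = y"
  using acyclic_impl_antisym_rtrancl[OF acyclic_R] by (meson antisymD)

lemma desc_comparable: "(x, a) \<in> R\<^sup>* \<Longrightarrow> (x, b) \<in> R\<^sup>* \<Longrightarrow> (a, b) \<in> R\<^sup>* \<or> (b, a) \<in> R\<^sup>*"
  using single_valued_confluent[OF single] by blast

lemma desc_stepE:
  assumes "(x, m) \<in> R\<^sup>*" "x \<noteq> m"
  obtains z where "(x, z) \<in> R\<^sup>*" "(z, m) \<in> R" "(m, z) \<notin> R\<^sup>*"
proof -
  obtain z where z: "(x, z) \<in> R\<^sup>*" "(z, m) \<in> R" using assms by (metis rtranclE)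
  moreover have "(m, z) \<notin> R\<^sup>*" using z(2) acyclic_R by (meson acyclic_def rtrancl_into_trancl2)
  ultimately show ?thesis using that by blast
qed

lemma parent_desc: "(z, m) \<in> R \<Longrightarrow> (z, x) \<in> R\<^sup>* \<Longrightarrow> x \<noteq> z \<Longrightarrow> (m, x) \<in> R\<^sup>*"
  by (metis converse_rtranclE single single_valuedD)

lemma cut_desc:
  assumes "(u, v) \<in> T" "(u, z) \<in> R\<^sup>*" "(v, z) \<notin> R\<^sup>*"
  shows "u = z" "(z, v) \<in> R"
proof -
  have uv: "(u, v) \<in> R" using assms by (auto intro: converse_rtrancl_into_rtrancl)
  then show "u = z" using assms parent_desc by blast
  with uv show "(z, v) \<in> R" by simp
qed

lemma connected_desc: "connected_in T {x. (x, z) \<in> R\<^sup>*}"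
proof -
  let ?B = "{x. (x, z) \<in> R\<^sup>*}"
  have to: "(x, z) \<in> (Restr T ?B)\<^sup>*" if "(x, z) \<in> R\<^sup>*" for x
    using that
  proof (induction rule: converse_rtrancl_induct)
    case (step x y)
    then have "(x, y) \<in> Restr T ?B" by (auto intro: converse_rtrancl_into_rtrancl)
    with step show ?case by (meson converse_rtrancl_into_rtrancl)
  qed simp
  show ?thesis by (rule connected_inI[where r = z]) (use to in \<open>auto simp: sym_def\<close>)
qed

text \<open>Outside the subtree at \<open>z\<close> the ascent to the root stays outside, since
  whatever has an ancestor in the subtree belongs to it. Both sides of the edge above
  \<open>z\<close> are thus convex, which reduces all facts on paths to facts on
  descendants.\<close>

lemma connected_not_desc: "connected_in T {x. (x, z) \<notin> R\<^sup>*}"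
proof -
  let ?B = "{x. (x, z) \<notin> R\<^sup>*}"
  have to: "(x, z) \<notin> R\<^sup>* \<Longrightarrow> (x, root) \<in> (Restr T ?B)\<^sup>*" for x
    using to_root[of x]
  proof (induction rule: converse_rtrancl_induct)
    case (step x y)
    then have "(y, z) \<notin> R\<^sup>*" by (meson converse_rtrancl_into_rtrancl)
    with step have "(x, y) \<in> Restr T ?B" by auto
    with step \<open>(y, z) \<notin> R\<^sup>*\<close> show ?case by (meson converse_rtrancl_into_rtrancl)
  qed simp
  show ?thesis by (rule connected_inI[where r = root]) (use to in \<open>auto simp: sym_def\<close>)
qed

lemma no_cycle: "\<not> has_cycle T"
proof
  assume "has_cycle T"
  then obtain p where p: "distinct p" "successively (\<lambda>u v. (u, v) \<in> T) p" "length p \<ge> 3" "(last p, hd p) \<in> T"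
    unfolding has_cycle_def is_path_def by blast
  let ?n = "length p"
  have ne: "p \<noteq> []" using p by auto
  have nxt: "(p ! i, p ! (Suc i mod ?n)) \<in> T" if "i < ?n" for i
  proof (cases "Suc i < ?n")
    case True
    then show ?thesis using p(2) by (auto simp: successively_conv_nth)
  next
    case False
    then have "i = ?n - 1" "Suc i = ?n" using that by auto
    then show ?thesis using p(4) ne by (simp add: last_conv_nth hd_conv_nth)
  qed
  have "wf R" using acyclic_R by (intro finite_acyclic_wf) auto
  \<comment> \<open>a cycle vertex with no child on the cycle would have two parents\<close>
  then obtain v where v: "v \<in> set p" "\<And>u. (u, v) \<in> R \<Longrightarrow> u \<notin> set p"
    using ne by (metis wfE_min hd_in_set)
  obtain i where i: "i < ?n" "p ! i = v" using v(1) by (auto simp: in_set_conv_nth)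
  define j where "j = (if i = 0 then ?n - 1 else i - 1)"
  have j: "j < ?n" "Suc j mod ?n = i" using i p(3) unfolding j_def by auto
  \<comment> \<open>Length at least 3 keeps the predecessor and the successor of \<open>i\<close> on
    the cycle apart.\<close>
  have "Suc i mod ?n \<noteq> j"
    using i(1) p(3) unfolding j_def by (cases "Suc i = ?n") auto
  moreover have "Suc i mod ?n < ?n" using ne by simp
  moreover have "(v, p ! (Suc i mod ?n)) \<in> R" using nxt[OF i(1)] i v nth_mem[OF \<open>Suc i mod ?n < ?n\<close>] by blast
  moreover have "(v, p ! j) \<in> R" using nxt[OF j(1)] i v nth_mem[OF j(1)] unfolding j(2) by blast
  ultimately show False
    using p(1) single j(1) by (metis nth_eq_iff_index_eq single_valuedD)
qed

lemma tree: "is_tree T"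
proof -
  have "irrefl T" using acyclic_R by (auto simp: irrefl_def acyclic_def)
  moreover have "connected_in T UNIV" using connected_desc[of root] to_root by simp
  ultimately show ?thesis using no_cycle by (auto simp: is_tree_def sym_def)
qed

lemma path_in_desc: "(x, z) \<in> R\<^sup>* \<Longrightarrow> (y, z) \<in> R\<^sup>* \<Longrightarrow> m \<in> path_verts T x y \<Longrightarrow> (m, z) \<in> R\<^sup>*"
  using path_verts_subset[OF tree connected_desc] by blast

lemma path_outside_desc:
  "(x, z) \<notin> R\<^sup>* \<Longrightarrow> (y, z) \<notin> R\<^sup>* \<Longrightarrow> m \<in> path_verts T x y \<Longrightarrow> (m, z) \<notin> R\<^sup>*"
  using path_verts_subset[OF tree connected_not_desc] by blast

lemma path_through:
  assumes "(z, m) \<in> R" "(x, z) \<in> R\<^sup>*" "(y, z) \<notin> R\<^sup>*"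
  shows "z \<in> path_verts T x y" "m \<in> path_verts T x y"
proof -
  have "u = z \<and> v = m" if "(u, v) \<in> T" "u \<in> {x. (x, z) \<in> R\<^sup>*}" "v \<notin> {x. (x, z) \<in> R\<^sup>*}" for u v
    using that cut_desc[of u v z] single_valuedD[OF single assms(1)] by blast
  from path_verts_cut[OF tree, of x "{x. (x, z) \<in> R\<^sup>*}" y z m, OF _ _ this] assms
  show "z \<in> path_verts T x y" "m \<in> path_verts T x y" by blast+
qed

text \<open>One inclusion is convexity of the descendants of \<open>y\<close> and of the
  non-descendants of \<open>m\<close>; for the other, the path has to cross the edge above
  \<open>m\<close>.\<close>

lemma path_to_anc:
  assumes "(x, y) \<in> R\<^sup>*"
  shows "path_verts T x y = {m. (x, m) \<in> R\<^sup>* \<and> (m, y) \<in> R\<^sup>*}"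
proof (intro equalityI subsetI CollectI conjI; (elim CollectE conjE)?)
  fix m assume m: "m \<in> path_verts T x y"
  show "(m, y) \<in> R\<^sup>*" using path_in_desc[OF assms _ m] by simp
  show "(x, m) \<in> R\<^sup>*"
  proof (rule ccontr)
    assume n: "(x, m) \<notin> R\<^sup>*"
    show False
    proof (cases "(y, m) \<in> R\<^sup>*")
      case True
      then show False using n assms by (meson rtrancl_trans)
    next
      case False
      then show False using path_outside_desc[OF n False m] by simp
    qed
  qed
next
  fix m assume m: "(x, m) \<in> R\<^sup>*" "(m, y) \<in> R\<^sup>*"
  show "m \<in> path_verts T x y"
  proof (cases "m = y")
    case True
    then show ?thesis using path_verts_ends[OF tree] by blast
  next
    case False
    then have "(y, m) \<notin> R\<^sup>*" using m desc_antisym by blast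
    moreover from False m(2) obtain m' where "(m, m') \<in> R" by (meson converse_rtranclE)
    ultimately show ?thesis using path_through m by blast
  qed
qed

lemma path_to_root: "path_verts T x root = {m. (x, m) \<in> R\<^sup>*}"
  using path_to_anc[OF to_root] to_root by blast

text \<open>The least common ancestor. Unless it is \<open>x\<close>, its child towards
  \<open>x\<close> is no ancestor of \<open>y\<close>, so the path must leave that child's subtree
  and pass through \<open>l\<close>.\<close>

lemma common_ancestor:
  obtains l where "(x, l) \<in> R\<^sup>*" "(y, l) \<in> R\<^sup>*" "l \<in> path_verts T x y"
    "\<And>m. (x, m) \<in> R\<^sup>* \<Longrightarrow> (y, m) \<in> R\<^sup>* \<Longrightarrow> (l, m) \<in> R\<^sup>*"
proof -
  let ?C = "{m. (x, m) \<in> R\<^sup>* \<and> (y, m) \<in> R\<^sup>*}"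
  have "wf R" using acyclic_R by (intro finite_acyclic_wf) auto
  moreover have "root \<in> ?C" using to_root by simp
  ultimately obtain l where l: "l \<in> ?C" "\<And>m. (m, l) \<in> R \<Longrightarrow> m \<notin> ?C"
    by (rule wfE_min) blast
  have least: "(l, m) \<in> R\<^sup>*" if "m \<in> ?C" for m
  proof (rule ccontr)
    assume n: "(l, m) \<notin> R\<^sup>*"
    then have "(m, l) \<in> R\<^sup>*" "m \<noteq> l" using that l(1) desc_comparable by blast+
    then obtain z where "(m, z) \<in> R\<^sup>*" "(z, l) \<in> R" by (meson desc_stepE)
    with that l(2)[of z] show False by (auto intro: rtrancl_trans)
  qed
  have "l \<in> path_verts T x y"
  proof (cases "l = x")
    case True
    then show ?thesis using path_verts_ends[OF tree] by blast
  next
    case False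
    then obtain z where z: "(x, z) \<in> R\<^sup>*" "(z, l) \<in> R" using l(1) desc_stepE by blast
    then have "(y, z) \<notin> R\<^sup>*" using l(2) by blast
    with z show ?thesis using path_through by blast
  qed
  with l(1) least show ?thesis using that by blast
qed

text \<open>The set is the path from \<open>x\<close> to the root, and every path from
  \<open>y\<close> to one of its vertices meets it first in the least common ancestor.\<close>

lemma proj_anc:
  assumes "(x, l) \<in> R\<^sup>*" "(y, l) \<in> R\<^sup>*"
    and least: "\<And>m. (x, m) \<in> R\<^sup>* \<Longrightarrow> (y, m) \<in> R\<^sup>* \<Longrightarrow> (l, m) \<in> R\<^sup>*"
    and "(x, y) \<notin> R\<^sup>*"
  shows "proj T y {m. (x, m) \<in> R\<^sup>*} = l"
proof -
  have "l \<in> path_verts T y b" if "(x, b) \<in> R\<^sup>*" for b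
  proof (cases "(b, l) \<in> R\<^sup>* \<and> b \<noteq> l")
    case True
    then obtain z where z: "(b, z) \<in> R\<^sup>*" "(z, l) \<in> R" "(l, z) \<notin> R\<^sup>*" using desc_stepE by blast
    then have "(x, z) \<in> R\<^sup>*" using that by (meson rtrancl_trans)
    then have "(y, z) \<notin> R\<^sup>*" using least z by blast
    then have "l \<in> path_verts T b y" using path_through z by blast
    then show ?thesis using path_verts_sym[OF tree] by blast
  next
    case False
    have "(b, l) \<in> R\<^sup>* \<or> (l, b) \<in> R\<^sup>*" using desc_comparable that assms(1) by blast
    with False have lb: "(l, b) \<in> R\<^sup>*" by blast
    then have "(y, b) \<in> R\<^sup>*" using assms by (meson rtrancl_trans)
    then show ?thesis using path_to_anc assms lb by blast
  qed
  moreover have "a = l" if a: "(x, a) \<in> R\<^sup>*" "\<And>b. (x, b) \<in> R\<^sup>* \<Longrightarrow> a \<in> path_verts T y b" for a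
  proof -
    have "(y, a) \<in> R\<^sup>*" using a(2)[OF to_root] path_to_root by blast
    then have "(l, a) \<in> R\<^sup>*" using least a by blast
    moreover have "(a, l) \<in> R\<^sup>*" using path_in_desc[OF assms(2) _ a(2)[OF assms(1)]] by blast
    ultimately show ?thesis using desc_antisym by blast
  qed
  ultimately have "(THE a. a \<in> {m. (x, m) \<in> R\<^sup>*} \<and> (\<forall>b\<in>{m. (x, m) \<in> R\<^sup>*}. a \<in> path_verts T y b)) = l"
    using assms(1) by (intro the_equality) blast+
  then show ?thesis unfolding proj_def using assms(4) by simp
qed

text \<open>Replaces projections by a condition on single edges, the form that
  \<open>hanging\<close> generalizes. The projection of \<open>y\<close> is the least common
  ancestor \<open>l\<close> of the peak and \<open>y\<close>. From left to right, \<open>m\<close>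
  is at least as good as \<open>l\<close> along the path and \<open>l\<close> as \<open>y\<close> by
  projection. From right to left, \<open>z\<close> is the child through which the ascent from the
  peak arrives.\<close>

lemma semi_single_peaked_iff:
  assumes lin: "linear_order P"
  shows "semi_single_peaked T root P \<longleftrightarrow>
    (\<forall>z m y. (z, m) \<in> R \<longrightarrow> (peak P, z) \<in> R\<^sup>* \<longrightarrow> (y, z) \<notin> R\<^sup>* \<longrightarrow> (m, y) \<in> P)"
    (is "?S \<longleftrightarrow> ?G")
proof
  let ?x = "peak P"
  assume G: ?G
  have 1: "(a, b) \<in> P" if ab: "(?x, a) \<in> R\<^sup>*" "a \<noteq> b" "a \<in> path_verts T ?x b" for a b
  proof (cases "a = ?x")
    case True
    then show ?thesis using peak_best[OF lin] by simp
  next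
    case False
    then obtain z where z: "(?x, z) \<in> R\<^sup>*" "(z, a) \<in> R" "(a, z) \<notin> R\<^sup>*"
      using desc_stepE[OF ab(1)] by metis
    have "(b, z) \<notin> R\<^sup>*" using path_in_desc[OF z(1) _ ab(3)] z(3) by blast
    with G z show ?thesis by blast
  qed
  have 2: "(proj T a (path_verts T ?x root), a) \<in> P" if "a \<notin> path_verts T ?x root" for a
  proof -
    have na: "(?x, a) \<notin> R\<^sup>*" using that path_to_root by simp
    obtain l where l: "(?x, l) \<in> R\<^sup>*" "(a, l) \<in> R\<^sup>*" "l \<in> path_verts T ?x a"
        "\<And>m. (?x, m) \<in> R\<^sup>* \<Longrightarrow> (a, m) \<in> R\<^sup>* \<Longrightarrow> (l, m) \<in> R\<^sup>*"
      using common_ancestor[of ?x a] by blast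
    have "l \<noteq> a" using l na by blast
    then have "(l, a) \<in> P" using 1 l by blast
    then show ?thesis using proj_anc[OF l(1,2,4) na] path_to_root by simp
  qed
  show ?S unfolding semi_single_peaked_def using 1 2 path_to_root by auto
next
  let ?x = "peak P"
  assume S: ?S
  note r = linear_orderD[OF lin]
  show ?G
  proof (intro allI impI)
    fix z m y assume z: "(z, m) \<in> R" "(?x, z) \<in> R\<^sup>*" "(y, z) \<notin> R\<^sup>*"
    obtain l where l: "(?x, l) \<in> R\<^sup>*" "(y, l) \<in> R\<^sup>*"
        "\<And>m. (?x, m) \<in> R\<^sup>* \<Longrightarrow> (y, m) \<in> R\<^sup>* \<Longrightarrow> (l, m) \<in> R\<^sup>*"
      using common_ancestor[of ?x y] by blast
    have nlz: "(l, z) \<notin> R\<^sup>*" using l(2) z(3) by (meson rtrancl_trans)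
    then have "(z, l) \<in> R\<^sup>*" using l(1) z(2) desc_comparable by blast
    have xm: "(?x, m) \<in> R\<^sup>*" using z by (meson rtrancl_into_rtrancl)
    have "(m, l) \<in> P"
    proof (cases "m = l")
      case False
      have "m \<in> path_verts T ?x l" using path_through z nlz by blast
      then show ?thesis using S False xm l(1) path_to_root unfolding semi_single_peaked_def by auto
    qed (use r in auto)
    moreover have "(l, y) \<in> P"
    proof (cases "(?x, y) \<in> R\<^sup>*")
      case True
      then have "(l, y) \<in> R\<^sup>*" using l(3) by blast
      then have "l = y" using l(2) desc_antisym by blast
      then show ?thesis using r by simp
    next
      case False
      then have "proj T y (path_verts T ?x root) = l"
        using proj_anc[OF l(1,2,3)] path_to_root by simp
      then show ?thesis using S False path_to_root unfolding semi_single_peaked_def by auto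
    qed
    ultimately show "(m, y) \<in> P" using r by blast
  qed
qed

end

section \<open>Orienting a given tree towards an arbitrary root\<close>

definition parent_rel :: "'a rel \<Rightarrow> 'a \<Rightarrow> 'a rel" where
  "parent_rel T r = {(x, y). (x, y) \<in> T \<and> x \<noteq> r \<and> y \<in> path_verts T x r}"

context
  fixes T :: "'a::finite rel"
  assumes tree: "is_tree T"
begin

lemma parent_path:
  assumes "(x, y) \<in> parent_rel T r"
  obtains q where "is_path T q" "hd q = y" "last q = r" "is_path T (x # q)"
proof -
  obtain p where p: "is_path T p" "hd p = x" "last p = r" "path_verts T x r = set p"
    using tree_path[OF tree] .
  have xy: "(x, y) \<in> T" "y \<in> set p" "x \<noteq> r" "x \<noteq> y"
    using assms p tree unfolding parent_rel_def is_tree_def irrefl_def by auto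
  obtain s q where "p = s @ y # q" using xy(2) by (meson split_list)
  then obtain s' where s: "p = x # s' @ y # q" using p(2) xy(4) by (cases s) auto
  have 1: "is_path T (y # q)" "is_path T (x # y # q)"
    using p(1) xy(1) unfolding s is_path_def by (auto simp: successively_append_iff successively_Cons)
  then show ?thesis using that[of "y # q"] p(3) s by auto
qed

lemma rooted_parent: "rooted (parent_rel T r) r"
proof
  show "single_valued (parent_rel T r)"
  proof (rule single_valuedI)
    fix x y z assume y: "(x, y) \<in> parent_rel T r" and z: "(x, z) \<in> parent_rel T r"
    obtain p where p: "is_path T p" "hd p = y" "last p = r" "is_path T (x # p)"
      using parent_path[OF y] .
    obtain q where q: "is_path T q" "hd q = z" "last q = r" "is_path T (x # q)"
      using parent_path[OF z] .
    have "x # p = x # q"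
      using p q tree unfolding is_tree_def by (intro path_unique[of T]) (auto simp: is_path_def)
    with p q show "y = z" by simp
  qed
  have len: "card (path_verts T y r) < card (path_verts T x r)" if xy: "(x, y) \<in> parent_rel T r" for x y
  proof -
    obtain p where p: "is_path T p" "hd p = y" "last p = r" "is_path T (x # p)"
      using parent_path[OF xy] .
    then have "path_verts T y r = set p" "path_verts T x r = set (x # p)" "x \<notin> set p"
      using path_verts_eq[OF tree p(1)] path_verts_eq[OF tree p(4)] by (auto simp: is_path_def)
    then show ?thesis by simp
  qed
  show "wf ((parent_rel T r)\<inverse>)"
    by (rule wf_subset[OF wf_measure[of "\<lambda>x. card (path_verts T x r)"]]) (use len in auto)
  have "x \<in> Domain (parent_rel T r)" if xr: "x \<noteq> r" for x
  proof -
    obtain p where p: "is_path T p" "hd p = x" "last p = r" "path_verts T x r = set p"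
      using tree_path[OF tree] .
    then obtain y q where "p = x # y # q"
      using xr by (cases p rule: remdups_adj.cases) (auto simp: is_path_def)
    with p xr have "(x, y) \<in> parent_rel T r" by (auto simp: parent_rel_def is_path_def)
    then show ?thesis by blast
  qed
  then show "Domain (parent_rel T r) = - {r}" by (auto simp: parent_rel_def)
qed

text \<open>Every edge gets a direction: either \<open>x\<close> lies on the path from
  \<open>y\<close> to \<open>r\<close>, or prefixing \<open>x\<close> to that path gives the path
  from \<open>x\<close> to \<open>r\<close>.\<close>

lemma parent_rel_un: "parent_rel T r \<union> (parent_rel T r)\<inverse> = T"
proof -
  have "sym T" using tree by (simp add: is_tree_def)
  moreover have "(x, y) \<in> parent_rel T r \<or> (y, x) \<in> parent_rel T r" if "(x, y) \<in> T" for x y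
  proof -
    have xy: "x \<noteq> y" "(y, x) \<in> T" using that tree unfolding is_tree_def irrefl_def by (auto dest: symD)
    obtain p where p: "is_path T p" "hd p = y" "last p = r" "path_verts T y r = set p"
      using tree_path[OF tree] .
    show ?thesis
    proof (cases "x \<in> set p")
      case True
      have "y \<noteq> r" using True p xy path_verts_refl[OF tree] by auto
      then show ?thesis using True p(4) xy by (auto simp: parent_rel_def)
    next
      case False
      then have "is_path T (x # p)" using p that by (auto simp: is_path_def successively_Cons)
      then have "path_verts T x r = set (x # p)"
        using p(1,3) by (intro path_verts_eq[OF tree]) (auto simp: is_path_def)
      moreover have "x \<noteq> r" "y \<in> set p"
        using False p(1-3) hd_in_set[of p] last_in_set[of p] unfolding is_path_def by blast+
      ultimately show ?thesis using that by (simp add: parent_rel_def)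
    qed
  qed
  ultimately show ?thesis by (auto simp: parent_rel_def dest: symD)
qed

end

section \<open>Projection rules and hanging trees\<close>

lemma path_connected:
  assumes "sym T" "is_path T p"
  shows "connected_in T (set p)"
proof (rule connected_inI[OF assms(1)])
  fix x assume "x \<in> set p"
  then obtain us vs where p: "p = us @ x # vs" by (meson split_list)
  then have "successively (\<lambda>u v. (u, v) \<in> T) (x # vs)"
    using assms(2) by (simp add: is_path_def successively_append_iff)
  then have "successively (\<lambda>u v. (u, v) \<in> Restr T (set p)) (x # vs)"
    by (rule successively_mono) (use p in auto)
  from path_imp_rtrancl[OF this] show "(x, last p) \<in> (Restr T (set p))\<^sup>*" using p by simp
qed

lemma spanned_pair:
  assumes "is_tree T"
  shows "spanned_subtree T {x, y} = path_verts T x y"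
proof -
  obtain p where p: "is_path T p" "hd p = x" "last p = y" "path_verts T x y = set p"
    using tree_path[OF assms] .
  have "subtree T (path_verts T x y)"
    using path_connected[OF _ p(1)] assms p(1,4) by (auto simp: subtree_def is_tree_def is_path_def)
  then show ?thesis
    unfolding spanned_subtree_def
    by (intro hull_unique)
      (use path_verts_subset[OF assms] path_verts_ends[OF assms] in \<open>auto simp: subtree_def\<close>)
qed

context rooted
begin

text \<open>All vertices of the path are descendants of \<open>l\<close>, so \<open>l\<close> is its
  vertex nearest to the root, where the threshold sits.\<close>

lemma proj_path:
  assumes l: "(x, l) \<in> R\<^sup>*" "(y, l) \<in> R\<^sup>*" "l \<in> path_verts T x y"
  shows "proj T root (path_verts T x y) = l"
proof -
  have in_l: "(b, l) \<in> R\<^sup>*" if "b \<in> path_verts T x y" for b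
    using path_in_desc[OF l(1,2) that] .
  have rootpath: "path_verts T root b = {m. (b, m) \<in> R\<^sup>*}" for b
    using path_to_root path_verts_sym[OF tree] by metis
  show ?thesis
  proof (cases "root \<in> path_verts T x y")
    case True
    then have "(root, l) \<in> R\<^sup>*" using in_l by blast
    then have "root = l" using desc_antisym[OF _ to_root] by blast
    then show ?thesis using True by (simp add: proj_def)
  next
    case False
    have "(THE a. a \<in> path_verts T x y \<and> (\<forall>b\<in>path_verts T x y. a \<in> path_verts T root b)) = l"
    proof (rule the_equality)
      show "l \<in> path_verts T x y \<and> (\<forall>b\<in>path_verts T x y. l \<in> path_verts T root b)"
        using l(3) in_l rootpath by blast
    next
      fix a assume "a \<in> path_verts T x y \<and> (\<forall>b\<in>path_verts T x y. a \<in> path_verts T root b)"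
      then have "(a, l) \<in> R\<^sup>*" "(l, a) \<in> R\<^sup>*" using l(3) in_l rootpath by blast+
      then show "a = l" using desc_antisym by blast
    qed
    with False show ?thesis by (simp add: proj_def)
  qed
qed

text \<open>Any misreport yields an ancestor \<open>k\<close> of \<open>y\<close>. If the truthful
  outcome \<open>l\<close> is not the peak, then \<open>y\<close>, and hence \<open>k\<close>, lies
  outside the subtree of the child of \<open>l\<close> towards the peak, so \<open>l\<close> is at
  least as good as \<open>k\<close>.\<close>

lemma proj_strategy_proof:
  assumes "linear_order P" "semi_single_peaked T root P"
  shows "(proj T root (path_verts T (peak P) y), proj T root (path_verts T x' y)) \<in> P"
proof -
  obtain l where l: "(peak P, l) \<in> R\<^sup>*" "(y, l) \<in> R\<^sup>*" "l \<in> path_verts T (peak P) y"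
      "\<And>m. (peak P, m) \<in> R\<^sup>* \<Longrightarrow> (y, m) \<in> R\<^sup>* \<Longrightarrow> (l, m) \<in> R\<^sup>*"
    using common_ancestor[of "peak P" y] by blast
  obtain k where k: "(x', k) \<in> R\<^sup>*" "(y, k) \<in> R\<^sup>*" "k \<in> path_verts T x' y"
    using common_ancestor[of x' y] by blast
  have "(l, k) \<in> P"
  proof (cases "l = peak P")
    case True
    then show ?thesis using peak_best[OF assms(1)] by simp
  next
    case False
    then obtain z where z: "(peak P, z) \<in> R\<^sup>*" "(z, l) \<in> R" "(l, z) \<notin> R\<^sup>*"
      using desc_stepE[OF l(1)] by metis
    then have "(y, z) \<notin> R\<^sup>*" using l(4) by blast
    then have "(k, z) \<notin> R\<^sup>*" using k(2) by (meson rtrancl_trans)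
    with z assms(2) show ?thesis unfolding semi_single_peaked_iff[OF assms(1)] by blast
  qed
  then show ?thesis using proj_path l k by simp
qed

end

lemma SSP_projection_strategy_proof:
  fixes D :: "'a::finite pref set"
  assumes "is_tree T" "D \<subseteq> SSP_prefs T xb"
  shows "strategy_proof D 2 (\<lambda>P. proj T xb (spanned_subtree T ((\<lambda>i. peak (P i)) ` {1..2})))"
    (is "strategy_proof D 2 ?f")
proof -
  interpret rooted "parent_rel T xb" xb by (rule rooted_parent[OF assms(1)])
  note T = parent_rel_un[OF assms(1)]
  have 12: "{1..2} = {1, 2::nat}" by auto
  have f: "?f P = proj T xb (path_verts T (peak (P 1)) (peak (P 2)))" for P
    unfolding 12 using spanned_pair[OF assms(1)] by simp
  have sp: "(proj T xb (path_verts T (peak P) y), proj T xb (path_verts T x' y)) \<in> P"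
    "(proj T xb (path_verts T y (peak P)), proj T xb (path_verts T y x')) \<in> P" if "P \<in> D" for P y x'
    using proj_strategy_proof[unfolded T, of P y x'] that assms path_verts_sym[OF assms(1)]
    unfolding SSP_prefs_def by auto
  have D: "P i \<in> D" if "P \<in> profiles D 2" "i \<in> {1..2}" for P i
    using that unfolding profiles_def by blast
  show ?thesis unfolding strategy_proof_def f
  proof (intro ballI disjI2)
    fix P i Q assume P: "P \<in> profiles D 2" and i: "i \<in> {1..2::nat}" and "Q \<in> D"
    then show "(proj T xb (path_verts T (peak (P 1)) (peak (P 2))),
        proj T xb (path_verts T (peak ((P(i := Q)) 1)) (peak ((P(i := Q)) 2)))) \<in> P i"
      using sp[OF D[OF P i]] unfolding 12 by auto
  qed
qed

lemma projection_rule_properties: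
  fixes D :: "'a::finite pref set"
  assumes "projection_rule D n f" "n \<ge> 2"
  shows "is_rule D n f" "anonymous D n f" "tops_only D n f"
proof -
  obtain T xb where T: "is_tree T" and
    f: "\<And>P. P \<in> profiles D n \<Longrightarrow> f P = proj T xb (spanned_subtree T ((\<lambda>i. peak (P i)) ` {1..n}))"
    using assms(1) unfolding projection_rule_def by blast
  show "is_rule D n f" unfolding is_rule_def
  proof (intro ballI allI impI)
    fix P a assume P: "P \<in> profiles D n" "\<forall>i\<in>{1..n}. peak (P i) = a"
    have "(\<lambda>i. peak (P i)) ` {1..n} = {a}" using P(2) assms(2) by force
    then have "f P = proj T xb {a}"
      using f[OF P(1)] spanned_pair[OF T, of a a] path_verts_refl[OF T] by simp
    moreover have "proj T xb {a} = a"
      using path_verts_ends(2)[OF T] by (auto simp: proj_def intro!: the_equality)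
    ultimately show "f P = a" by simp
  qed
  show "anonymous D n f" unfolding anonymous_def
  proof (intro ballI allI impI)
    fix P \<sigma> assume P: "P \<in> profiles D n" and s: "\<sigma> permutes {1..n}"
    have "P \<circ> \<sigma> \<in> profiles D n"
      using P permutes_in_image[OF s] permutes_not_in[OF s]
      unfolding profiles_def PiE_def Pi_def extensional_def by auto
    moreover have "(\<lambda>i. peak ((P \<circ> \<sigma>) i)) ` {1..n} = (\<lambda>i. peak (P i)) ` {1..n}"
      using permutes_image[OF s] by (metis (no_types, lifting) comp_apply image_cong image_image)
    ultimately show "f P = f (P \<circ> \<sigma>)" using f P by simp
  qed
  show "tops_only D n f" unfolding tops_only_def
  proof (intro ballI impI)
    fix P Q assume "P \<in> profiles D n" "Q \<in> profiles D n" "\<forall>i\<in>{1..n}. peak (P i) = peak (Q i)"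
    moreover from this have "(\<lambda>i. peak (P i)) ` {1..n} = (\<lambda>i. peak (Q i)) ` {1..n}"
      by (intro image_cong) auto
    ultimately show "f P = f Q" using f by simp
  qed
qed

text \<open>\<open>hanging D F R\<close>: outside \<open>F\<close> the alternatives form rooted trees with child--parent relation
  \<open>R\<close> that hang at elements of \<open>F\<close>. Seen from inside a subtree, its parent beats everything outside;
  seen from outside, the element of \<open>F\<close> at which a tree hangs beats the whole tree. Both
  semi-single-peakedness (\<open>F\<close> a singleton) and semi-hybridness (\<open>F\<close> the free zone) have this form.\<close>

definition hanging :: "'a pref set \<Rightarrow> 'a set \<Rightarrow> 'a rel \<Rightarrow> bool" where
  "hanging D F R \<longleftrightarrow> single_valued R \<and> wf (R\<inverse>) \<and> Domain R = - F \<and>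
     (\<forall>z m P y. (z, m) \<in> R \<longrightarrow> P \<in> D \<longrightarrow> (peak P, z) \<in> R\<^sup>* \<longrightarrow> (y, z) \<notin> R\<^sup>* \<longrightarrow> (m, y) \<in> P) \<and>
     (\<forall>c\<in>F. \<forall>P\<in>D. \<forall>y. (peak P, c) \<notin> R\<^sup>* \<longrightarrow> (y, c) \<in> R\<^sup>* \<longrightarrow> (c, y) \<in> P)"

context
  fixes D :: "'a::finite pref set" and F R
  assumes hang: "hanging D F R"
begin

lemma hanging_single: "single_valued R" and hanging_wf: "wf (R\<inverse>)" and hanging_Domain: "Domain R = - F"
  using hang unfolding hanging_def by blast+

lemma hanging_in:
  "(z, m) \<in> R \<Longrightarrow> P \<in> D \<Longrightarrow> (peak P, z) \<in> R\<^sup>* \<Longrightarrow> (y, z) \<notin> R\<^sup>* \<Longrightarrow> (m, y) \<in> P"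
  using hang unfolding hanging_def by blast

lemma hanging_out:
  "c \<in> F \<Longrightarrow> P \<in> D \<Longrightarrow> (peak P, c) \<notin> R\<^sup>* \<Longrightarrow> (y, c) \<in> R\<^sup>* \<Longrightarrow> (c, y) \<in> P"
  using hang unfolding hanging_def by blast

lemma hanging_not_Domain: "c \<in> F \<Longrightarrow> (c, y) \<in> R\<^sup>* \<Longrightarrow> y = c"
  using hanging_Domain by (auto elim: converse_rtranclE)

lemma hanging_rootE:
  obtains c where "c \<in> F" "(x, c) \<in> R\<^sup>*"
proof -
  have "\<exists>c\<in>F. (x, c) \<in> R\<^sup>*"
  proof (induction x rule: wf_induct_rule[OF hanging_wf])
    case (1 x)
    show ?case
    proof (cases "x \<in> F")
      case False
      then obtain y where "(x, y) \<in> R" using hanging_Domain by blast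
      with 1 show ?thesis by (meson converse_iff converse_rtrancl_into_rtrancl)
    qed auto
  qed
  then show ?thesis using that by blast
qed

lemma hanging_root_unique:
  assumes "c \<in> F" "c' \<in> F" "(x, c) \<in> R\<^sup>*" "(x, c') \<in> R\<^sup>*"
  shows "c = c'"
proof -
  have "(c, c') \<in> R\<^sup>* \<or> (c', c) \<in> R\<^sup>*"
    using single_valued_confluent[OF hanging_single] assms by blast
  then show ?thesis using assms hanging_not_Domain by blast
qed

lemma hanging_antisym: "(x, y) \<in> R\<^sup>* \<Longrightarrow> (y, x) \<in> R\<^sup>* \<Longrightarrow> x = y"
  using acyclic_impl_antisym_rtrancl[of R] wf_acyclic[OF hanging_wf] by (meson acyclic_converse antisymD)

end

section \<open>Hanging trees and the adjacency graph\<close>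

context preferences
begin

text \<open>A preference with peak \<open>x\<close> outside \<open>F\<close> ranks the parent of
  \<open>x\<close> above all else outside the subtree at \<open>x\<close>. If its second alternative
  is not in that subtree, it is therefore the parent. This is applied to both ends of the
  edge.\<close>

lemma adjacent_hanging:
  assumes hang: "hanging D F R" and xy: "(x, y) \<in> adjacency D"
  shows "x \<in> F \<and> y \<in> F \<or> (x, y) \<in> R \<or> (y, x) \<in> R"
proof -
  have step: "(x, y) \<in> R \<or> (y, x) \<in> R\<^sup>*" if a: "(x, y) \<in> adjacency D" and x: "x \<notin> F" for x y
  proof (rule ccontr)
    assume n: "\<not> ?thesis"
    obtain m where m: "(x, m) \<in> R" using x hanging_Domain[OF hang] by blast
    obtain P where P: "P \<in> D" "peak P = x" "ranked 2 P = y"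
      using a by (meson adjacencyE)
    have "(m, y) \<in> P" using hanging_in[OF hang m P(1)] P(2) n by blast
    then have "m = y \<or> m = x" using pref_secondD P by blast
    moreover have "m \<noteq> x" using m wf_not_refl[OF hanging_wf[OF hang]] by blast
    ultimately show False using m n by blast
  qed
  have xy': "(y, x) \<in> adjacency D" "x \<noteq> y" using xy adjacency_sym adjacency_irrefl by blast+
  have F: "x \<notin> F" if "(x, y) \<in> R\<^sup>*" using that xy'(2) hanging_not_Domain[OF hang] by blast
  have F': "y \<notin> F" if "(y, x) \<in> R\<^sup>*" using that xy'(2) hanging_not_Domain[OF hang] by blast
  show ?thesis
    using step[OF xy] step[OF xy'(1)] F F' hanging_antisym[OF hang] xy'(2) by blast
qed

text \<open>A walk from \<open>z\<close> to its parent \<open>m\<close> has to leave the subtree at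
  \<open>z\<close>, and \<open>adjacent_hanging\<close> permits no exit but
  \<open>(z, m)\<close>.\<close>

lemma hanging_subset_adjacency:
  assumes hang: "hanging D F R" and conn: "path_connected_domain D"
  shows "R \<subseteq> adjacency D"
proof (intro subrelI)
  fix z m assume zm: "(z, m) \<in> R"
  have "(z, m) \<in> (adjacency D)\<^sup>*"
    using conn unfolding path_connected_domain_def connected_in_def by simp
  moreover have "(m, z) \<notin> R\<^sup>*"
    using zm hanging_antisym[OF hang] wf_not_refl[OF hanging_wf[OF hang]] by blast
  ultimately have "\<exists>x y. (x, y) \<in> adjacency D \<and> (x, z) \<in> R\<^sup>* \<and> (y, z) \<notin> R\<^sup>*"
  proof (induction rule: rtrancl_induct)
    case (step y w)
    then show ?case by blast
  qed simp
  then obtain x y where xy: "(x, y) \<in> adjacency D" "(x, z) \<in> R\<^sup>*" "(y, z) \<notin> R\<^sup>*" by blast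
  have "z \<notin> F" using zm hanging_Domain[OF hang] by blast
  then have "x \<notin> F" using xy(2) hanging_not_Domain[OF hang] by blast
  then have "(x, y) \<in> R"
    using adjacent_hanging[OF hang xy(1)] xy(2,3) by (meson converse_rtrancl_into_rtrancl)
  then have "x = z" using xy(2,3) hanging_single[OF hang] by (metis converse_rtranclE single_valuedD)
  then have "y = m" using \<open>(x, y) \<in> R\<close> zm hanging_single[OF hang] by (metis single_valuedD)
  with \<open>x = z\<close> xy show "(z, m) \<in> adjacency D" by simp
qed

text \<open>A single root makes the forest one tree, and this tree is the adjacency graph itself, to
  which condition (iii) of semi-hybrid domains refers.\<close>

lemma hanging_singleton:
  assumes hang: "hanging D {w} R" and conn: "path_connected_domain D"
  shows "is_tree (adjacency D)" "D \<subseteq> SSP_prefs (adjacency D) w"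
proof -
  interpret rooted R w
    using hanging_single[OF hang] hanging_wf[OF hang] hanging_Domain[OF hang] by unfold_locales
  have "adjacency D \<subseteq> R \<union> R\<inverse>"
    using adjacent_hanging[OF hang] adjacency_irrefl by fast
  then have G: "adjacency D = T"
    using hanging_subset_adjacency[OF hang conn] adjacency_sym by fast
  then show "is_tree (adjacency D)" using tree by simp
  have "semi_single_peaked T w P" if "P \<in> D" for P
    using hanging_in[OF hang] that unfolding semi_single_peaked_iff[OF linear[OF that]] by blast
  then show "D \<subseteq> SSP_prefs (adjacency D) w" using linear G unfolding SSP_prefs_def by auto
qed

end

section \<open>Semi-hybridness and hanging trees\<close>

context preferences
begin

text \<open>\<open>R\<close> orients the edges outside the free zone towards \<open>a\<close>. The
  orientation towards \<open>b\<close> agrees there, since neither threshold lies in a hanging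
  subtree, so one relation serves the preferences on both sides.\<close>

lemma semi_hybrid_hanging:
  assumes T: "is_tree T" and dual: "dual_thresholds T a b" and SH: "D \<subseteq> SH_prefs T a b"
  shows "\<exists>R. hanging D (path_verts T a b) R"
proof -
  let ?A = "parent_rel T a" and ?B = "parent_rel T b"
  interpret A: rooted ?A a by (rule rooted_parent[OF T])
  interpret B: rooted ?B b by (rule rooted_parent[OF T])
  note TA = parent_rel_un[OF T, of a] and TB = parent_rel_un[OF T, of b]
  note sym = path_verts_sym[OF T]
  define F where "F = path_verts T a b"
  have F: "m \<in> F \<longleftrightarrow> (b, m) \<in> ?A\<^sup>*" for m
    using A.path_to_root[of b] sym[of a b] unfolding TA F_def by simp
  have abF: "a \<in> F" "b \<in> F" using path_verts_ends[OF T] unfolding F_def by auto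
  define R where "R = {(z, m). (z, m) \<in> ?A \<and> z \<notin> F}"
  have RA: "R \<subseteq> ?A" unfolding R_def by blast
  then have RA': "(x, y) \<in> R\<^sup>* \<Longrightarrow> (x, y) \<in> ?A\<^sup>*" for x y using rtrancl_mono by blast
  have AR: "(x, z) \<in> ?A\<^sup>* \<Longrightarrow> z \<notin> F \<Longrightarrow> (x, z) \<in> R\<^sup>*" for x z
  proof (induction rule: converse_rtrancl_induct)
    case (step x y)
    have "x \<notin> F"
    proof
      assume "x \<in> F"
      then have "(b, z) \<in> ?A\<^sup>*" using F step.hyps by (meson rtrancl_trans converse_rtrancl_into_rtrancl)
      then show False using F step.prems by blast
    qed
    then have "(x, y) \<in> R" using step.hyps unfolding R_def by blast
    with step show ?case by (meson converse_rtrancl_into_rtrancl)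
  qed simp
  have single: "single_valued R" using A.single RA by (rule single_valued_subset[rotated])
  have wfR: "wf (R\<inverse>)" using A.wf by (rule wf_subset) (use RA in blast)
  have dom: "Domain R = - F" using A.domain_R abF unfolding R_def by blast
  \<comment> \<open>The projection of \<open>x\<close> on the free zone is its least common ancestor
    with \<open>b\<close>; dual thresholds therefore make every tree hang at \<open>a\<close> or
    \<open>b\<close>.\<close>
  have lca: "l \<in> {a, b} \<and> (x, l) \<in> R\<^sup>* \<and> l \<in> path_verts T x b" if x: "x \<notin> F"
    and l: "(b, l) \<in> ?A\<^sup>*" "(x, l) \<in> ?A\<^sup>*" "l \<in> path_verts T b x"
      "\<And>m. (b, m) \<in> ?A\<^sup>* \<Longrightarrow> (x, m) \<in> ?A\<^sup>* \<Longrightarrow> (l, m) \<in> ?A\<^sup>*" for x l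
  proof -
    have "{m. (b, m) \<in> ?A\<^sup>*} = F" using F by blast
    then have "proj T x F = l" using A.proj_anc[OF l(1,2,4)] x F unfolding TA by simp
    then have "l \<in> {a, b}" using dual x unfolding dual_thresholds_def F_def by blast
    moreover have "x \<noteq> l" using x l F by blast
    then obtain z where z: "(x, z) \<in> ?A\<^sup>*" "(z, l) \<in> ?A" "(l, z) \<notin> ?A\<^sup>*"
      using A.desc_stepE[OF l(2)] by metis
    then have "z \<notin> F" using l(4) F by blast
    then have "(x, l) \<in> R\<^sup>*" using AR z unfolding R_def by (auto intro: rtrancl_into_rtrancl)
    ultimately show ?thesis using l(3) sym by blast
  qed
  have root: "\<exists>l. l \<in> {a, b} \<and> (x, l) \<in> R\<^sup>* \<and> l \<in> path_verts T x b" if x: "x \<notin> F" for x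
    using A.common_ancestor[of b x] lca[OF x] unfolding TA by metis
  have notdom: "(c, y) \<in> R\<^sup>* \<Longrightarrow> c \<in> F \<Longrightarrow> y = c" for c y
    using dom by (auto elim: converse_rtranclE)
  have runique: "c = c'" if "(x, c) \<in> R\<^sup>*" "(x, c') \<in> R\<^sup>*" "c \<in> F" "c' \<in> F" for x c c'
    using single_valued_confluent[OF single that(1,2)] notdom that(3,4) by blast
  have bpath: "(x, b) \<in> R\<^sup>* \<Longrightarrow> b \<in> path_verts T x a" for x
    using RA' A.path_to_root[of x] unfolding TA by blast
  have desc_eq: "(x, z) \<in> ?A\<^sup>* \<longleftrightarrow> (x, z) \<in> ?B\<^sup>*" if z: "z \<notin> F" for x z
  proof -
    have bz: "(b, z) \<notin> ?A\<^sup>*" using F z by blast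
    have "(x, z) \<in> ?B\<^sup>* \<longleftrightarrow> z \<in> path_verts T x b"
      using B.path_to_root[of x] unfolding TB by blast
    also have "\<dots> \<longleftrightarrow> (x, z) \<in> ?A\<^sup>*"
    proof
      assume "z \<in> path_verts T x b"
      then show "(x, z) \<in> ?A\<^sup>*" using A.path_outside_desc[OF _ bz] unfolding TA by blast
    next
      assume x: "(x, z) \<in> ?A\<^sup>*"
      have "z \<noteq> a" using z abF by blast
      then obtain m where "(z, m) \<in> ?A" using A.domain_R by blast
      then show "z \<in> path_verts T x b" using A.path_through(1)[OF _ x bz] unfolding TA by blast
    qed
    finally show ?thesis by simp
  qed
  have step_eq: "(z, m) \<in> ?B" if zm: "(z, m) \<in> ?A" "z \<notin> F" for z m
  proof -
    have "(b, z) \<notin> ?A\<^sup>*" using F zm by blast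
    then have "m \<in> path_verts T z b" using A.path_through(2)[OF zm(1)] unfolding TA by blast
    then show ?thesis using zm abF unfolding parent_rel_def by blast
  qed
  have sh: "linear_order P" "semi_hybrid T a b P" if "P \<in> D" for P
    using that SH unfolding SH_prefs_def by blast+
  have "(m, y) \<in> P"
    if zm: "(z, m) \<in> R" and P: "P \<in> D" and x: "(peak P, z) \<in> R\<^sup>*" and y: "(y, z) \<notin> R\<^sup>*" for z m P y
  proof -
    have z: "(z, m) \<in> ?A" "z \<notin> F" using zm unfolding R_def by blast+
    have x': "(peak P, z) \<in> ?A\<^sup>*" "(peak P, z) \<in> ?B\<^sup>*" using RA'[OF x] desc_eq[OF z(2)] by blast+
    have y': "(y, z) \<notin> ?A\<^sup>*" "(y, z) \<notin> ?B\<^sup>*" using y AR z(2) desc_eq[OF z(2)] by blast+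
    have xF: "peak P \<notin> F" using notdom[OF x] z(2) by blast
    obtain l where l: "l \<in> {a, b}" "(peak P, l) \<in> R\<^sup>*" "l \<in> path_verts T (peak P) b"
      using root[OF xF] by blast
    show ?thesis
    proof (cases "l = a")
      case True
      then have "semi_single_peaked T a P"
        using sh(2)[OF P] l xF abF unfolding semi_hybrid_def beyond_def by blast
      then show ?thesis using A.semi_single_peaked_iff[OF sh(1)[OF P]] z(1) x'(1) y'(1) unfolding TA by blast
    next
      case False
      then have "b \<in> path_verts T (peak P) a" using l bpath by blast
      then have "semi_single_peaked T b P"
        using sh(2)[OF P] xF abF unfolding semi_hybrid_def beyond_def by blast
      then show ?thesis
        using B.semi_single_peaked_iff[OF sh(1)[OF P]] step_eq[OF z] x'(2) y'(2) unfolding TB by blast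
    qed
  qed
  moreover have "(c, y) \<in> P"
    if c: "c \<in> F" and P: "P \<in> D" and x: "(peak P, c) \<notin> R\<^sup>*" and y: "(y, c) \<in> R\<^sup>*" for c P y
  proof (cases "y = c")
    case True
    then show ?thesis using pref_refl P by blast
  next
    case False
    then have yF: "y \<notin> F" using notdom y by blast
    obtain l where l: "l \<in> {a, b}" "(y, l) \<in> R\<^sup>*" "l \<in> path_verts T y b" using root[OF yF] by blast
    have lc: "l = c" using runique[OF l(2) y _ c] l(1) abF by blast
    have a: "best P (beyond T a b) = a" if "c = a"
    proof (cases "peak P \<in> F")
      case True
      then show ?thesis using sh(2)[OF P] unfolding semi_hybrid_def F_def by blast
    next
      case xF: False
      then obtain k where k: "k \<in> {a, b}" "(peak P, k) \<in> R\<^sup>*" using root by blast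
      then have "(peak P, b) \<in> R\<^sup>*" using x that by blast
      then have "peak P \<in> beyond T b a - {b}" using bpath xF abF unfolding beyond_def by blast
      then show ?thesis using sh(2)[OF P] unfolding semi_hybrid_def by blast
    qed
    have b: "best P (beyond T b a) = b" if "c = b"
    proof (cases "peak P \<in> F")
      case True
      then show ?thesis using sh(2)[OF P] unfolding semi_hybrid_def F_def by blast
    next
      case xF: False
      then obtain k where k: "k \<in> {a, b}" "(peak P, k) \<in> R\<^sup>*" "k \<in> path_verts T (peak P) b" using root by blast
      then have "k = a" using x that by blast
      then have "peak P \<in> beyond T a b - {a}" using k xF abF unfolding beyond_def by blast
      then show ?thesis using sh(2)[OF P] unfolding semi_hybrid_def by blast
    qed
    have "c \<in> beyond T a b \<and> y \<in> beyond T a b" if "c = a"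
      using l(3) lc that path_verts_ends[OF T] unfolding beyond_def by blast
    moreover have "c \<in> beyond T b a \<and> y \<in> beyond T b a" if "c = b"
      using bpath[of y] y that path_verts_ends[OF T] unfolding beyond_def by blast
    ultimately show ?thesis
      using a b l(1) lc best_iff[OF sh(1)[OF P], of c] by blast
  qed
  ultimately have "hanging D F R" unfolding hanging_def using single wfR dom by blast
  then show ?thesis unfolding F_def by blast
qed

end

text \<open>\<open>L\<close> is the successor relation of an enumeration \<open>g\<close> of
  \<open>F\<close> that starts with \<open>a\<close> and ends with \<open>b\<close>.\<close>

lemma line_exists:
  assumes "finite F" "a \<in> F" "b \<in> F" "a \<noteq> b"
  obtains L :: "'a rel" where "L \<subseteq> F \<times> F" "single_valued L" "single_valued (L\<inverse>)" "wf L" "wf (L\<inverse>)"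
    "Domain L = F - {b}" "Range L = F - {a}"
proof -
  let ?M = "F - {a, b}"
  define n where "n = card ?M"
  obtain h where h: "bij_betw h ?M {0..<n}"
    using ex_bij_betw_finite_nat[of ?M] assms(1) unfolding n_def by auto
  define g where "g = (\<lambda>x. if x = a then 0 else if x = b then Suc n else Suc (h x))"
  have gM: "h x < n" if "x \<in> ?M" for x using bij_betwE[OF h] that by auto
  have inj: "x = y" if "x \<in> F" "y \<in> F" "g x = g y" for x y
    using that gM[of x] gM[of y] bij_betw_imp_inj_on[OF h] assms(4)
    unfolding g_def by (auto split: if_splits dest: inj_onD)
  have surj: "\<exists>x\<in>F. g x = k" if k: "k \<le> Suc n" for k
  proof -
    consider "k = 0" | "k = Suc n" | j where "k = Suc j" "j < n" using k by (cases k) (auto simp: le_less)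
    then show ?thesis
    proof cases
      case 3
      then obtain x where "x \<in> ?M" "h x = j" using h by (metis atLeast0LessThan bij_betw_iff_bijections lessThan_iff)
      then show ?thesis using 3 unfolding g_def by (intro bexI[of _ x]) auto
    qed (use assms g_def in auto)
  qed
  have bd: "g x \<le> Suc n" if "x \<in> F" for x using gM[of x] that unfolding g_def by auto
  have gb: "g x = Suc n \<longleftrightarrow> x = b" "g x = 0 \<longleftrightarrow> x = a" if "x \<in> F" for x
    using gM[of x] that assms(4) unfolding g_def by auto
  define L where "L = {(x, y). x \<in> F \<and> y \<in> F \<and> g y = Suc (g x)}"
  show ?thesis
  proof
    show "L \<subseteq> F \<times> F" unfolding L_def by auto
    show "single_valued L" "single_valued (L\<inverse>)"
      unfolding L_def single_valued_def using inj by auto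
    show "wf L" by (rule wf_subset[OF wf_measure[of g]]) (auto simp: L_def)
    show "wf (L\<inverse>)" by (rule wf_subset[OF wf_measure[of "\<lambda>x. Suc n - g x"]]) (use bd in \<open>force simp: L_def\<close>)
    show "Domain L = F - {b}"
    proof (intro equalityI subsetI)
      fix x assume "x \<in> Domain L"
      then show "x \<in> F - {b}" using bd gb unfolding L_def by fastforce
    next
      fix x assume x: "x \<in> F - {b}"
      then have "Suc (g x) \<le> Suc n" using bd[of x] gb(1)[of x] by simp
      then obtain y where "y \<in> F" "g y = Suc (g x)" using surj by blast
      then show "x \<in> Domain L" using x unfolding L_def by blast
    qed
    show "Range L = F - {a}"
    proof (intro equalityI subsetI)
      fix x assume "x \<in> Range L"
      then show "x \<in> F - {a}" using gb unfolding L_def by fastforce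
    next
      fix x assume x: "x \<in> F - {a}"
      then obtain j where j: "g x = Suc j" using gb(2)[of x] by (cases "g x") auto
      then obtain y where "y \<in> F" "g y = j" using surj[of j] bd[of x] x by auto
      then show "x \<in> Range L" using x j unfolding L_def by blast
    qed
  qed
qed

text \<open>One side of the tree that arranges \<open>F\<close> in a line from \<open>a\<close> to \<open>b\<close>, seen from the root \<open>b\<close>;
  the other side is obtained by reversing the line.\<close>

lemma line_tree:
  fixes D :: "'a::finite pref set"
  assumes hang: "hanging D F R" and abF: "a \<in> F" "b \<in> F" "a \<noteq> b"
    and L: "L \<subseteq> F \<times> F" "single_valued L" "wf L" "wf (L\<inverse>)" "Domain L = F - {b}" "Range L = F - {a}"
    and T: "T = (R \<union> L) \<union> (R \<union> L)\<inverse>"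
  shows "is_tree T" "path_verts T a b = F"
    "z \<in> beyond T a b \<longleftrightarrow> (z, a) \<in> R\<^sup>*"
    "z \<notin> F \<Longrightarrow> (z, a) \<in> R\<^sup>* \<Longrightarrow> proj T z F = a"
    "P \<in> D \<Longrightarrow> linear_order P \<Longrightarrow> (peak P, b) \<in> R\<^sup>* \<Longrightarrow> semi_single_peaked T b P"
proof -
  let ?S = "R \<union> L"
  note dom = hanging_Domain[OF hang]
  note notdom = hanging_not_Domain[OF hang]
  have "rooted ?S b"
  proof
    show "single_valued ?S"
      using hanging_single[OF hang] L(1,2) dom unfolding single_valued_def by blast
    have "wf (L\<inverse> \<union> R\<inverse>)"
      using L(4) hanging_wf[OF hang] by (rule wf_Un) (use L(1) dom in blast)
    then show "wf (?S\<inverse>)" by (simp add: converse_Un Un_commute)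
    show "Domain ?S = - {b}" using dom L(5) abF by blast
  qed
  then interpret rooted ?S b .
  show t: "is_tree T" using tree unfolding T .
  have RS: "(x, y) \<in> R\<^sup>* \<Longrightarrow> (x, y) \<in> ?S\<^sup>*" for x y using rtrancl_mono[of R ?S] by blast
  have to_out: "(x, z) \<in> ?S\<^sup>* \<Longrightarrow> z \<notin> F \<Longrightarrow> (x, z) \<in> R\<^sup>*" for x z
  proof (induction rule: converse_rtrancl_induct)
    case (step x y)
    then have "(y, z) \<in> R\<^sup>*" by blast
    then have "y \<notin> F" using notdom step.prems by blast
    then have "(x, y) \<in> R" using step.hyps L(1) by blast
    with \<open>(y, z) \<in> R\<^sup>*\<close> show ?case by (meson converse_rtrancl_into_rtrancl)
  qed simp
  \<comment> \<open>No edge of the line leads into its first element \<open>a\<close>.\<close>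
  have to_a: "(x, a) \<in> ?S\<^sup>* \<Longrightarrow> (x, a) \<in> R\<^sup>*" for x
  proof (induction rule: converse_rtrancl_induct)
    case (step x y)
    have "(x, y) \<notin> L"
    proof
      assume xy: "(x, y) \<in> L"
      then have "y = a" using notdom step.IH L(1) by blast
      then show False using xy L(6) by blast
    qed
    then show ?case using step by (meson Un_iff converse_rtrancl_into_rtrancl)
  qed simp
  have stay: "(x, z) \<in> ?S\<^sup>* \<Longrightarrow> x \<in> F \<Longrightarrow> z \<in> F" for x z
    using to_out notdom by blast
  have line: "m \<in> F \<Longrightarrow> (a, m) \<in> ?S\<^sup>*" for m
  proof (induction m rule: wf_induct_rule[OF L(3)])
    case (1 m)
    show ?case
    proof (cases "m = a")
      case False
      then obtain k where k: "(k, m) \<in> L" using 1 L(6) by blast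
      then have "(a, k) \<in> ?S\<^sup>*" using 1 L(1) by blast
      with k show ?thesis by (meson UnI2 rtrancl_into_rtrancl)
    qed simp
  qed
  have anc: "{m. (a, m) \<in> ?S\<^sup>*} = F" using line stay abF(1) by blast
  then show "path_verts T a b = F" using path_to_root unfolding T by simp
  show "z \<in> beyond T a b \<longleftrightarrow> (z, a) \<in> R\<^sup>*"
    using path_to_root[of z] to_a RS unfolding T[symmetric] beyond_def by blast
  show "proj T z F = a" if "z \<notin> F" "(z, a) \<in> R\<^sup>*"
  proof -
    have "(a, z) \<notin> ?S\<^sup>*" using that(1) anc by blast
    then have "proj T z {m. (a, m) \<in> ?S\<^sup>*} = a"
      unfolding T using RS[OF that(2)] by (intro proj_anc) auto
    then show ?thesis unfolding anc .
  qed
  assume P: "P \<in> D" "linear_order P" and x: "(peak P, b) \<in> R\<^sup>*"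
  \<comment> \<open>Above a peak that hangs at the root \<open>b\<close>, no other element of
    \<open>F\<close> occurs, so the edges of the line impose no condition on such a
    preference.\<close>
  have only_b: "(x, b) \<in> R\<^sup>* \<Longrightarrow> (x, z) \<in> ?S\<^sup>* \<Longrightarrow> z \<in> F \<Longrightarrow> z = b" for x z
  proof (induction rule: converse_rtrancl_induct)
    case base
    then show ?case using to_root desc_antisym by blast
  next
    case (step x y)
    have "x \<noteq> z" using step dom by blast
    then have "(y, z) \<in> ?S\<^sup>*" using parent_desc step by blast
    then show ?case using step by blast
  qed
  have "(m, y) \<in> P" if z: "(z, m) \<in> ?S" "(peak P, z) \<in> ?S\<^sup>*" "(y, z) \<notin> ?S\<^sup>*" for z m y
  proof -
    have "z \<noteq> b" using z(1) domain_R by blast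
    then have zF: "z \<notin> F" using only_b[OF x z(2)] by blast
    then have "(z, m) \<in> R" "(peak P, z) \<in> R\<^sup>*" "(y, z) \<notin> R\<^sup>*"
      using z to_out RS L(1) by blast+
    then show ?thesis using hanging_in[OF hang _ P(1)] by blast
  qed
  then show "semi_single_peaked T b P"
    using semi_single_peaked_iff[OF P(2)] unfolding T by blast
qed

context preferences
begin

text \<open>Let the peaks of two reversed preferences hang at \<open>p\<close> and \<open>q\<close>.
  Any other \<open>c\<close> in \<open>F\<close> beats its whole tree in both of them, which is
  impossible unless the tree is \<open>c\<close> alone.\<close>

lemma hanging_semi_hybrid:
  assumes div: "diverse D" and hang: "hanging D F R" and F: "card F \<ge> 2"
  shows "\<exists>T a b. is_tree T \<and> dual_thresholds T a b \<and> D \<subseteq> SH_prefs T a b \<and> path_verts T a b = F"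
proof -
  obtain P Q where PQ: "P \<in> D" "Q \<in> D" and rev: "\<And>a b. a \<noteq> b \<Longrightarrow> (a, b) \<in> P \<longleftrightarrow> (b, a) \<in> Q"
    using div unfolding diverse_def by blast
  obtain p where p: "p \<in> F" "(peak P, p) \<in> R\<^sup>*" using hanging_rootE[OF hang] by blast
  obtain q where q: "q \<in> F" "(peak Q, q) \<in> R\<^sup>*" using hanging_rootE[OF hang] by blast
  have two: "c \<in> {p, q}" if c: "c \<in> F" "(y, c) \<in> R\<^sup>*" "y \<noteq> c" for c y
  proof (rule ccontr)
    assume n: "c \<notin> {p, q}"
    then have "(peak P, c) \<notin> R\<^sup>*" "(peak Q, c) \<notin> R\<^sup>*"
      using hanging_root_unique[OF hang] c(1) p q by blast+
    then have "(c, y) \<in> P" "(c, y) \<in> Q" using hanging_out[OF hang c(1)] PQ c(2) by blast+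
    then show False using rev[of c y] pref_antisym[OF PQ(2)] c(3) by blast
  qed
  \<comment> \<open>\<open>b\<close> is \<open>q\<close>, or any other element of \<open>F\<close>
    if both peaks hang at \<open>p\<close>.\<close>
  have "\<exists>b. b \<in> F \<and> p \<noteq> b \<and> q \<in> {p, b}"
  proof (cases "q = p")
    case True
    have "\<not> F \<subseteq> {p}" using F card_mono[of "{p}" F] by auto
    then show ?thesis using True by auto
  qed (use q in auto)
  then obtain b where b: "b \<in> F" "p \<noteq> b" "q \<in> {p, b}" by blast
  obtain L where L: "L \<subseteq> F \<times> F" "single_valued L" "single_valued (L\<inverse>)" "wf L" "wf (L\<inverse>)"
      "Domain L = F - {b}" "Range L = F - {p}"
    using line_exists[of F p b] p(1) b by (metis finite)
  define T where "T = (R \<union> L) \<union> (R \<union> L)\<inverse>"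
  \<comment> \<open>Reversing the line gives the same tree rooted at \<open>p\<close>, so
    \<open>line_tree\<close> covers both ends.\<close>
  have T': "T = (R \<union> L\<inverse>) \<union> (R \<union> L\<inverse>)\<inverse>" unfolding T_def by auto
  note 1 = line_tree[OF hang p(1) b(1,2) L(1,2,4,5,6,7) T_def]
  have "L\<inverse> \<subseteq> F \<times> F" "wf ((L\<inverse>)\<inverse>)" "Domain (L\<inverse>) = F - {p}" "Range (L\<inverse>) = F - {b}"
    using L by auto
  note 2 = line_tree[OF hang b(1) p(1) b(2)[symmetric] this(1) L(3,5) this(2-4) T']
  have "p \<in> beyond T p b" "b \<in> beyond T b p" using 1(3) 2(3) by auto
  note best = best_iff[OF _ this(1)] best_iff[OF _ this(2)]
  have root: "x \<in> F \<or> (x, p) \<in> R\<^sup>* \<or> (x, b) \<in> R\<^sup>*" for x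
  proof -
    obtain c where c: "c \<in> F" "(x, c) \<in> R\<^sup>*" using hanging_rootE[OF hang] by blast
    then show ?thesis using two[OF c] b(3) by blast
  qed
  have out_p: "best P (beyond T p b) = p" if "P \<in> D" "peak P = p \<or> (peak P, p) \<notin> R\<^sup>*" for P
    using hanging_out[OF hang p(1) that(1)] that peak_top best(1)[OF linear] 1(3) by metis
  have out_b: "best P (beyond T b p) = b" if "P \<in> D" "peak P = b \<or> (peak P, b) \<notin> R\<^sup>*" for P
    using hanging_out[OF hang b(1) that(1)] that peak_top best(2)[OF linear] 2(3) by metis
  have disj: "\<not> ((x, p) \<in> R\<^sup>* \<and> (x, b) \<in> R\<^sup>*)" for x
    using hanging_root_unique[OF hang p(1) b(1)] b(2) by blast
  have inF: "(x, p) \<in> R\<^sup>* \<Longrightarrow> x \<in> F \<Longrightarrow> x = p" "(x, b) \<in> R\<^sup>* \<Longrightarrow> x \<in> F \<Longrightarrow> x = b" for x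
    using hanging_not_Domain[OF hang] by blast+
  have "semi_hybrid T p b P" if P: "P \<in> D" for P
    unfolding semi_hybrid_def
  proof (intro conjI impI)
    assume "peak P \<in> beyond T p b - {p}"
    then have x: "(peak P, p) \<in> R\<^sup>*" using 1(3) by blast
    show "semi_single_peaked T p P" using 2(5)[OF P linear[OF P] x] .
    show "best P (beyond T b p) = b" using out_b[OF P] disj x by blast
  next
    assume "peak P \<in> beyond T b p - {b}"
    then have x: "(peak P, b) \<in> R\<^sup>*" using 2(3) by blast
    show "semi_single_peaked T b P" using 1(5)[OF P linear[OF P] x] .
    show "best P (beyond T p b) = p" using out_p[OF P] disj x by blast
  next
    assume "peak P \<in> path_verts T p b"
    then have "peak P \<in> F" using 1(2) by simp
    then show "best P (beyond T p b) = p" "best P (beyond T b p) = b"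
      using out_p[OF P] out_b[OF P] inF by blast+
  qed
  then have "D \<subseteq> SH_prefs T p b" using linear unfolding SH_prefs_def by blast
  moreover have "dual_thresholds T p b"
    unfolding dual_thresholds_def 1(2) using b(2) root 1(4) 2(4) by blast
  ultimately show ?thesis using 1(1,2) by blast
qed

end

section \<open>Reduction to two voters\<close>

context preferences
begin

text \<open>Unanimity is required on \<open>F\<close> only, since fixing the peaks of some voters in the free zone leaves
  a rule that is unanimous just there. The flag \<open>tops\<close> adds tops-onlyness. The voters form an
  arbitrary finite set, so that merging two of them needs no renumbering.\<close>

definition rule2 :: "bool \<Rightarrow> 'a set \<Rightarrow> ('a pref \<Rightarrow> 'a pref \<Rightarrow> 'a) \<Rightarrow> bool" where
  "rule2 tops F h \<longleftrightarrow>
     (\<forall>P\<in>D. \<forall>P'\<in>D. \<forall>Q\<in>D. (h P Q, h P' Q) \<in> P \<and> (h Q P, h Q P') \<in> P) \<and>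
     (\<forall>P\<in>D. \<forall>Q\<in>D. peak P = peak Q \<longrightarrow> peak P \<in> F \<longrightarrow> h P Q = peak P) \<and>
     (tops \<longrightarrow> (\<forall>P\<in>D. \<forall>P'\<in>D. \<forall>Q\<in>D. \<forall>Q'\<in>D. peak P = peak P' \<longrightarrow> peak Q = peak Q' \<longrightarrow> h P Q = h P' Q'))"

definition dictatorial2 :: "'a set \<Rightarrow> ('a pref \<Rightarrow> 'a pref \<Rightarrow> 'a) \<Rightarrow> bool" where
  "dictatorial2 F h \<longleftrightarrow>
     (\<forall>P\<in>D. \<forall>Q\<in>D. peak P \<in> F \<longrightarrow> peak Q \<in> F \<longrightarrow> h P Q = peak P) \<or>
     (\<forall>P\<in>D. \<forall>Q\<in>D. peak P \<in> F \<longrightarrow> peak Q \<in> F \<longrightarrow> h P Q = peak Q)"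

text \<open>Profiles are arbitrary functions here; the last clause replaces the extensionality built
  into \<open>profiles\<close>.\<close>

definition ruleN :: "bool \<Rightarrow> 'a set \<Rightarrow> nat set \<Rightarrow> 'a scf \<Rightarrow> bool" where
  "ruleN tops F N f \<longleftrightarrow>
     (\<forall>P i Q. (\<forall>k\<in>N. P k \<in> D) \<longrightarrow> i \<in> N \<longrightarrow> Q \<in> D \<longrightarrow> (f P, f (P(i := Q))) \<in> P i) \<and>
     (\<forall>P x. (\<forall>k\<in>N. P k \<in> D \<and> peak (P k) = x) \<longrightarrow> x \<in> F \<longrightarrow> f P = x) \<and>
     (tops \<longrightarrow> (\<forall>P P'. (\<forall>k\<in>N. P k \<in> D \<and> P' k \<in> D \<and> peak (P k) = peak (P' k)) \<longrightarrow> f P = f P')) \<and>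
     (\<forall>P P'. (\<forall>k\<in>N. P k = P' k) \<longrightarrow> f P = f P')"

lemma ruleN_sp: "ruleN tops F N f \<Longrightarrow> \<forall>k\<in>N. P k \<in> D \<Longrightarrow> i \<in> N \<Longrightarrow> Q \<in> D \<Longrightarrow> (f P, f (P(i := Q))) \<in> P i"
  and ruleN_unanimous: "ruleN tops F N f \<Longrightarrow> \<forall>k\<in>N. P k \<in> D \<and> peak (P k) = x \<Longrightarrow> x \<in> F \<Longrightarrow> f P = x"
  and ruleN_tops: "ruleN tops F N f \<Longrightarrow> tops \<Longrightarrow>
    \<forall>k\<in>N. P k \<in> D \<and> P' k \<in> D \<and> peak (P k) = peak (P' k) \<Longrightarrow> f P = f P'"
  and ruleN_dep: "ruleN tops F N f \<Longrightarrow> \<forall>k\<in>N. P k = P' k \<Longrightarrow> f P = f P'"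
  unfolding ruleN_def by blast+

text \<open>\<open>unan\<close> speaks of identical preferences only. If the preferences differ but
  share the peak, voter \<open>i\<close> could obtain the peak by imitating
  \<open>j\<close>.\<close>

lemma ruleN_imp_rule2:
  assumes f: "ruleN tops F N f" and ij: "i \<in> N" "j \<in> N" "i \<noteq> j" and P: "\<forall>k\<in>N. P k \<in> D"
    and unan: "\<And>Q. Q \<in> D \<Longrightarrow> peak Q \<in> F \<Longrightarrow> f (P(i := Q, j := Q)) = peak Q"
  shows "rule2 tops F (\<lambda>Q Q'. f (P(i := Q, j := Q')))"
proof -
  have 1: "(f (P(i := Q, j := Q')), f (P(i := R, j := Q'))) \<in> Q"
    if "Q \<in> D" "Q' \<in> D" "R \<in> D" for Q Q' R
    using ruleN_sp[OF f, of "P(i := Q, j := Q')" i R] that P ij by (simp add: fun_upd_twist)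
  have 2: "(f (P(i := Q, j := Q')), f (P(i := Q, j := R))) \<in> Q'"
    if "Q \<in> D" "Q' \<in> D" "R \<in> D" for Q Q' R
    using ruleN_sp[OF f, of "P(i := Q, j := Q')" j R] that P ij by simp
  have 3: "f (P(i := Q, j := Q')) = peak Q"
    if "Q \<in> D" "Q' \<in> D" "peak Q = peak Q'" "peak Q \<in> F" for Q Q'
  proof -
    have "(f (P(i := Q, j := Q')), f (P(i := Q', j := Q'))) \<in> Q" using 1 that by blast
    then show ?thesis using unan[of Q'] that pref_peakD[of Q] by simp
  qed
  have 4: "f (P(i := Q, j := R)) = f (P(i := Q', j := R'))"
    if tops "Q \<in> D" "Q' \<in> D" "R \<in> D" "R' \<in> D" "peak Q = peak Q'" "peak R = peak R'" for Q Q' R R'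
    using ruleN_tops[OF f \<open>tops\<close>, of "P(i := Q, j := R)" "P(i := Q', j := R')"] that P by simp
  show ?thesis unfolding rule2_def using 1 2 3 4 by blast
qed

text \<open>Voter \<open>i\<close> copies \<open>j\<close>. A misreport of \<open>j\<close> then
  changes two reports, but it splits into two single misreports that are both judged by
  \<open>P j\<close>.\<close>

lemma ruleN_merge:
  assumes f: "ruleN tops F N f" and ij: "i \<in> N" "j \<in> N" "i \<noteq> j"
  shows "ruleN tops F (N - {i}) (\<lambda>P. f (P(i := P j)))"
proof -
  have "(f (P(i := P j)), f ((P(k := Q))(i := (P(k := Q)) j))) \<in> P k"
    if P: "\<forall>l\<in>N - {i}. P l \<in> D" and k: "k \<in> N - {i}" and Q: "Q \<in> D" for P k Q
  proof (cases "k = j")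
    case False
    have "\<forall>l\<in>N. (P(i := P j)) l \<in> D" using P ij by auto
    then have "(f (P(i := P j)), f (P(i := P j, k := Q))) \<in> (P(i := P j)) k"
      using k Q by (intro ruleN_sp[OF f]) auto
    moreover have "(P(k := Q))(i := (P(k := Q)) j) = P(i := P j, k := Q)"
      using False k by (auto simp: fun_eq_iff)
    ultimately show ?thesis using k by simp
  next
    case True
    have P1: "\<forall>l\<in>N. (P(i := P j)) l \<in> D" "\<forall>l\<in>N. (P(i := Q)) l \<in> D" using P ij Q by auto
    have "(f (P(i := P j)), f (P(i := Q))) \<in> P j"
      using ruleN_sp[OF f, of "P(i := P j)" i Q] P1(1) ij(1) Q by simp
    moreover have "(f (P(i := Q)), f (P(i := Q, j := Q))) \<in> P j"
      using ruleN_sp[OF f, of "P(i := Q)" j Q] P1(2) ij Q by simp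
    moreover have "P j \<in> D" using P ij by auto
    ultimately have "(f (P(i := P j)), f (P(i := Q, j := Q))) \<in> P j" using pref_trans by blast
    then show ?thesis using True ij(3) by (simp add: fun_upd_twist)
  qed
  moreover have "f (P(i := P j)) = x" if "\<forall>k\<in>N - {i}. P k \<in> D \<and> peak (P k) = x" "x \<in> F" for P x
    using ruleN_unanimous[OF f, of "P(i := P j)" x] that ij by auto
  moreover have "f (P(i := P j)) = f (P'(i := P' j))"
    if tops "\<forall>k\<in>N - {i}. P k \<in> D \<and> P' k \<in> D \<and> peak (P k) = peak (P' k)" for P P'
    using ruleN_tops[OF f \<open>tops\<close>, of "P(i := P j)" "P'(i := P' j)"] that ij by auto
  moreover have "f (P(i := P j)) = f (P'(i := P' j))" if "\<forall>k\<in>N - {i}. P k = P' k" for P P'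
    using ruleN_dep[OF f, of "P(i := P j)" "P'(i := P' j)"] that ij by auto
  ultimately show ?thesis unfolding ruleN_def by blast
qed

text \<open>For fixed preferences of the others one of the two merged voters dictates, and no other voter
  can influence which one without being able to manipulate.\<close>

lemma ruleN_dictator_of_merged:
  assumes two: "\<And>h. rule2 tops F h \<Longrightarrow> dictatorial2 F h"
    and rich: "\<And>x. \<exists>P\<in>D. peak P = x" and ab: "a \<in> F" "b \<in> F" "a \<noteq> b"
    and N: "finite N" and f: "ruleN tops F N f" and ij: "i \<in> N" "j \<in> N" "i \<noteq> j"
    and merged: "\<And>P. \<forall>k\<in>N - {i}. P k \<in> D \<and> peak (P k) \<in> F \<Longrightarrow> f (P(i := P j)) = peak (P j)"
  shows "\<exists>i\<in>N. \<forall>P. (\<forall>k\<in>N. P k \<in> D \<and> peak (P k) \<in> F) \<longrightarrow> f P = peak (P i)"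
proof -
  define prof where "prof P \<longleftrightarrow> (\<forall>k\<in>N. P k \<in> D \<and> peak (P k) \<in> F)" for P
  define di where "di P \<longleftrightarrow> (\<forall>Q\<in>D. \<forall>Q'\<in>D. peak Q \<in> F \<longrightarrow> peak Q' \<in> F \<longrightarrow> f (P(i := Q, j := Q')) = peak Q)" for P
  define dj where "dj P \<longleftrightarrow> (\<forall>Q\<in>D. \<forall>Q'\<in>D. peak Q \<in> F \<longrightarrow> peak Q' \<in> F \<longrightarrow> f (P(i := Q, j := Q')) = peak Q')" for P
  have dich: "di P \<or> dj P" if P: "prof P" for P
  proof -
    have "f (P(i := Q, j := Q)) = peak Q" if "Q \<in> D" "peak Q \<in> F" for Q
      using merged[of "P(j := Q)"] P that ij unfolding prof_def by (simp add: fun_upd_twist)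
    then have "rule2 tops F (\<lambda>Q Q'. f (P(i := Q, j := Q')))"
      using ruleN_imp_rule2[OF f ij] P unfolding prof_def by blast
    from two[OF this] show ?thesis unfolding dictatorial2_def di_def dj_def by blast
  qed
  have step: "di (P(k := R))" if P: "prof P" "di P" and R: "R \<in> D" "peak R \<in> F" and k: "k \<in> N" "k \<noteq> i" "k \<noteq> j" for P k R
  proof (rule ccontr)
    assume "\<not> di (P(k := R))"
    moreover have P': "prof (P(k := R))" using P R unfolding prof_def by simp
    ultimately have dj: "dj (P(k := R))" using dich by blast
    have Pk: "P k \<in> D" using P k unfolding prof_def by blast
    \<comment> \<open>At \<open>P\<close> the outcome is the peak \<open>x\<close> of
      \<open>i\<close>, after the change of \<open>k\<close> it is the peak \<open>y\<close> of
      \<open>j\<close>. Since \<open>k\<close> prefers \<open>y\<close>, she would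
      manipulate.\<close>
    obtain x y where xy: "x \<in> F" "y \<in> F" "x \<noteq> y" "(y, x) \<in> P k"
      using ab pref_total[OF Pk] by metis
    obtain X where X: "X \<in> D" "peak X = x" using rich by blast
    obtain Y where Y: "Y \<in> D" "peak Y = y" using rich by blast
    have "\<forall>l\<in>N. (P(i := X, j := Y)) l \<in> D" using P(1) X Y unfolding prof_def by simp
    then have "(f (P(i := X, j := Y)), f (P(i := X, j := Y, k := R))) \<in> (P(i := X, j := Y)) k"
      using k(1) R(1) by (intro ruleN_sp[OF f]) auto
    moreover have "(P(k := R))(i := X, j := Y) = P(i := X, j := Y, k := R)"
      using k by (auto simp: fun_eq_iff)
    ultimately have "(f (P(i := X, j := Y)), f ((P(k := R))(i := X, j := Y))) \<in> P k"
      using k by simp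
    then have "(x, y) \<in> P k"
      using P(2) dj X Y xy unfolding di_def dj_def by simp
    then show False using xy pref_antisym[OF Pk] by blast
  qed
  have all: "di P'" if P: "prof P" "di P" and P': "prof P'" for P P'
  proof -
    \<comment> \<open>The voters other than \<open>i\<close> and \<open>j\<close> are switched from
      \<open>P\<close> to \<open>P'\<close> one at a time.\<close>
    have "prof (override_on P P' S) \<and> di (override_on P P' S)" if "finite S" "S \<subseteq> N - {i, j}" for S
      using that
    proof (induction S)
      case empty
      then show ?case using P by simp
    next
      case (insert k S)
      have eq: "override_on P P' (insert k S) = (override_on P P' S)(k := P' k)"
        by (auto simp: override_on_def fun_eq_iff)
      have "prof ((override_on P P' S)(k := P' k))"
        using insert P' unfolding prof_def by auto
      moreover have "di ((override_on P P' S)(k := P' k))"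
        using insert P' unfolding prof_def by (intro step) (auto simp: prof_def)
      ultimately show ?case unfolding eq by blast
    qed
    from this[of "N - {i, j}"] have "di (override_on P P' (N - {i, j}))" using N by simp
    moreover have "f ((override_on P P' (N - {i, j}))(i := Q, j := Q')) = f (P'(i := Q, j := Q'))" for Q Q'
      by (rule ruleN_dep[OF f]) (auto simp: override_on_def)
    ultimately show ?thesis unfolding di_def by simp
  qed
  have triv: "P(i := P i, j := P j) = P" for P :: "nat \<Rightarrow> 'a pref" by simp
  show ?thesis
  proof (cases "\<exists>P. prof P \<and> di P")
    case True
    then have "f P = peak (P i)" if "prof P" for P
      using all[OF _ _ that] that ij triv[of P] unfolding di_def prof_def by metis
    then show ?thesis using ij unfolding prof_def by blast
  next
    case False
    then have "f P = peak (P j)" if "prof P" for P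
      using dich[OF that] that ij triv[of P] unfolding dj_def prof_def by metis
    then show ?thesis using ij unfolding prof_def by blast
  qed
qed

text \<open>Suppose that every merged rule is dictated by a third voter: \<open>k\<close> if
  \<open>i\<close> copies \<open>j\<close>, and \<open>l\<close> if \<open>i\<close> copies
  \<open>k\<close>. Then \<open>l = j\<close>. If now \<open>j\<close> has peak \<open>a\<close> and
  \<open>k\<close> has peak \<open>b\<close>, voter \<open>i\<close> obtains \<open>b\<close> by
  reporting \<open>A\<close> and \<open>a\<close> by reporting \<open>B\<close>, and
  manipulates.\<close>

theorem ruleN_dictatorial:
  assumes two: "\<And>h. rule2 tops F h \<Longrightarrow> dictatorial2 F h"
    and rich: "\<And>x. \<exists>P\<in>D. peak P = x" and ab: "a \<in> F" "b \<in> F" "a \<noteq> b"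
  shows "finite N \<Longrightarrow> card N \<ge> 2 \<Longrightarrow> ruleN tops F N f \<Longrightarrow>
    \<exists>i\<in>N. \<forall>P. (\<forall>k\<in>N. P k \<in> D \<and> peak (P k) \<in> F) \<longrightarrow> f P = peak (P i)"
proof (induction "card N" arbitrary: N f rule: less_induct)
  case less
  note f = less.prems(3)
  obtain A where A: "A \<in> D" "peak A = a" using rich by blast
  obtain B where B: "B \<in> D" "peak B = b" using rich by blast
  show ?case
  proof (cases "card N = 2")
    case True
    then obtain i j where ij: "N = {i, j}" "i \<noteq> j" by (meson card_2_iff)
    have "f (P(i := P j)) = peak (P j)" if "\<forall>k\<in>N - {i}. P k \<in> D \<and> peak (P k) \<in> F" for P
      using that ij by (intro ruleN_unanimous[OF f]) auto
    then show ?thesis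
      using ij by (intro ruleN_dictator_of_merged[OF two rich ab less.prems(1) f, of i j]) auto
  next
    case False
    then have card: "card N > 2" using less.prems(2) by simp
    have merge: "\<exists>k\<in>N - {i}. \<forall>P. (\<forall>l\<in>N - {i}. P l \<in> D \<and> peak (P l) \<in> F) \<longrightarrow> f (P(i := P j)) = peak (P k)"
      if ij: "i \<in> N" "j \<in> N" "i \<noteq> j" for i j
    proof -
      have c: "card (N - {i}) < card N" "2 \<le> card (N - {i})" using ij card less.prems(1) by auto
      from less.hyps[OF c(1) _ c(2) ruleN_merge[OF f ij]] less.prems(1) show ?thesis by simp
    qed
    show ?thesis
    proof (rule ccontr)
      assume n: "\<not> ?thesis"
      have merge': "\<exists>k\<in>N - {i, j}. \<forall>P. (\<forall>l\<in>N - {i}. P l \<in> D \<and> peak (P l) \<in> F) \<longrightarrow> f (P(i := P j)) = peak (P k)"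
        if ij: "i \<in> N" "j \<in> N" "i \<noteq> j" for i j
      proof -
        obtain k where k: "k \<in> N - {i}"
          "\<forall>P. (\<forall>l\<in>N - {i}. P l \<in> D \<and> peak (P l) \<in> F) \<longrightarrow> f (P(i := P j)) = peak (P k)"
          using merge[OF ij] by blast
        have "k \<noteq> j"
          using n ruleN_dictator_of_merged[OF two rich ab less.prems(1) f ij] k(2) by blast
        then show ?thesis using k by blast
      qed
      obtain i j where ij: "i \<in> N" "j \<in> N" "i \<noteq> j"
        using card by (metis card_le_Suc0_iff_eq less.prems(1) numeral_2_eq_2 not_less_eq_eq less_imp_le_nat)
      obtain k where k: "k \<in> N - {i, j}"
        "\<And>P. \<forall>l\<in>N - {i}. P l \<in> D \<and> peak (P l) \<in> F \<Longrightarrow> f (P(i := P j)) = peak (P k)"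
        using merge'[OF ij] by blast
      obtain l where l: "l \<in> N - {i, k}"
        "\<And>P. \<forall>m\<in>N - {i}. P m \<in> D \<and> peak (P m) \<in> F \<Longrightarrow> f (P(i := P k)) = peak (P l)"
        using merge'[of i k] ij k by blast
      have "l = j"
      proof (rule ccontr)
        assume lj: "l \<noteq> j"
        \<comment> \<open>If \<open>j\<close> and \<open>k\<close> agree, copying either of them
          gives the same profile, so the dictators \<open>k\<close> and \<open>l\<close> may not
          differ.\<close>
        define P where "P = (\<lambda>_. A)(l := B)"
        have P: "\<forall>m\<in>N - {i}. P m \<in> D \<and> peak (P m) \<in> F" using A B ab unfolding P_def by auto
        have "P j = A" "P k = A" "P l = B" "P(i := P j) = P(i := P k)"
          using lj l unfolding P_def by auto
        then show False using k(2)[OF P] l(2)[OF P] A B ab by simp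
      qed
      define P where "P = (\<lambda>_. A)(k := B)"
      have P: "\<forall>m\<in>N - {i}. P m \<in> D \<and> peak (P m) \<in> F" using A B ab unfolding P_def by auto
      have P1: "P j = A" "P k = B" using k unfolding P_def by auto
      have "f (P(i := A)) = b" using k(2)[OF P] P1 B by simp
      moreover have "f (P(i := B)) = a" using l(2)[OF P] P1 A \<open>l = j\<close> by simp
      moreover have "\<forall>m\<in>N. (P(i := B)) m \<in> D" using A B unfolding P_def by simp
      ultimately have "(a, b) \<in> B" using ruleN_sp[OF f, of "P(i := B)" i A] ij A by simp
      then show False using pref_peakD[OF B(1)] B ab by blast
    qed
  qed
qed

end

section \<open>Domains without unique seconds\<close>

context preferences
begin

lemma rule2_sp:
  assumes "rule2 tops F h" "P \<in> D" "P' \<in> D" "Q \<in> D"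
  shows "(h P Q, h P' Q) \<in> P" "(h Q P, h Q P') \<in> P"
  using assms unfolding rule2_def by blast+

lemma rule2_unanimous:
  "rule2 tops F h \<Longrightarrow> P \<in> D \<Longrightarrow> Q \<in> D \<Longrightarrow> peak P = peak Q \<Longrightarrow> peak P \<in> F \<Longrightarrow> h P Q = peak P"
  unfolding rule2_def by blast

lemma rule2_flip:
  assumes "rule2 tops F h"
  shows "rule2 tops F (\<lambda>P Q. h Q P)"
proof -
  have "h Q P = peak P" if "P \<in> D" "Q \<in> D" "peak P = peak Q" "peak P \<in> F" for P Q
    using rule2_unanimous[OF assms, of Q P] that by simp
  then show ?thesis using assms unfolding rule2_def by blast
qed

lemma connected_induct:
  assumes "path_connected_domain D" "p x" "\<And>y z. (y, z) \<in> adjacency D \<Longrightarrow> p y \<Longrightarrow> p z"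
  shows "p w"
proof -
  have "(x, w) \<in> (adjacency D)\<^sup>*"
    using assms(1) unfolding path_connected_domain_def connected_in_def by simp
  then show ?thesis by (induction rule: rtrancl_induct) (use assms in blast)+
qed

lemma neighbor_exists:
  assumes "path_connected_domain D"
  shows "\<exists>y. (x, y) \<in> adjacency D"
proof -
  have "\<exists>y. y \<noteq> x"
  proof (rule ccontr)
    assume "\<nexists>y. y \<noteq> x"
    then have "UNIV = {x}" by auto
    then have "CARD('a) = 1" by (metis card.empty card.insert empty_iff finite.emptyI One_nat_def)
    then show False using card_ge_3 by simp
  qed
  then obtain y where y: "y \<noteq> x" by blast
  have "(x, y) \<in> (adjacency D)\<^sup>*"
    using assms unfolding path_connected_domain_def connected_in_def by simp
  then show ?thesis using y by (metis converse_rtranclE)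
qed

lemma all_peaks: "path_connected_domain D \<Longrightarrow> \<exists>P\<in>D. peak P = x"
  using neighbor_exists[of x] by (meson adjacencyE)

text \<open>Own peak first: \<open>wins (flip h) y x\<close> says that the second voter with peak
  \<open>y\<close> prevails over the first with peak \<open>x\<close>.\<close>

definition wins :: "('a pref \<Rightarrow> 'a pref \<Rightarrow> 'a) \<Rightarrow> 'a \<Rightarrow> 'a \<Rightarrow> bool" where
  "wins h x y \<longleftrightarrow> (\<forall>P\<in>D. \<forall>Q\<in>D. peak P = x \<longrightarrow> peak Q = y \<longrightarrow> h P Q = x)"

abbreviation "flip h \<equiv> \<lambda>P Q. h Q P"

context
  assumes conn: "path_connected_domain D"
begin

lemma wins_clash: "wins h x y \<Longrightarrow> wins (flip h) y x \<Longrightarrow> x = y"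
  using all_peaks[OF conn, of x] all_peaks[OF conn, of y] unfolding wins_def by metis

text \<open>Without tops-onlyness one outcome still decides all profiles with these peaks:
  \<open>P\<close> leaves only its two top alternatives, and if \<open>Q'\<close> led to
  \<open>y\<close>, the second voter with \<open>Q\<close> would report it.\<close>

lemma wins_from_outcome:
  assumes h: "rule2 tops UNIV h" and P: "P \<in> D" "ranked 2 P = y" and Q: "Q \<in> D" "peak Q = y"
    and out: "h P Q = peak P"
  shows "wins h (peak P) y"
  unfolding wins_def
proof (intro ballI impI)
  fix P' Q' assume P': "P' \<in> D" "peak P' = peak P" and Q': "Q' \<in> D" "peak Q' = y"
  have "h Q' Q' = y" using rule2_unanimous[OF h Q'(1) Q'(1)] Q' by simp
  then have "(h P Q', y) \<in> P" using rule2_sp(1)[OF h P(1) Q'(1) Q'(1)] by simp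
  then have "h P Q' = y \<or> h P Q' = peak P" using pref_secondD P by blast
  moreover have "h P Q' \<noteq> y"
  proof
    assume "h P Q' = y"
    then have "(peak P, y) \<in> Q" using rule2_sp(2)[OF h Q(1) Q'(1) P(1)] out by simp
    then show False using pref_peakD[OF Q(1)] Q(2) second_top(1)[OF P(1)] P(2) by metis
  qed
  ultimately have "h P Q' = peak P" by blast
  then show "h P' Q' = peak P"
    using rule2_sp(1)[OF h P'(1) P(1) Q'(1)] pref_peakD[OF P'(1)] P'(2) by simp
qed

lemma wins_dichotomy:
  assumes h: "rule2 tops UNIV h" and "y \<in> seconds D x" "x \<in> seconds D y"
  shows "wins h x y \<or> wins (flip h) y x"
proof -
  obtain P where P: "P \<in> D" "peak P = x" "ranked 2 P = y" using assms(2) by (rule secondsE)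
  obtain Q where Q: "Q \<in> D" "peak Q = y" "ranked 2 Q = x" using assms(3) by (rule secondsE)
  have "h Q Q = y" using rule2_unanimous[OF h Q(1) Q(1)] Q by simp
  then have "(h P Q, y) \<in> P" using rule2_sp(1)[OF h P(1) Q(1) Q(1)] by simp
  then have "h P Q = y \<or> h P Q = x" using pref_secondD P by blast
  then show ?thesis
    using wins_from_outcome[OF h P(1,3) Q(1,2)] wins_from_outcome[OF rule2_flip[OF h] Q(1,3) P(1,2)] P(2) Q(2)
    by auto
qed

lemma wins_refl: "rule2 tops UNIV h \<Longrightarrow> wins h x x"
  unfolding wins_def using rule2_unanimous by (metis UNIV_I)

text \<open>Reporting peak \<open>x'\<close> secures \<open>x'\<close>, so a preference with second
  \<open>x'\<close> obtains \<open>x\<close> or \<open>x'\<close>. If it were \<open>x'\<close>, the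
  second voter with peak \<open>x'\<close> would report \<open>Q\<close>, since her own peak makes
  her lose to \<open>x\<close>.\<close>

lemma wins_step:
  assumes h: "rule2 tops UNIV h" and "x' \<in> seconds D x" "wins h x x'" "wins h x' y"
  shows "wins h x y"
  unfolding wins_def
proof (intro ballI impI)
  fix P' Q assume P': "P' \<in> D" "peak P' = x" and Q: "Q \<in> D" "peak Q = y"
  obtain P where P: "P \<in> D" "peak P = x" "ranked 2 P = x'" using assms(2) by (rule secondsE)
  obtain R where R: "R \<in> D" "peak R = x'" using all_peaks[OF conn] by blast
  have "h R Q = x'" using assms(4) R Q unfolding wins_def by blast
  then have "(h P Q, x') \<in> P" using rule2_sp(1)[OF h P(1) R(1) Q(1)] by simp
  then have "h P Q = x' \<or> h P Q = x" using pref_secondD P by blast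
  moreover have "h P Q \<noteq> x'"
  proof
    assume a: "h P Q = x'"
    have "h P R = x" using assms(3) P R unfolding wins_def by blast
    then have "(x, x') \<in> R" using rule2_sp(2)[OF h R(1) Q(1) P(1)] a by simp
    then show False using pref_peakD[OF R(1)] R(2) second_top(1)[OF P(1)] P(2,3) by metis
  qed
  ultimately have "h P Q = x" by blast
  then show "h P' Q = x"
    using rule2_sp(1)[OF h P'(1) P(1) Q(1)] pref_peakD[OF P'(1)] P'(2) by simp
qed

text \<open>Winning propagates along walks that do not backtrack, provided that one of two consecutive
  steps is an adjacency.\<close>

lemma wins_forward:
  assumes h: "rule2 tops UNIV h" and yx: "(y, x) \<in> adjacency D"
    and xz: "z \<in> seconds D x" "x \<in> seconds D z" "z \<noteq> y" and w: "wins h y x"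
  shows "wins h x z"
proof (rule ccontr)
  assume "\<not> wins h x z"
  then have f: "wins (flip h) z x" using wins_dichotomy[OF h xz(1,2)] by blast
  obtain P P' where P: "P \<in> D" "P' \<in> D" "peak P = y" "peak P' = x"
    and swap: "\<And>s t. s = t \<or> (s, t) \<in> P \<Longrightarrow> s = t \<or> (t, s) \<in> P' \<Longrightarrow> s = t \<or> s = y \<and> t = x"
    using yx by (rule adjacencyE) blast
  obtain Q where Q: "Q \<in> D" "peak Q = z" using all_peaks[OF conn] by blast
  obtain Q' where Q': "Q' \<in> D" "peak Q' = x" "ranked 2 Q' = z" using xz(1) by (rule secondsE)
  have zx: "z \<noteq> x" using second_top(1)[OF Q'(1)] Q' by simp
  have 1: "h P' Q = z" using f P Q unfolding wins_def by blast
  \<comment> \<open>Passing from \<open>P\<close> to \<open>P'\<close> can change the outcome only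
    into \<open>x\<close>, but \<open>h P' Q\<close> is \<open>z\<close>.\<close>
  have "h P Q = h P' Q \<or> h P Q = y \<and> h P' Q = x"
    using swap rule2_sp(1)[OF h P(1) P(2) Q(1)] rule2_sp(1)[OF h P(2) P(1) Q(1)] by blast
  then have 2: "h P Q = z" using 1 zx by auto
  have "h P Q' = y" using w P Q' unfolding wins_def by blast
  then have "(y, z) \<in> Q'" using rule2_sp(2)[OF h Q'(1) Q(1) P(1)] 2 by simp
  then show False using pref_secondD[OF Q'(1)] Q' xz(3) adjacency_irrefl[OF yx] by auto
qed

text \<open>If the other voter won the second step, \<open>wins_forward\<close> would carry her win
  back along the reversed walk.\<close>

lemma wins_forward':
  assumes h: "rule2 tops UNIV h" and xz: "z \<in> seconds D x" "x \<in> seconds D z"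
    and zw: "(z, w) \<in> adjacency D" "w \<noteq> x" and w: "wins h x z"
  shows "wins h z w"
proof (rule ccontr)
  assume "\<not> wins h z w"
  then have "wins (flip h) w z" using wins_dichotomy[OF h adjacency_seconds[OF zw(1)]] by blast
  then have "wins (flip h) z x"
    using wins_forward[OF rule2_flip[OF h] adjacency_sym[OF zw(1)] xz(2,1)] zw(2) by blast
  then have "x = z" using wins_clash w by blast
  then show False using xz(1) by (metis second_top(1) secondsE)
qed

text \<open>\<open>modes\<close> gives each edge one winner in both directions.
  \<open>wins_forward\<close> makes edges with a common end share it, and \<open>wins_step\<close>
  passes from edges to all pairs.\<close>

lemma wins_everywhere:
  assumes h: "rule2 tops UNIV h"
    and modes: "\<And>x y. (x, y) \<in> adjacency D \<Longrightarrow>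
      wins h x y \<and> wins h y x \<or> wins (flip h) x y \<and> wins (flip h) y x"
    and pq: "(p, q) \<in> adjacency D" "wins h p q" "wins h q p"
  shows "wins h x y"
proof -
  define X where "X x \<longleftrightarrow> (\<forall>y. (x, y) \<in> adjacency D \<longrightarrow> wins h x y \<and> wins h y x)" for x
  have start: "X p" if pq: "(p, q) \<in> adjacency D" "wins h p q" "wins h q p" for p q
    unfolding X_def
  proof (intro allI impI)
    fix c assume c: "(p, c) \<in> adjacency D"
    have "wins h p c"
    proof (cases "c = q")
      case False
      then show ?thesis
        using wins_forward[OF h adjacency_sym[OF pq(1)] adjacency_seconds[OF c]] pq by blast
    qed (use pq in simp)
    then show "wins h p c \<and> wins h c p" using modes[OF c] wins_clash adjacency_irrefl[OF c] by blast
  qed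
  have "X x" for x
    using start[OF pq]
  proof (rule connected_induct[OF conn])
    fix y z assume yz: "(y, z) \<in> adjacency D" "X y"
    then show "X z" using start[OF adjacency_sym[OF yz(1)]] unfolding X_def by blast
  qed
  then have edge: "wins h x y" if "(x, y) \<in> adjacency D" for x y using that unfolding X_def by blast
  have "(x, y) \<in> (adjacency D)\<^sup>*"
    using conn unfolding path_connected_domain_def connected_in_def by simp
  then show ?thesis
  proof (induction rule: converse_rtrancl_induct)
    case base
    show ?case by (rule wins_refl[OF h])
  next
    case (step x x')
    then show ?case using wins_step[OF h adjacency_seconds(1)[OF step.hyps(1)] edge] by blast
  qed
qed

end

text \<open>An arrow leads from \<open>x\<close> to \<open>y\<close> if \<open>y\<close> is chosen whenever one voter's peak is \<open>x\<close> and the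
  other's is \<open>y\<close>. Arrows cannot form a cycle, but without unique seconds every arrow has a
  predecessor.\<close>

lemma dictatorial2_if_not_unique_seconds:
  assumes conn: "path_connected_domain D" and leaf: "leaf_symmetric D" and nus: "\<not> unique_seconds D"
    and h: "rule2 tops UNIV h"
  shows "dictatorial2 UNIV h"
proof -
  note h' = rule2_flip[OF h]
  \<comment> \<open>Mutual seconds rather than adjacency, since the predecessors supplied by leaf
    symmetry are not adjacent.\<close>
  define Ar where "Ar = {(x, y). y \<in> seconds D x \<and> x \<in> seconds D y \<and> wins h y x \<and> wins (flip h) y x}"
  have star: "wins h y x \<and> wins (flip h) y x" if "(x, y) \<in> Ar\<^sup>*" for x y
    using that
  proof (induction rule: rtrancl_induct)
    case base
    show ?case using wins_refl[OF conn h] wins_refl[OF conn h'] by simp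
  next
    case (step y z)
    then show ?case
      using wins_step[OF conn h, of y z x] wins_step[OF conn h', of y z x] unfolding Ar_def by blast
  qed
  have "acyclic Ar"
  proof (rule acyclicI, intro allI notI)
    fix x assume "(x, x) \<in> Ar\<^sup>+"
    then obtain y where y: "(x, y) \<in> Ar" "(y, x) \<in> Ar\<^sup>*" by (meson tranclD)
    have "wins (flip h) y x" using y(1) unfolding Ar_def by blast
    then have "x = y" using wins_clash[OF conn] star[OF y(2)] by blast
    then have "x \<in> seconds D x" using y(1) unfolding Ar_def by blast
    then show False by (metis second_top(1) secondsE)
  qed
  then have wf: "wf Ar" by (intro finite_acyclic_wf) auto
  have pred: "\<exists>z. (z, x) \<in> Ar" if xy: "(x, y) \<in> Ar" for x y
  proof -
    have W: "y \<in> seconds D x" "x \<in> seconds D y" "wins h y x" "wins (flip h) y x"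
      using xy unfolding Ar_def by auto
    show ?thesis
    proof (cases "\<exists>z. (x, z) \<in> adjacency D \<and> z \<noteq> y")
      case True
      then obtain z where z: "(x, z) \<in> adjacency D" "z \<noteq> y" by blast
      have "wins h x z" "wins (flip h) x z"
        using wins_forward'[OF conn h W(2,1) z W(3)] wins_forward'[OF conn h' W(2,1) z W(4)] by blast+
      then show ?thesis using adjacency_seconds[OF z(1)] unfolding Ar_def by blast
    next
      case False
      \<comment> \<open>Here \<open>x\<close> is a leaf. Having no unique second, it falls under
        leaf symmetry, which yields a mutual second other than \<open>y\<close>.\<close>
      then have nb: "neighbors_in (adjacency D) UNIV x = {y}"
        using neighbor_exists[OF conn, of x] unfolding neighbors_in_def by auto
      then have "x \<in> leaves_in (adjacency D) UNIV" unfolding leaves_in_def by simp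
      moreover have "card (seconds D x) > 1"
      proof -
        have "card (seconds D x) \<noteq> 0" using W(1) by auto
        moreover have "card (seconds D x) \<noteq> 1" using nus unfolding unique_seconds_def by blast
        ultimately show ?thesis by linarith
      qed
      ultimately obtain z where z: "z \<in> seconds D x" "z \<noteq> y" "x \<in> seconds D z"
        using leaf nb unfolding leaf_symmetric_def by blast
      have yx: "(y, x) \<in> adjacency D" using nb adjacency_sym unfolding neighbors_in_def by blast
      have "wins h x z" "wins (flip h) x z"
        using wins_forward[OF conn h yx z(1,3,2) W(3)] wins_forward[OF conn h' yx z(1,3,2) W(4)] by blast+
      then show ?thesis using z unfolding Ar_def by blast
    qed
  qed
  have empty: "Ar = {}"
  proof (rule ccontr)
    assume "Ar \<noteq> {}"
    then obtain x0 where "x0 \<in> Domain Ar" by fast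
    with wf obtain x where "x \<in> Domain Ar" "\<And>z. (z, x) \<in> Ar \<Longrightarrow> z \<notin> Domain Ar"
      by (rule wfE_min) blast
    then show False using pred by blast
  qed
  have modes: "wins h x y \<and> wins h y x \<or> wins (flip h) x y \<and> wins (flip h) y x"
    if xy: "(x, y) \<in> adjacency D" for x y
    using wins_dichotomy[OF conn h adjacency_seconds[OF xy]] wins_dichotomy[OF conn h adjacency_seconds(2,1)[OF xy]]
      empty adjacency_seconds[OF xy] unfolding Ar_def by blast
  obtain p q where pq: "(p, q) \<in> adjacency D" using neighbor_exists[OF conn] by blast
  show ?thesis
  proof (cases "wins h p q \<and> wins h q p")
    case True
    then have "wins h x y" for x y using wins_everywhere[OF conn h modes pq] by blast
    then show ?thesis unfolding dictatorial2_def wins_def by blast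
  next
    case False
    then have "wins (flip h) p q" "wins (flip h) q p" using modes[OF pq] by blast+
    then have "wins (flip h) x y" for x y using wins_everywhere[OF conn h' _ pq] modes by blast
    then show ?thesis unfolding dictatorial2_def wins_def by blast
  qed
qed

end

section \<open>Dictatorship on the free zone\<close>

context preferences
begin

text \<open>A tops-only two-voter rule as a function of the peaks. Every alternative is a peak, so
  \<open>x\<close> and \<open>y\<close> range over all of them.\<close>

definition peak_rule :: "'a set \<Rightarrow> ('a \<Rightarrow> 'a \<Rightarrow> 'a) \<Rightarrow> bool" where
  "peak_rule F h \<longleftrightarrow>
     (\<forall>P\<in>D. \<forall>x y. (h (peak P) y, h x y) \<in> P \<and> (h y (peak P), h y x) \<in> P) \<and> (\<forall>x\<in>F. h x x = x)"

lemma peak_rule_flip: "peak_rule F h \<Longrightarrow> peak_rule F (\<lambda>x y. h y x)"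
  unfolding peak_rule_def by blast

lemma peak_rule_sp: "peak_rule F h \<Longrightarrow> P \<in> D \<Longrightarrow> peak P = p \<Longrightarrow> (h p y, h x y) \<in> P"
    "peak_rule F h \<Longrightarrow> P \<in> D \<Longrightarrow> peak P = p \<Longrightarrow> (h y p, h y x) \<in> P"
  unfolding peak_rule_def by blast+

lemma peak_rule_refl: "peak_rule F h \<Longrightarrow> x \<in> F \<Longrightarrow> h x x = x"
  unfolding peak_rule_def by blast

text \<open>Tops-onlyness lets the two witnesses of the adjacency stand for the peaks, and they
  disagree only on \<open>x\<close> and \<open>x'\<close>.\<close>

lemma peak_rule_swap:
  assumes h: "peak_rule F h" and xx': "(x, x') \<in> adjacency D"
  shows "h x y = h x' y \<or> h x y = x \<and> h x' y = x'" "h y x = h y x' \<or> h y x = x \<and> h y x' = x'"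
proof -
  obtain P Q where PQ: "P \<in> D" "Q \<in> D" "peak P = x" "peak Q = x'"
    and swap: "\<And>s t. s = t \<or> (s, t) \<in> P \<Longrightarrow> s = t \<or> (t, s) \<in> Q \<Longrightarrow> s = t \<or> s = x \<and> t = x'"
    using xx' by (rule adjacencyE) blast
  show "h x y = h x' y \<or> h x y = x \<and> h x' y = x'"
    by (rule swap) (use peak_rule_sp(1)[OF h] PQ in blast)+
  show "h y x = h y x' \<or> h y x = x \<and> h y x' = x'"
    by (rule swap) (use peak_rule_sp(2)[OF h] PQ in blast)+
qed

lemma connected_free_zone:
  assumes conn: "path_connected_domain D" and hang: "hanging D F R" and uv: "u \<in> F" "v \<in> F"
  shows "(u, v) \<in> (Restr (adjacency D) F)\<^sup>*"
proof -
  have "(u, v) \<in> (adjacency D)\<^sup>*"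
    using conn unfolding path_connected_domain_def connected_in_def by simp
  then have "\<exists>c\<in>F. (v, c) \<in> R\<^sup>* \<and> (u, c) \<in> (Restr (adjacency D) F)\<^sup>*"
  proof (induction rule: rtrancl_induct)
    case base
    then show ?case using uv by blast
  next
    case (step x x')
    then obtain c where c: "c \<in> F" "(x, c) \<in> R\<^sup>*" "(u, c) \<in> (Restr (adjacency D) F)\<^sup>*" by blast
    from adjacent_hanging[OF hang step.hyps(2)] show ?case
    proof (elim disjE conjE)
      assume F: "x \<in> F" "x' \<in> F"
      then have "c = x" using hanging_not_Domain[OF hang] c(2) by blast
      then have "(u, x') \<in> (Restr (adjacency D) F)\<^sup>*"
        using c(3) F step.hyps(2) by (auto intro: rtrancl_into_rtrancl)
      then show ?case using F by blast
    next
      assume xx': "(x, x') \<in> R"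
      then have "x \<noteq> c" using c(1) hanging_Domain[OF hang] by blast
      then have "(x', c) \<in> R\<^sup>*"
        using c(2) xx' hanging_single[OF hang] by (metis converse_rtranclE single_valuedD)
      then show ?case using c by blast
    next
      assume "(x', x) \<in> R"
      then show ?case using c by (meson converse_rtrancl_into_rtrancl)
    qed
  qed
  then show ?thesis using hanging_not_Domain[OF hang uv(2)] by blast
qed

context
  fixes F R
  assumes conn: "path_connected_domain D" and hang: "hanging D F R"
begin

section \<open>Arrows in the free zone\<close>

abbreviation "E \<equiv> Restr (adjacency D) F"

lemma E_sym: "(x, y) \<in> E \<Longrightarrow> (y, x) \<in> E" using adjacency_sym by blast

lemma E_D: "(x, y) \<in> E \<Longrightarrow> (x, y) \<in> adjacency D \<and> x \<in> F \<and> y \<in> F \<and> x \<noteq> y"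
  using adjacency_irrefl by blast

lemma edge_values: "peak_rule F h \<Longrightarrow> (x, y) \<in> E \<Longrightarrow> h x y = x \<or> h x y = y"
  using peak_rule_swap(1)[of F h x y y] peak_rule_refl[of F h y] by auto

lemma first_step:
  assumes h: "peak_rule F h" and "(x, x') \<in> E" "h x x' = x" "h x' y = x'"
  shows "h x y = x"
proof (rule ccontr)
  assume "h x y \<noteq> x"
  then have "h x y = x'" using peak_rule_swap(1)[OF h, of x x' y] assms by auto
  moreover obtain P where P: "P \<in> D" "peak P = x'" using all_peaks[OF conn] by blast
  ultimately have "(x, x') \<in> P" using peak_rule_sp(2)[OF h P, of x y] assms(3) by simp
  then show False using pref_peakD[OF P(1)] P(2) E_D[OF assms(2)] by blast
qed

text \<open>Otherwise \<open>h b a = b\<close> and \<open>h a c = c\<close> would force the distinct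
  values \<open>b\<close> and \<open>c\<close> on \<open>h b c\<close>, one move of a peak away from
  both.\<close>

lemma edge_forward:
  assumes h: "peak_rule F h" and ba: "(b, a) \<in> E" and ac: "(a, c) \<in> E" and "b \<noteq> c" "h b a = b"
  shows "h a c = a"
proof (rule ccontr)
  note e = E_D[OF ba] E_D[OF ac]
  assume "h a c \<noteq> a"
  then have 1: "h a c = c" using edge_values[OF h ac] by blast
  have "h b c = c" using peak_rule_swap(1)[OF h, of b a c] 1 e by auto
  then show False using peak_rule_swap(2)[OF h, of a c b] e assms(4,5) by auto
qed

definition arrows :: "('a \<Rightarrow> 'a \<Rightarrow> 'a) \<Rightarrow> 'a rel" where
  "arrows h = {(x, y) \<in> E. h x y = y \<and> h y x = y}"

lemma arrows_E: "(x, y) \<in> arrows h \<Longrightarrow> (x, y) \<in> E"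
  unfolding arrows_def by blast

lemma arrows_star:
  assumes h: "peak_rule F h" and "x \<in> F" and "(x, y) \<in> (arrows h)\<^sup>*"
  shows "h x y = y" "h y x = y" "y \<in> F"
proof -
  from assms(3) have "h x y = y \<and> h y x = y \<and> y \<in> F"
  proof (induction rule: rtrancl_induct)
    case base
    show ?case using peak_rule_refl[OF h] assms(2) by blast
  next
    case (step y z)
    then have zy: "(z, y) \<in> E" "h y z = z" "h z y = z" using E_sym unfolding arrows_def by blast+
    then show ?case
      using first_step[OF h zy(1,3), of x] first_step[OF peak_rule_flip[OF h] zy(1,2), of x] step.IH by blast
  qed
  then show "h x y = y" "h y x = y" "y \<in> F" by blast+
qed

lemma arrows_acyclic:
  assumes h: "peak_rule F h"
  shows "acyclic (arrows h)"
proof (rule acyclicI, intro allI notI)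
  fix x assume "(x, x) \<in> (arrows h)\<^sup>+"
  then obtain y where y: "(x, y) \<in> arrows h" "(y, x) \<in> (arrows h)\<^sup>*" by (meson tranclD)
  then have "h x y = x" using arrows_star(2)[OF h _ y(2)] E_D[OF arrows_E[OF y(1)]] by blast
  then show False using y(1) E_D[OF arrows_E[OF y(1)]] unfolding arrows_def by auto
qed

text \<open>A voter who wins with peak \<open>y\<close> against \<open>z\<close> wins with peak
  \<open>z\<close> against \<open>x\<close>, contrary to a second arrow. With acyclicity this makes
  the arrows a child-parent relation.\<close>

lemma arrows_single:
  assumes h: "peak_rule F h" and zy: "(z, y) \<in> arrows h" and zx: "(z, x) \<in> arrows h"
  shows "x = y"
proof (rule ccontr)
  assume n: "x \<noteq> y"
  have "h y z = y" "h z x = x" using zy zx unfolding arrows_def by blast+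
  then show False
    using edge_forward[OF h E_sym[OF arrows_E[OF zy]] arrows_E[OF zx]] n E_D[OF arrows_E[OF zx]] by auto
qed

text \<open>Both voters win with peak \<open>m\<close> against \<open>z\<close>, and both wins
  propagate to the other neighbours of \<open>z\<close>.\<close>

lemma arrows_back:
  assumes h: "peak_rule F h" and zm: "(z, m) \<in> arrows h" and zy: "(z, y) \<in> E" "y \<noteq> m"
  shows "(y, z) \<in> arrows h"
proof -
  have "h m z = m" "h z m = m" using zm unfolding arrows_def by blast+
  then have "h z y = z" "h y z = z"
    using edge_forward[OF h E_sym[OF arrows_E[OF zm]] zy(1)]
      edge_forward[OF peak_rule_flip[OF h] E_sym[OF arrows_E[OF zm]] zy(1)] zy(2) by simp_all
  then show ?thesis using E_sym[OF zy(1)] unfolding arrows_def by blast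
qed

text \<open>Preferences with peak in a tree hanging at \<open>c\<close> behave towards \<open>F\<close> as if their peak were \<open>c\<close>.\<close>

lemma outcome_preferred:
  assumes h: "peak_rule F h" and P: "P \<in> D" and c: "c \<in> F" "(peak P, c) \<in> R\<^sup>*"
    and "h c y \<in> F" "h t y \<in> F"
  shows "(h c y, h t y) \<in> P"
proof (cases "h c y = c")
  case True
  show ?thesis
  proof (cases "peak P = c")
    case True
    then show ?thesis using peak_top[OF P] \<open>h c y = c\<close> by metis
  next
    case False
    then obtain z where z: "(peak P, z) \<in> R\<^sup>*" "(z, c) \<in> R" using c(2) by (metis rtranclE)
    have "z \<notin> F" using z(2) hanging_Domain[OF hang] by blast
    then have "(h t y, z) \<notin> R\<^sup>*" using hanging_not_Domain[OF hang assms(6)] assms(6) by blast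
    then show ?thesis using hanging_in[OF hang z(2) P z(1)] True by simp
  qed
next
  case False
  \<comment> \<open>Moving the peak down the tree changes the outcome only if this is the peak being
    left, but \<open>h c y\<close> lies in \<open>F\<close> and is not \<open>c\<close>.\<close>
  have "h x y = h c y" if "(x, c) \<in> R\<^sup>*" for x
    using that
  proof (induction rule: converse_rtrancl_induct)
    case (step x x')
    have "(x, x') \<in> adjacency D" using hanging_subset_adjacency[OF hang conn] step.hyps by blast
    moreover have "h c y \<noteq> x'"
    proof
      assume "h c y = x'"
      then have "c = x'" using hanging_not_Domain[OF hang, of x' c] assms(5) step.hyps(2) by blast
      then show False using False \<open>h c y = x'\<close> by simp
    qed
    ultimately show ?case using peak_rule_swap(1)[OF h, of x x' y] step.IH by auto
  qed simp
  from this[OF c(2)] show ?thesis using peak_rule_sp(1)[OF h P refl, of y t] by simp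
qed

text \<open>The decisive step: everything behind an arrow \<open>u \<rightarrow> w\<close> can be cut off from the free zone and
  hung at \<open>w\<close>, with the arrows as child--parent relation.\<close>

context
  fixes h u w
  assumes h: "peak_rule F h" and uw: "(u, w) \<in> arrows h" and w: "\<And>y. (w, y) \<in> E \<Longrightarrow> h w y = w"
begin

definition "behind = {z. (z, u) \<in> (arrows h)\<^sup>*}"

lemma uwF: "u \<in> F" "w \<in> F" using E_D[OF arrows_E[OF uw]] by blast+

lemma behind_w: "z \<in> behind \<Longrightarrow> (z, w) \<in> (arrows h)\<^sup>+"
  using uw unfolding behind_def by (simp add: rtrancl_into_trancl1)

lemma w_not_behind: "w \<notin> behind"
  using behind_w arrows_acyclic[OF h] unfolding acyclic_def by blast

lemma behind_F: "z \<in> behind \<Longrightarrow> z \<in> F"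
  using uwF(1) unfolding behind_def by (auto elim: converse_rtranclE dest: arrows_E)

lemma behind_out:
  assumes "z \<in> behind"
  shows "\<exists>m. (z, m) \<in> arrows h \<and> (m \<in> behind \<or> z = u \<and> m = w)"
  using assms uw unfolding behind_def by (metis converse_rtranclE mem_Collect_eq)

lemma behind_step: "z \<in> behind \<Longrightarrow> (z, m) \<in> arrows h \<Longrightarrow> m \<in> behind \<or> z = u \<and> m = w"
  using behind_out arrows_single[OF h] by blast

text \<open>By \<open>arrows_back\<close> all neighbours of \<open>z\<close> but the head of its
  arrow are themselves behind, so \<open>(u, w)\<close> is the only exit.\<close>

lemma behind_cut:
  assumes z: "z \<in> behind" and zy: "(z, y) \<in> E"
  shows "y \<in> behind \<or> z = u \<and> y = w"
proof -
  obtain m where m: "(z, m) \<in> arrows h" "m \<in> behind \<or> z = u \<and> m = w" using behind_out[OF z] by blast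
  show ?thesis
  proof (cases "y = m")
    case False
    then have "(y, z) \<in> arrows h" using arrows_back[OF h m(1) zy] by blast
    moreover have "(z, u) \<in> (arrows h)\<^sup>*" using z unfolding behind_def by simp
    ultimately have "(y, u) \<in> (arrows h)\<^sup>*" by (rule converse_rtrancl_into_rtrancl)
    then show ?thesis unfolding behind_def by simp
  qed (use m in simp)
qed

text \<open>Starting from \<open>(z, w)\<close>, the second peak moves along a walk to
  \<open>x\<close>. The outcome \<open>w\<close> can change only in a step that leaves
  \<open>w\<close>, which \<open>nbr\<close> covers; a detour through \<open>behind\<close> comes
  back through \<open>w\<close>.\<close>

lemma behind_outside:
  assumes z: "z \<in> behind" and x: "x \<in> F" "x \<notin> behind"
  shows "h z x = w"
proof -
  have zw: "h z w = w"
    using arrows_star(1)[OF h behind_F[OF z]] behind_w[OF z] by (simp add: trancl_into_rtrancl)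
  \<comment> \<open>From \<open>h w y = w\<close> the outcome at \<open>(u, y)\<close> is
    \<open>w\<close> or \<open>u\<close>, from \<open>h u w = w\<close> it is \<open>w\<close> or
    \<open>y\<close>.\<close>
  have nbr: "h z y = w" if y: "(w, y) \<in> E" "y \<notin> behind" for y
  proof -
    have yu: "y \<noteq> u" using y(2) unfolding behind_def by blast
    have uw': "(u, w) \<in> adjacency D" "h u w = w" using uw unfolding arrows_def by blast+
    have "h u y = w \<or> h u y = u" using peak_rule_swap(1)[OF h uw'(1), of y] w[OF y(1)] by auto
    moreover have "h u y = w \<or> h u y = y" using peak_rule_swap(2)[OF h, of w y u] y(1) uw'(2) by auto
    ultimately have "h u y = w" using yu by auto
    have "(z, u) \<in> (arrows h)\<^sup>*" using z unfolding behind_def by blast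
    then show ?thesis
    proof (induction rule: converse_rtrancl_induct)
      case base
      show ?case by fact
    next
      case (step z z')
      then have "z' \<in> behind" unfolding behind_def by blast
      then have "z' \<noteq> w" using w_not_behind by blast
      then show ?case
        using peak_rule_swap(1)[OF h, of z z' y] step E_D[OF arrows_E[OF step.hyps(1)]] by auto
    qed
  qed
  have "x \<in> behind \<or> h z x = w"
    using connected_free_zone[OF conn hang uwF(2) x(1)]
  proof (induction rule: rtrancl_induct)
    case base
    show ?case using zw by simp
  next
    case (step x x')
    show ?case
    proof (cases "x' \<in> behind \<or> x' = w")
      case True
      then show ?thesis using zw by blast
    next
      case False
      then have "x \<notin> behind" using behind_cut step.hyps(2) by blast
      then have "h z x = w" using step.IH by blast
      then show ?thesis
        using peak_rule_swap(2)[OF h, of x x' z] nbr[of x'] step.hyps(2) False by auto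
    qed
  qed
  with x(2) show ?thesis by blast
qed

text \<open>The squeeze of \<open>behind_outside\<close> at two arrows into \<open>m\<close> yields
  \<open>m\<close>. Moving either peak further back keeps this outcome, as by acyclicity the peak
  being left is never \<open>m\<close>.\<close>

lemma arrows_meet:
  assumes zm: "(z, m) \<in> arrows h" and cz: "(c, z) \<in> (arrows h)\<^sup>*"
    and e1: "(e1, m) \<in> arrows h" "e1 \<noteq> z" and e: "(e, e1) \<in> (arrows h)\<^sup>*"
  shows "h c e = m"
proof -
  note ac = arrows_acyclic[OF h, unfolded acyclic_def, rule_format]
  have E: "(z, m) \<in> adjacency D" "(m, e1) \<in> adjacency D" "h z m = m" "h m e1 = m"
    using zm e1(1) adjacency_sym unfolding arrows_def by blast+
  have "h z e1 = m \<or> h z e1 = e1" using peak_rule_swap(2)[OF h E(2), of z] E(3) by auto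
  moreover have "h z e1 = m \<or> h z e1 = z" using peak_rule_swap(1)[OF h E(1), of e1] E(4) by auto
  ultimately have 1: "h z e1 = m" using e1(2) by auto
  have 2: "h z e = m"
    using e
  proof (induction rule: converse_rtrancl_induct)
    case (step e e')
    have "e' \<noteq> m" using ac step.hyps(2) e1(1) by (meson rtrancl_into_trancl1)
    then show ?case using peak_rule_swap(2)[OF h, of e e' z] step E_D[OF arrows_E[OF step.hyps(1)]] by auto
  qed (rule 1)
  show ?thesis
    using cz
  proof (induction rule: converse_rtrancl_induct)
    case (step c c')
    have "c' \<noteq> m" using ac step.hyps(2) zm by (meson rtrancl_into_trancl1)
    then show ?case using peak_rule_swap(1)[OF h, of c c' e] step E_D[OF arrows_E[OF step.hyps(1)]] by auto
  qed (rule 2)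
qed

text \<open>Reporting \<open>e\<close> against \<open>e\<close> yields \<open>e\<close>, so
  \<open>m\<close> beats \<open>e\<close> wherever \<open>h c e = m\<close>.
  \<open>behind_outside\<close> gives this at the arrow from \<open>u\<close>, and
  \<open>arrows_meet\<close> if \<open>e\<close> lies behind \<open>m\<close> on another branch. If
  \<open>e\<close> does not lead to \<open>m\<close>, then \<open>m\<close> beats the head of its
  own arrow, which beats \<open>e\<close> by induction.\<close>

lemma next_preferred:
  assumes z: "z \<in> behind" and zm: "(z, m) \<in> arrows h" and P: "P \<in> D" and c: "c \<in> F" "(peak P, c) \<in> R\<^sup>*"
    and cz: "(c, z) \<in> (arrows h)\<^sup>*" and e: "e \<in> F" "(e, z) \<notin> (arrows h)\<^sup>*"
  shows "(m, e) \<in> P"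
proof -
  have "(z, u) \<in> (arrows h)\<^sup>*" using z unfolding behind_def by blast
  then have "(z, m) \<in> arrows h \<longrightarrow> (c, z) \<in> (arrows h)\<^sup>* \<longrightarrow> (e, z) \<notin> (arrows h)\<^sup>* \<longrightarrow> (m, e) \<in> P" for m
  proof (induction arbitrary: m rule: converse_rtrancl_induct)
    case base
    show ?case
    proof (intro impI)
      assume "(u, m) \<in> arrows h" and cu: "(c, u) \<in> (arrows h)\<^sup>*" and eu: "(e, u) \<notin> (arrows h)\<^sup>*"
      then have "m = w" using arrows_single[OF h uw] by blast
      moreover have "h c e = w" using behind_outside cu eu e(1) unfolding behind_def by blast
      ultimately show "(m, e) \<in> P"
        using outcome_preferred[OF h P c, of e e] uwF(2) peak_rule_refl[OF h e(1)] e(1) by simp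
    qed
  next
    case (step z z')
    show ?case
    proof (intro impI)
      assume "(z, m) \<in> arrows h" and cz: "(c, z) \<in> (arrows h)\<^sup>*" and ez: "(e, z) \<notin> (arrows h)\<^sup>*"
      then have m: "m = z'" using arrows_single[OF h step.hyps(1)] by blast
      have cz': "(c, z') \<in> (arrows h)\<^sup>*" using cz step.hyps(1) by (rule rtrancl_into_rtrancl)
      note cz'' = arrows_star[OF h c(1) cz']
      show "(m, e) \<in> P"
      proof (cases "(e, z') \<in> (arrows h)\<^sup>*")
        case True
        show ?thesis
        proof (cases "e = z'")
          case True
          then show ?thesis using m pref_refl[OF P] by simp
        next
          case False
          then obtain e1 where e1: "(e, e1) \<in> (arrows h)\<^sup>*" "(e1, z') \<in> arrows h"
            using True by (metis rtranclE)
          then have "h c e = z'" using arrows_meet[OF step.hyps(1) cz e1(2) _ e1(1)] ez by blast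
          then show ?thesis
            using outcome_preferred[OF h P c, of e e] cz''(3) peak_rule_refl[OF h e(1)] e(1) m by simp
        qed
      next
        case False
        have "z' \<in> behind" using step.hyps(2) unfolding behind_def by blast
        then obtain m' where m': "(z', m') \<in> arrows h" using behind_out by blast
        then have "(m', e) \<in> P" using step.IH cz' False by blast
        moreover have "(z', m') \<in> P"
          using outcome_preferred[OF h P c, of z' m'] cz'' m' unfolding arrows_def by auto
        ultimately show ?thesis using pref_trans[OF P] m by blast
      qed
    qed
  qed
  then show ?thesis using zm cz e(2) by blast
qed

text \<open>The first preference condition comes from \<open>next_preferred\<close>, extended by
  \<open>hanging_out\<close> from \<open>F\<close> to what hangs there. The second is new only at
  \<open>w\<close>, where the cut-off part now hangs.\<close>

lemma hanging_behind: "hanging D (F - behind) (R \<union> {(z, m) \<in> arrows h. z \<in> behind})"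
proof -
  define B where "B = {(z, m) \<in> arrows h. z \<in> behind}"
  let ?S = "R \<union> B"
  note dom = hanging_Domain[OF hang] and notdom = hanging_not_Domain[OF hang]
  have BF: "B \<subseteq> F \<times> F" using E_D arrows_E unfolding B_def by fast
  have BA: "(x, y) \<in> B\<^sup>* \<Longrightarrow> (x, y) \<in> (arrows h)\<^sup>*" for x y
    using rtrancl_mono[of B "arrows h"] unfolding B_def by blast
  have AB: "(c, z) \<in> (arrows h)\<^sup>* \<Longrightarrow> z \<in> behind \<Longrightarrow> (c, z) \<in> B\<^sup>*" for c z
  proof (induction rule: converse_rtrancl_induct)
    case (step c c')
    have "(c, z) \<in> (arrows h)\<^sup>*" using step.hyps by (rule converse_rtrancl_into_rtrancl)
    moreover have "(z, u) \<in> (arrows h)\<^sup>*" using step.prems unfolding behind_def by blast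
    ultimately have "(c, u) \<in> (arrows h)\<^sup>*" by (rule rtrancl_trans)
    then have "(c, c') \<in> B" using step.hyps unfolding B_def behind_def by blast
    with step show ?case by (meson converse_rtrancl_into_rtrancl)
  qed simp
  have RS: "(x, y) \<in> R\<^sup>* \<Longrightarrow> (x, y) \<in> ?S\<^sup>*" for x y using rtrancl_mono[of R ?S] by blast
  have BS: "(x, y) \<in> B\<^sup>* \<Longrightarrow> (x, y) \<in> ?S\<^sup>*" for x y using rtrancl_mono[of B ?S] by blast
  have single: "single_valued ?S"
    using hanging_single[OF hang] arrows_single[OF h] dom BF unfolding single_valued_def B_def by blast
  have "wf ((arrows h)\<inverse>)" using arrows_acyclic[OF h] by (intro finite_acyclic_wf_converse) auto
  then have "wf (B\<inverse>)" by (rule wf_subset) (auto simp: B_def)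
  then have "wf (B\<inverse> \<union> R\<inverse>)" using hanging_wf[OF hang] by (rule wf_Un) (use BF dom in blast)
  then have wf: "wf (?S\<inverse>)" by (simp add: converse_Un Un_commute)
  have "Domain B = behind" using behind_out unfolding B_def by blast
  then have domS: "Domain ?S = - (F - behind)" using dom by auto
  have to_out: "(x, z) \<in> ?S\<^sup>* \<Longrightarrow> z \<notin> F \<Longrightarrow> (x, z) \<in> R\<^sup>*" for x z
  proof (induction rule: converse_rtrancl_induct)
    case (step x y)
    then have "(y, z) \<in> R\<^sup>*" by blast
    then have "y \<notin> F" using notdom step.prems by blast
    then have "(x, y) \<in> R" using step.hyps BF by blast
    with \<open>(y, z) \<in> R\<^sup>*\<close> show ?case by (meson converse_rtrancl_into_rtrancl)
  qed simp
  have to_in: "(x, z) \<in> ?S\<^sup>* \<Longrightarrow> z \<in> F \<Longrightarrow> \<exists>c\<in>F. (x, c) \<in> R\<^sup>* \<and> (c, z) \<in> B\<^sup>*" for x z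
  proof (induction rule: converse_rtrancl_induct)
    case (step x y)
    then obtain c where c: "c \<in> F" "(y, c) \<in> R\<^sup>*" "(c, z) \<in> B\<^sup>*" by blast
    show ?case
    proof (cases "(x, y) \<in> R")
      case True
      then show ?thesis using c by (meson converse_rtrancl_into_rtrancl)
    next
      case False
      then have xy: "(x, y) \<in> B" using step.hyps by blast
      then have "c = y" "x \<in> F" using c notdom BF by blast+
      then show ?thesis using xy c(3) by (meson converse_rtrancl_into_rtrancl rtrancl.rtrancl_refl)
    qed
  qed auto
  have inside: "(m, y) \<in> P"
    if zm: "(z, m) \<in> ?S" and P: "P \<in> D" and x: "(peak P, z) \<in> ?S\<^sup>*" and y: "(y, z) \<notin> ?S\<^sup>*" for z m P y
  proof (cases "(z, m) \<in> R")
    case True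
    then have "z \<notin> F" using dom by blast
    then show ?thesis using hanging_in[OF hang True P to_out[OF x]] y RS by blast
  next
    case False
    then have zm': "(z, m) \<in> arrows h" "z \<in> behind" using zm unfolding B_def by blast+
    obtain c where c: "c \<in> F" "(peak P, c) \<in> R\<^sup>*" "(c, z) \<in> B\<^sup>*"
      using to_in[OF x behind_F[OF zm'(2)]] by blast
    obtain e where e: "e \<in> F" "(y, e) \<in> R\<^sup>*" using hanging_rootE[OF hang] by blast
    have nez: "(e, z) \<notin> (arrows h)\<^sup>*"
    proof
      assume "(e, z) \<in> (arrows h)\<^sup>*"
      then have "(e, z) \<in> ?S\<^sup>*" using AB BS zm'(2) by blast
      then show False using y RS[OF e(2)] by (meson rtrancl_trans)
    qed
    then have me: "(m, e) \<in> P"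
      using next_preferred[OF zm'(2,1) P c(1,2) BA[OF c(3)] e(1)] by blast
    have "(peak P, e) \<notin> R\<^sup>*"
      using hanging_root_unique[OF hang e(1) c(1)] c(2) BA[OF c(3)] nez by blast
    then have "(e, y) \<in> P" using hanging_out[OF hang e(1) P _ e(2)] by blast
    then show ?thesis using me pref_trans[OF P] by blast
  qed
  have outside: "(c', y) \<in> P"
    if c': "c' \<in> F - behind" and P: "P \<in> D" and x: "(peak P, c') \<notin> ?S\<^sup>*" and y: "(y, c') \<in> ?S\<^sup>*" for c' P y
  proof -
    obtain e where e: "e \<in> F" "(y, e) \<in> R\<^sup>*" "(e, c') \<in> B\<^sup>*" using to_in[OF y] c' by blast
    show ?thesis
    proof (cases "e = c'")
      case True
      then show ?thesis using hanging_out[OF hang _ P] e c' x RS by blast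
    next
      case False
      then obtain k where k: "(k, c') \<in> B" using e(3) by (metis rtranclE)
      then have c'w: "c' = w" using behind_step[of k c'] c' unfolding B_def by blast
      obtain e' where "(e, e') \<in> B" using e(3) False by (metis converse_rtranclE)
      then have eb: "e \<in> behind" unfolding B_def by blast
      obtain c where c: "c \<in> F" "(peak P, c) \<in> R\<^sup>*" using hanging_rootE[OF hang] by blast
      have cb: "c \<notin> behind"
      proof
        assume cb: "c \<in> behind"
        have ub: "u \<in> behind" unfolding behind_def by blast
        have "(c, u) \<in> B\<^sup>*" using AB cb ub unfolding behind_def by blast
        moreover have "(u, w) \<in> B" using uw ub unfolding B_def by blast
        ultimately have "(c, w) \<in> B\<^sup>*" by (rule rtrancl_into_rtrancl)
        then have "(peak P, w) \<in> ?S\<^sup>*" using RS[OF c(2)] BS by (meson rtrancl_trans)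
        then show False using x c'w by simp
      qed
      \<comment> \<open>\<open>behind_outside\<close> wants the peak behind the arrow to be the
        first one, so \<open>P\<close> belongs to the second voter here.\<close>
      have "(w, e) \<in> P"
        using outcome_preferred[OF peak_rule_flip[OF h] P c, of e e] behind_outside[OF eb c(1) cb]
          peak_rule_refl[OF h e(1)] e(1) uwF(2) by simp
      moreover have "(peak P, e) \<notin> R\<^sup>*"
        using hanging_root_unique[OF hang e(1) c(1)] c(2) eb cb by blast
      then have "(e, y) \<in> P" using hanging_out[OF hang e(1) P _ e(2)] by blast
      ultimately show ?thesis using pref_trans[OF P] c'w by blast
    qed
  qed
  show ?thesis unfolding B_def[symmetric]
    unfolding hanging_def using single wf domS inside outside by blast
qed

lemma w_leaf:
  assumes "F - behind = {w}"
  shows "w \<in> leaves_in (adjacency D) F"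
proof -
  have "y = u" if "y \<in> F" "(w, y) \<in> adjacency D" for y
  proof -
    have yw: "(y, w) \<in> E" using that uwF(2) adjacency_sym by blast
    then have "y \<in> behind" using E_D[OF yw] assms that by blast
    then show ?thesis using behind_cut[OF _ yw] w_not_behind by blast
  qed
  moreover have "(w, u) \<in> adjacency D" using E_D[OF E_sym[OF arrows_E[OF uw]]] by blast
  ultimately have "neighbors_in (adjacency D) F w = {u}"
    using uwF unfolding neighbors_in_def by blast
  then show ?thesis using uwF unfolding leaves_in_def by simp
qed

text \<open>Built to contradict minimality: condition (ii) of semi-hybrid domains if two
  alternatives remain, condition (iii) if only the leaf \<open>v\<close> does.\<close>

lemma arrow_cut:
  "\<exists>F' R' v. hanging D F' R' \<and> F' \<subset> F \<and> v \<in> F' \<and> (F' = {v} \<longrightarrow> v \<in> leaves_in (adjacency D) F)"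
proof (intro exI conjI)
  show "hanging D (F - behind) (R \<union> {(z, m) \<in> arrows h. z \<in> behind})" by (rule hanging_behind)
  show "F - behind \<subset> F" using uwF(1) unfolding behind_def by blast
  show "w \<in> F - behind" using uwF(2) w_not_behind by blast
  show "F - behind = {w} \<longrightarrow> w \<in> leaves_in (adjacency D) F" using w_leaf by blast
qed

end

section \<open>Dictatorship in the absence of arrows\<close>

lemma first_everywhere:
  assumes h: "peak_rule F h" and modes: "\<And>x y. (x, y) \<in> E \<Longrightarrow> h x y = x \<and> h y x = y \<or> h x y = y \<and> h y x = x"
    and pq: "(p, q) \<in> E" "h p q = p" and xy: "x \<in> F" "y \<in> F"
  shows "h x y = x"
proof -
  define X where "X x \<longleftrightarrow> (\<forall>y. (x, y) \<in> E \<longrightarrow> h x y = x)" for x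
  have start: "X p" if pq: "(p, q) \<in> E" "h p q = p" for p q
    unfolding X_def
  proof (intro allI impI)
    fix c assume c: "(p, c) \<in> E"
    have "h q p = q" using modes[OF pq(1)] pq(2) E_D[OF pq(1)] by auto
    then show "h p c = p"
      using edge_forward[OF h E_sym[OF pq(1)] c] pq(2) by (cases "c = q") auto
  qed
  have X: "X x" if "x \<in> F" for x
  proof -
    have "p \<in> F" using pq by blast
    from connected_free_zone[OF conn hang this that] show ?thesis
    proof (induction rule: rtrancl_induct)
      case base
      show ?case using start[OF pq] .
    next
      case (step y z)
      then have "h y z = y" unfolding X_def by blast
      then have "h z y = z" using modes[OF step.hyps(2)] E_D[OF step.hyps(2)] by auto
      then show ?case using start[OF E_sym[OF step.hyps(2)]] by blast
    qed
  qed
  from connected_free_zone[OF conn hang xy] show ?thesis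
  proof (induction rule: converse_rtrancl_induct)
    case base
    show ?case using peak_rule_refl[OF h xy(2)] .
  next
    case (step x x')
    then show ?case using first_step[OF h step.hyps(1) _ step.IH] X unfolding X_def by blast
  qed
qed

lemma peak_rule_dictatorial:
  assumes h: "peak_rule F h"
    and minimal: "\<not> (\<exists>F' R' v. hanging D F' R' \<and> F' \<subset> F \<and> v \<in> F' \<and> (F' = {v} \<longrightarrow> v \<in> leaves_in (adjacency D) F))"
  shows "(\<forall>x\<in>F. \<forall>y\<in>F. h x y = x) \<or> (\<forall>x\<in>F. \<forall>y\<in>F. h x y = y)"
proof -
  note h' = peak_rule_flip[OF h]
  have no_arrow: "arrows h = {}"
  proof (rule ccontr)
    assume "arrows h \<noteq> {}"
    then obtain w0 where "w0 \<in> Range (arrows h)" by fast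
    moreover have "wf ((arrows h)\<inverse>)"
      using arrows_acyclic[OF h] by (intro finite_acyclic_wf_converse) auto
    ultimately obtain w where w: "w \<in> Range (arrows h)" "\<And>y. (y, w) \<in> (arrows h)\<inverse> \<Longrightarrow> y \<notin> Range (arrows h)"
      by (meson wfE_min)
    then obtain u where uw: "(u, w) \<in> arrows h" by blast
    have no: "(w, y) \<notin> arrows h" for y using w(2) by blast
    \<comment> \<open>If the second voter with peak \<open>w\<close> loses to peak \<open>y\<close>,
      then \<open>edge_forward\<close> lets the first win with peak \<open>w\<close> against the
      other neighbours, and against \<open>y\<close> she wins because no arrow leaves
      \<open>w\<close>.\<close>
    have "(\<forall>y. (w, y) \<in> E \<longrightarrow> h w y = w) \<or> (\<forall>y. (w, y) \<in> E \<longrightarrow> h y w = w)"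
    proof (rule disjCI)
      assume "\<not> (\<forall>y. (w, y) \<in> E \<longrightarrow> h y w = w)"
      then obtain y where y: "(w, y) \<in> E" "h y w \<noteq> w" by blast
      then have yw: "h y w = y" using edge_values[OF h E_sym[OF y(1)]] by blast
      have "h w y' = w" if y': "(w, y') \<in> E" for y'
      proof (cases "y' = y")
        case True
        then show ?thesis using no[of y] y(1) yw edge_values[OF h y(1)] unfolding arrows_def by blast
      next
        case False
        then show ?thesis using edge_forward[OF h E_sym[OF y(1)] y'] yw by blast
      qed
      then show "\<forall>y. (w, y) \<in> E \<longrightarrow> h w y = w" by blast
    qed
    then have "\<exists>F' R' v. hanging D F' R' \<and> F' \<subset> F \<and> v \<in> F' \<and>
        (F' = {v} \<longrightarrow> v \<in> leaves_in (adjacency D) F)"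
    proof
      assume a: "\<forall>y. (w, y) \<in> E \<longrightarrow> h w y = w"
      have "h w y = w" if "(w, y) \<in> E" for y using a[THEN spec, THEN mp, OF that] .
      from arrow_cut[OF h uw this] show ?thesis .
    next
      assume a: "\<forall>y. (w, y) \<in> E \<longrightarrow> h y w = w"
      have uw': "(u, w) \<in> arrows (\<lambda>x y. h y x)" using uw unfolding arrows_def by blast
      have "h y w = w" if "(w, y) \<in> E" for y using a[THEN spec, THEN mp, OF that] .
      from arrow_cut[OF h' uw' this] show ?thesis .
    qed
    with minimal show False by (rule notE)
  qed
  have modes: "h x y = x \<and> h y x = y \<or> h x y = y \<and> h y x = x" if xy: "(x, y) \<in> E" for x y
    using no_arrow edge_values[OF h xy] edge_values[OF h E_sym[OF xy]] xy E_sym[OF xy]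
    unfolding arrows_def by blast
  show ?thesis
  proof (cases "\<exists>p q. (p, q) \<in> E")
    case True
    then obtain p q where pq: "(p, q) \<in> E" by blast
    have modes': "h y x = x \<and> h x y = y \<or> h y x = y \<and> h x y = x" if "(x, y) \<in> E" for x y
      using modes[OF that] by blast
    show ?thesis
    proof (cases "h p q = p")
      case True
      then show ?thesis using first_everywhere[OF h modes pq] by blast
    next
      case False
      then have "h q p = p" using modes[OF pq] by blast
      then show ?thesis using first_everywhere[OF h' modes' pq] by blast
    qed
  next
    case False
    have "x = y" if "x \<in> F" "y \<in> F" for x y
      using connected_free_zone[OF conn hang that] False by (metis converse_rtranclE)
    then show ?thesis using peak_rule_refl[OF h] by metis
  qed
qed

lemma dictatorial2_free_zone:
  assumes g: "rule2 True F g"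
    and minimal: "\<not> (\<exists>F' R' v. hanging D F' R' \<and> F' \<subset> F \<and> v \<in> F' \<and> (F' = {v} \<longrightarrow> v \<in> leaves_in (adjacency D) F))"
  shows "dictatorial2 F g"
proof -
  define s where "s x = (SOME P. P \<in> D \<and> peak P = x)" for x
  have s: "s x \<in> D" "peak (s x) = x" for x
    using someI_ex[of "\<lambda>P. P \<in> D \<and> peak P = x"] all_peaks[OF conn, of x] unfolding s_def by blast+
  define h where "h x y = g (s x) (s y)" for x y
  have gh: "g P Q = h (peak P) (peak Q)" if "P \<in> D" "Q \<in> D" for P Q
    using g that s unfolding rule2_def h_def by metis
  have "(h (peak P) y, h x y) \<in> P" "(h y (peak P), h y x) \<in> P" if "P \<in> D" for P x y
    using rule2_sp[OF g that s(1)[of x] s(1)[of y]] gh[OF that s(1)] gh[OF s(1) that] gh[OF s(1) s(1)] s(2) by simp_all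
  moreover have "h x x = x" if "x \<in> F" for x
    using rule2_unanimous[OF g s(1) s(1), of x x] s(2) that unfolding h_def by simp
  ultimately have "peak_rule F h" unfolding peak_rule_def by blast
  from peak_rule_dictatorial[OF this minimal] show ?thesis
    unfolding dictatorial2_def using gh by (elim disjE) simp_all
qed

end
end

section \<open>The corollary\<close>

context preferences
begin

lemma is_rule_imp_ruleN:
  assumes "is_rule D n f" "strategy_proof D n f" "tops \<longrightarrow> tops_only D n f"
  shows "ruleN tops F {1..n} (\<lambda>P. f (restrict P {1..n}))"
proof -
  have prof: "restrict P {1..n} \<in> profiles D n" if "\<forall>k\<in>{1..n}. P k \<in> D" for P
    using that unfolding profiles_def by auto
  have "(f (restrict P {1..n}), f (restrict (P(i := Q)) {1..n})) \<in> P i"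
    if P: "\<forall>k\<in>{1..n}. P k \<in> D" and i: "i \<in> {1..n}" and Q: "Q \<in> D" for P i Q
  proof -
    have eq: "restrict (P(i := Q)) {1..n} = (restrict P {1..n})(i := Q)"
      using i by (auto simp: fun_eq_iff)
    have "f (restrict P {1..n}) = f ((restrict P {1..n})(i := Q)) \<or>
        (f (restrict P {1..n}), f ((restrict P {1..n})(i := Q))) \<in> restrict P {1..n} i"
      using assms(2) prof[OF P] i Q unfolding strategy_proof_def by blast
    moreover have "P i \<in> D" using P i by blast
    ultimately show ?thesis using pref_refl[of "P i"] i unfolding eq by auto
  qed
  moreover have "f (restrict P {1..n}) = x" if P: "\<forall>k\<in>{1..n}. P k \<in> D \<and> peak (P k) = x" for P x
  proof -
    have "\<forall>k\<in>{1..n}. peak (restrict P {1..n} k) = x" "restrict P {1..n} \<in> profiles D n"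
      using P prof by auto
    then show ?thesis using assms(1) unfolding is_rule_def by blast
  qed
  moreover have "f (restrict P {1..n}) = f (restrict P' {1..n})"
    if tops and P: "\<forall>k\<in>{1..n}. P k \<in> D \<and> P' k \<in> D \<and> peak (P k) = peak (P' k)" for P P'
  proof -
    have "\<forall>k\<in>{1..n}. peak (restrict P {1..n} k) = peak (restrict P' {1..n} k)" using P by simp
    moreover have "restrict P {1..n} \<in> profiles D n" "restrict P' {1..n} \<in> profiles D n"
      using P prof by blast+
    ultimately show ?thesis using assms(3) \<open>tops\<close> unfolding tops_only_def by blast
  qed
  moreover have "f (restrict P {1..n}) = f (restrict P' {1..n})" if "\<forall>k\<in>{1..n}. P k = P' k" for P P'
    using that by (intro arg_cong[where f = f] restrict_ext) simp
  ultimately show ?thesis unfolding ruleN_def by blast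
qed

lemma dictatorship_on_if_dictatorial2:
  assumes conn: "path_connected_domain D" and two: "\<And>h. rule2 tops F h \<Longrightarrow> dictatorial2 F h"
    and ab: "a \<in> F" "b \<in> F" "a \<noteq> b" and n: "n \<ge> 2"
    and f: "is_rule D n f" "strategy_proof D n f" "tops \<longrightarrow> tops_only D n f"
  shows "dictatorship_on D n f F"
proof -
  have "finite {1..n}" "card {1..n} \<ge> 2" using n by auto
  from ruleN_dictatorial[OF two all_peaks[OF conn] ab this is_rule_imp_ruleN[OF f]]
  obtain i where i: "i \<in> {1..n}"
    "\<And>P. \<forall>k\<in>{1..n}. P k \<in> D \<and> peak (P k) \<in> F \<Longrightarrow> f (restrict P {1..n}) = peak (P i)" by blast
  have "f P = peak (P i)" if P: "P \<in> profiles D n" "\<forall>j\<in>{1..n}. peak (P j) \<in> F" for P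
  proof -
    have "restrict P {1..n} = P" using P(1) unfolding profiles_def by (simp add: PiE_restrict)
    moreover have "\<forall>k\<in>{1..n}. P k \<in> D \<and> peak (P k) \<in> F" using P unfolding profiles_def by auto
    ultimately show ?thesis using i(2)[of P] by simp
  qed
  then show ?thesis using i(1) ab unfolding dictatorship_on_def by blast
qed

lemma non_dictatorial_unique_seconds:
  assumes "path_connected_domain D" "leaf_symmetric D" "non_dictatorial D"
  shows "unique_seconds D"
proof (rule ccontr)
  assume nus: "\<not> unique_seconds D"
  obtain n f where f: "n \<ge> 2" "is_rule D n f" "strategy_proof D n f" "\<not> dictatorship D n f"
    using assms(3) unfolding non_dictatorial_def by blast
  have two: "dictatorial2 UNIV h" if "rule2 False UNIV h" for h
    using dictatorial2_if_not_unique_seconds[OF assms(1,2) nus that] .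
  obtain x y where "(x, y) \<in> adjacency D" using neighbor_exists[OF assms(1)] by blast
  then have "x \<noteq> y" by (rule adjacency_irrefl)
  then have "dictatorship_on D n f UNIV"
    using dictatorship_on_if_dictatorial2[OF assms(1) two UNIV_I UNIV_I _ f(1-3)] by blast
  then show False using f(4) unfolding dictatorship_on_def dictatorship_def by blast
qed

text \<open>The weak superset in the theorem is the free zone itself.\<close>

lemma free_zone_dictatorship:
  assumes div: "diverse D" and SH: "semi_hybrid_on D T a b" and n: "n \<ge> 2"
    and f: "is_rule D n f" "tops_only D n f" "strategy_proof D n f"
  shows "dictatorship_on D n f (path_verts T a b)"
proof -
  let ?F = "path_verts T a b"
  have T: "is_tree T" "dual_thresholds T a b" "D \<subseteq> SH_prefs T a b" and conn: "path_connected_domain D"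
    and ii: "\<not> (\<exists>T' a' b'. is_tree T' \<and> dual_thresholds T' a' b' \<and>
          D \<subseteq> SH_prefs T' a' b' \<and> path_verts T' a' b' \<subset> ?F)"
    and iii: "is_tree (adjacency D) \<Longrightarrow> x \<in> leaves_in (adjacency D) ?F \<Longrightarrow>
           \<exists>P\<in>D. \<not> semi_single_peaked (adjacency D) x P" for x
    using SH unfolding semi_hybrid_on_def by blast+
  obtain R where hang: "hanging D ?F R" using semi_hybrid_hanging[OF T] by blast
  have minimal: "\<not> (\<exists>F' R' v. hanging D F' R' \<and> F' \<subset> ?F \<and> v \<in> F' \<and> (F' = {v} \<longrightarrow> v \<in> leaves_in (adjacency D) ?F))"
  proof (intro notI, elim exE conjE)
    fix F' R' v
    assume hang': "hanging D F' R'" and F': "F' \<subset> ?F" "v \<in> F'" "F' = {v} \<longrightarrow> v \<in> leaves_in (adjacency D) ?F"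
    show False
    proof (cases "F' = {v}")
      case True
      note S = hanging_singleton[OF hang'[unfolded True] conn]
      obtain P where "P \<in> D" "\<not> semi_single_peaked (adjacency D) v P"
        using iii[OF S(1)] F'(3) True by blast
      then show False using S(2) unfolding SSP_prefs_def by blast
    next
      case False
      then obtain v' where "v' \<in> F'" "v' \<noteq> v" using F'(2) by blast
      then have "card {v, v'} \<le> card F'" using F'(2) by (intro card_mono) auto
      then have "card F' \<ge> 2" using \<open>v' \<noteq> v\<close> by simp
      from hanging_semi_hybrid[OF div hang' this] show False using ii F'(1) by blast
    qed
  qed
  have "a \<in> ?F" "b \<in> ?F" "a \<noteq> b"
    using path_verts_ends[OF T(1)] T(2) unfolding dual_thresholds_def by auto
  then show ?thesis
    using dictatorship_on_if_dictatorial2[where tops = True, OF conn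
        dictatorial2_free_zone[OF conn hang _ minimal] _ _ _ n f(1,3)] f(2) by blast
qed

text \<open>Exchanging the dictator, with peak \<open>a\<close>, and a voter with peak
  \<open>b\<close> changes the outcome.\<close>

lemma not_anonymous_if_dictatorship_on:
  assumes conn: "path_connected_domain D" and n: "n \<ge> 2" and ab: "a \<in> F" "b \<in> F" "a \<noteq> b"
    and dict: "dictatorship_on D n f F"
  shows "\<not> anonymous D n f"
proof
  assume anon: "anonymous D n f"
  obtain i where i: "i \<in> {1..n}"
    and f: "\<And>P. P \<in> profiles D n \<Longrightarrow> \<forall>j\<in>{1..n}. peak (P j) \<in> F \<Longrightarrow> f P = peak (P i)"
    using dict unfolding dictatorship_on_def by blast
  obtain A where A: "A \<in> D" "peak A = a" using all_peaks[OF conn] by blast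
  obtain B where B: "B \<in> D" "peak B = b" using all_peaks[OF conn] by blast
  define j :: nat where "j = (if i = 1 then 2 else 1)"
  have j: "j \<in> {1..n}" "j \<noteq> i" using n unfolding j_def by auto
  define P where "P = restrict (\<lambda>k. if k = i then A else B) {1..n}"
  have P: "P \<in> profiles D n" "\<forall>k\<in>{1..n}. peak (P k) \<in> F"
    using A B ab unfolding P_def profiles_def by auto
  let ?s = "Transposition.transpose i j"
  have s: "?s permutes {1..n}" using i j by (intro permutes_swap_id)
  have "P \<circ> ?s \<in> profiles D n"
    using P(1) permutes_in_image[OF s] permutes_not_in[OF s]
    unfolding profiles_def PiE_def Pi_def extensional_def by auto
  moreover have "\<forall>k\<in>{1..n}. peak ((P \<circ> ?s) k) \<in> F"
    using P(2) permutes_in_image[OF s] by auto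
  ultimately have "f (P \<circ> ?s) = peak (P j)" using f[of "P \<circ> ?s"] by simp
  moreover have "f P = peak (P i)" using f P by blast
  moreover have "f P = f (P \<circ> ?s)" using anon P(1) s unfolding anonymous_def by blast
  ultimately show False using A B ab i j unfolding P_def by simp
qed

lemma semi_hybrid_domain_exists:
  assumes conn: "path_connected_domain D" and div: "diverse D" and nSSP: "\<not> semi_single_peaked_domain D"
  shows "semi_hybrid_domain D"
proof -
  define good where "good t \<longleftrightarrow> (case t of (T, a, b) \<Rightarrow>
    is_tree T \<and> dual_thresholds T a b \<and> D \<subseteq> SH_prefs T a b)" for t :: "'a rel \<times> 'a \<times> 'a"
  define size where "size t = (case t of (T, a, b) \<Rightarrow> card (path_verts T a b))" for t :: "'a rel \<times> 'a \<times> 'a"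
  have "hanging D UNIV {}" unfolding hanging_def using pref_refl by auto
  from hanging_semi_hybrid[OF div this] card_ge_3 obtain t where "good t"
    unfolding good_def by auto
  then obtain t where t: "good t" "\<And>t'. good t' \<Longrightarrow> size t \<le> size t'"
    using ex_has_least_nat[of good t size] by blast
  obtain T a b where T: "t = (T, a, b)" by (cases t)
  have "\<not> path_verts T' a' b' \<subset> path_verts T a b" if "good (T', a', b')" for T' a' b'
    using t(2)[OF that] psubset_card_mono[of "path_verts T a b" "path_verts T' a' b'"]
    unfolding T size_def by auto
  \<comment> \<open>Condition (iii) even holds at every alternative, for otherwise the adjacency
    tree would witness semi-single-peakedness.\<close>
  moreover have "\<exists>P\<in>D. \<not> semi_single_peaked (adjacency D) x P" if "is_tree (adjacency D)" for x
    using nSSP conn that linear unfolding semi_single_peaked_domain_def SSP_prefs_def by blast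
  ultimately have "semi_hybrid_on D T a b"
    using t(1) conn unfolding semi_hybrid_on_def good_def T by auto
  then show ?thesis unfolding semi_hybrid_domain_def by blast
qed

end

theorem corollary1:
  fixes D :: "('a::finite) pref set"
  assumes "CARD('a) \<ge> 3"
    and "preference_domain D"
    and "non_dictatorial D"
    and "unidimensional D"
  shows
    "((\<exists>n\<ge>2. \<exists>f. is_rule D n f \<and> anonymous D n f \<and> tops_only D n f \<and> strategy_proof D n f)
        \<longleftrightarrow> semi_single_peaked_domain D) \<and>
     ((\<exists>n\<ge>2. \<exists>f. is_rule D n f \<and> anonymous D n f \<and> tops_only D n f \<and> strategy_proof D n f)
        \<longleftrightarrow> (\<exists>n\<ge>2. \<exists>f. projection_rule D n f \<and> strategy_proof D n f)) \<and>
     ((\<forall>n\<ge>2. \<not> (\<exists>f. is_rule D n f \<and> anonymous D n f \<and> tops_only D n f \<and> strategy_proof D n f))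
        \<longleftrightarrow> semi_hybrid_domain D \<and> unique_seconds D) \<and>
     (semi_hybrid_domain D \<and> unique_seconds D \<longrightarrow>
        (\<forall>T a b n f. semi_hybrid_on D T a b \<longrightarrow> n \<ge> 2 \<longrightarrow>
           is_rule D n f \<longrightarrow> tops_only D n f \<longrightarrow> strategy_proof D n f \<longrightarrow>
             (\<exists>B. path_verts T a b \<subseteq> B \<and> dictatorship_on D n f B)))"
proof -
  interpret preferences D using assms(1,2) by unfold_locales
  have conn: "path_connected_domain D" and div: "diverse D" and leaf: "leaf_symmetric D"
    using assms(4) unfolding unidimensional_def by auto
  define good where "good n f \<longleftrightarrow> is_rule D n f \<and> anonymous D n f \<and> tops_only D n f \<and> strategy_proof D n f" for n f
  have US: "unique_seconds D" using non_dictatorial_unique_seconds[OF conn leaf assms(3)] .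
  have fz: "dictatorship_on D n f (path_verts T a b)"
    if "semi_hybrid_on D T a b" "n \<ge> 2" "is_rule D n f" "tops_only D n f" "strategy_proof D n f" for T a b n f
    using free_zone_dictatorship[OF div that] .
  have not_good: "\<not> good n f" if SH: "semi_hybrid_domain D" and n: "n \<ge> 2" for n f
  proof
    assume g: "good n f"
    obtain T a b where T: "semi_hybrid_on D T a b" using SH unfolding semi_hybrid_domain_def by blast
    then have "is_tree T" "a \<noteq> b" unfolding semi_hybrid_on_def dual_thresholds_def by blast+
    then show False
      using not_anonymous_if_dictatorship_on[OF conn n, of a "path_verts T a b" b f]
        path_verts_ends[of T] fz[OF T n] g unfolding good_def by blast
  qed
  have SSP_proj: "\<exists>n\<ge>2. \<exists>f. projection_rule D n f \<and> strategy_proof D n f" if SSP: "semi_single_peaked_domain D"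
  proof -
    obtain T xb where T: "is_tree T" "D \<subseteq> SSP_prefs T xb"
      using SSP unfolding semi_single_peaked_domain_def by blast
    have "projection_rule D 2 (\<lambda>P. proj T xb (spanned_subtree T ((\<lambda>i. peak (P i)) ` {1..2})))"
      using T(1) unfolding projection_rule_def by blast
    then show ?thesis using SSP_projection_strategy_proof[OF T] by blast
  qed
  have proj_good: "\<exists>n\<ge>2. \<exists>f. good n f" if "\<exists>n\<ge>2. \<exists>f. projection_rule D n f \<and> strategy_proof D n f"
    using that projection_rule_properties unfolding good_def by blast
  have good_SSP: "semi_single_peaked_domain D" if "\<exists>n\<ge>2. \<exists>f. good n f"
    using that not_good semi_hybrid_domain_exists[OF conn div] by blast
  \<comment> \<open>The three preceding implications form a cycle.\<close>
  have "(\<exists>n\<ge>2. \<exists>f. good n f) \<longleftrightarrow> semi_single_peaked_domain D"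
    using good_SSP SSP_proj proj_good by blast
  note 1 = this[unfolded good_def]
  have "(\<exists>n\<ge>2. \<exists>f. good n f) \<longleftrightarrow> (\<exists>n\<ge>2. \<exists>f. projection_rule D n f \<and> strategy_proof D n f)"
    using good_SSP SSP_proj proj_good by blast
  note 2 = this[unfolded good_def]
  have "(\<forall>n\<ge>2. \<not> (\<exists>f. good n f)) \<longleftrightarrow> semi_hybrid_domain D \<and> unique_seconds D"
    using not_good semi_hybrid_domain_exists[OF conn div] SSP_proj proj_good US by blast
  note 3 = this[unfolded good_def]
  show ?thesis
  proof (intro conjI impI allI)
    fix T a b n f
    assume "semi_hybrid_on D T a b" "n \<ge> 2" "is_rule D n f" "tops_only D n f" "strategy_proof D n f"
    from fz[OF this] show "\<exists>B. path_verts T a b \<subseteq> B \<and> dictatorship_on D n f B" by blast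
  qed (fact 1, fact 2, fact 3)
qed

end
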